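(* Let $\lambda$ be an essentially regular point for the pair $(\mathcal A,F)$. Let $H_0\in\mathcal A$ be an operator regular at $\lambda$ and let $V=F^*JF\in\mathcal A_0(F)$. Let $r_\lambda\in\mathbb R$ be a resonance point of the path $\{H_r=H_0+rV:r\in\mathbb R\}$. The following assertions (each with either choice of sign) are all equivalent to $r_\lambda$ being of type I. (i$_\pm$) For any regular point $r$, $\sqrt{\operatorname{Im}T_{\lambda+i0}(H_r)}\,JP_{\lambda\pm i0}(r_\lambda)=0$. (i$^*_\pm$) There exists a regular point $r$ such that $\sqrt{\operatorname{Im}T_{\lambda+i0}(H_r)}\,JP_{\lambda\pm i0}(r_\lambda)=0$. (ii$_\pm$) For any regular point $r$, $\sqrt{\operatorname{Im}T_{\lambda+i0}(H_r)}\,Q_{\lambda\pm i0}(r_\lambda)=0$. (ii$^*_\pm$) There exists a regular point $r$ such that $\sqrt{\operatorname{Im}T_{\lambda+i0}(H_r)}\,Q_{\lambda\pm i0}(r_\lambda)=0$. (iii$_\pm$) The meromorphic function $w_\pm(s):=\sqrt{\operatorname{Im}T_{\lambda+i0}(H_0)}\,[1+sJT_{\lambda\pm i0}(H_0)]^{-1}$ is holomorphic at $s=r_\lambda$. (iii$'_\pm$) The meromorphic function $w_\pm(s)J=\sqrt{\operatorname{Im}T_{\lambda+i0}(H_0)}\,J[1+sT_{\lambda\pm i0}(H_0)J]^{-1}$ is holomorphic at $s=r_\lambda$. (iv$_\pm$) The meromorphic function $w^\dagger_\pm(s)=[1+sT_{\lambda\mp i0}(H_0)J]^{-1}\sqrt{\operatorname{Im}T_{\lambda+i0}(H_0)}$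 is holomorphic at $s=r_\lambda$. (v$_\pm$) The residue of the function $w_\pm(s)$ at $s=r_\lambda$ is zero. (vi$_\pm$) For all vectors $u\in\Upsilon_{\lambda\pm i0}(r_\lambda)$ the real numbers $c_{\pm j}$ are all zero. (vii) The function $s\mapsto\operatorname{Im}T_{\lambda+i0}(H_s)$ is holomorphic at $s=r_\lambda$. (viii) The function $s\mapsto J\operatorname{Im}T_{\lambda+i0}(H_s)J$ is holomorphic at $s=r_\lambda$. Moreover, the assertions obtained from (i$_\pm$)–(ii$_\pm$) and (i$^*_\pm$)–(ii$^*_\pm$) by removing the square root are also equivalent to these ones.
   Context: Setting. Scalar products are linear in the second argument. $\mathcal H,\mathcal K$ are complex separable Hilbert spaces. $F:\mathcal H\to\mathcal K$ is a closed densely defined operator with trivial kernel and co-kernel (the rigging operator). $\mathcal A_0(F)$ is a real vector space of self-adjoint operators $V=F^*JF$ on $\mathcal H$, with $J$ running over a real subspace of the bounded self-adjoint operators on $\mathcal K$, and $\mathcal A=H+\mathcal A_0(F)$ is an affine space of self-adjoint operators. Standing assumptions: all $H\in\mathcal A$ have a common dense domain $\mathcal D$; $\mathcal D\subset\operatorname{dom}(F)$ and $\mathcal D\subset\operatorname{dom}(V)$ for all $V\in\mathcal A_0(F)$; every $V\in\mathcal A_0(F)$ is relatively compact with respect to every $H\in\mathcal A$; and for non-real $z$ the operator $T_z(H):=F(H-z)^{-1}F^*$ (densely defined on $\operatorname{dom}F^*$) extends to a compact operator on $\mathcal K$, also denoted $T_z(H)$. $\Lambda(H,F)$ is the set of real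 $\lambda$ for which the norm limits $T_{\lambda\pm i0}(H):=\lim_{y\to0^+}T_{\lambda\pm iy}(H)$ exist; it is assumed to have full Lebesgue measure for every $H\in\mathcal A$. Elements of $\bigcup_{H\in\mathcal A}\Lambda(H,F)$ are the essentially regular points of $(\mathcal A,F)$. $H$ is regular at $\lambda$ if $\lambda\in\Lambda(H,F)$ and resonant otherwise; a real $r$ is a regular (non-resonant) point if $H_r$ is regular at $\lambda$, otherwise a real resonance point. $\operatorname{Im}T=(T-T^* )/(2i)$. For $z=\lambda\pm i0$ and regular $s$ put $A_z(s)=T_z(H_s)J$, $B_z(s)=JT_z(H_s)$; as functions of $s$ they extend meromorphically to $\mathbb C$, their real poles being the real resonance points. $P_z(r_\lambda)=\frac1{2\pi i}\oint_{C(r_\lambda)}A_z(s)\,ds$, $Q_z(r_\lambda)=\frac1{2\pi i}\oint_{C(r_\lambda)}B_z(s)\,ds$, $\mathbf A_z(r_\lambda)=\frac1{2\pi i}\oint_{C(r_\lambda)}(s-r_\lambda)A_z(s)\,ds$, with $C(r_\lambda)$ a small counter-clockwise circle around $r_\lambda$ enclosing no other poles; $\Upsilon_z(r_\lambda)=\operatorname{im}P_z(r_\lambda)$ is the space of vectors $u$ with $(1+(r_\lambda-s)A_z(s))^ku=0$ for some $k\ge1$. The function $s\mapsto\operatorname{Im}T_{\lambda+i0}(H_s)$, defined for regular real $s$, is identified with its meromorphic continuation to complex $s$. Type I: a real resonance point $r_\lambda$ is of type I if $\sqrt{\operatorname{Im}T_{\lambda+i0}(H_s)}\,JP_{\lambda+i0}(r_\lambda)=0$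 for some regular real $s$. For $u\in\Upsilon_{\lambda\pm i0}(r_\lambda)$, the numbers $c_{\pm j}$, $j\ge2$, are $c_{\pm j}=\operatorname{Im}\langle u,J\mathbf A^{j-1}_{\lambda\pm i0}(r_\lambda)u\rangle$; they are the coefficients in the finite expansion $\langle Ju,\operatorname{Im}T_{\lambda\pm i0}(H_s)Ju\rangle=\sum_{j\ge2}c_{\pm j}(s-r_\lambda)^{-j}$ valid for all regular $s$. *)

theory Defs
  imports "HOL-Complex_Analysis.Complex_Analysis"
begin

section \<open>Complex Hilbert spaces\<close>

class scaleC =
  fixes scaleC :: "complex \<Rightarrow> 'a \<Rightarrow> 'a"  (infixr \<open>*\<^sub>C\<close> 75)

class complex_normed_vector = scaleC + real_normed_vector +
  assumes scaleC_add_right: "a *\<^sub>C (x + y) = a *\<^sub>C x + a *\<^sub>C y"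
    and scaleC_add_left: "(a + b) *\<^sub>C x = a *\<^sub>C x + b *\<^sub>C x"
    and scaleC_scaleC: "a *\<^sub>C (b *\<^sub>C x) = (a * b) *\<^sub>C x"
    and scaleR_scaleC: "r *\<^sub>R x = complex_of_real r *\<^sub>C x"
    and norm_scaleC: "norm (a *\<^sub>C x) = cmod a * norm x"

text \<open>Scalar products are conjugate-linear in the first and linear in the second argument.\<close>

class complex_hilbert = complex_normed_vector + complete_space +
  fixes cinner :: "'a \<Rightarrow> 'a \<Rightarrow> complex"
  assumes cinner_commute: "cinner x y = cnj (cinner y x)"
    and cinner_add_right: "cinner x (y + z) = cinner x y + cinner x z"
    and cinner_scaleC_right: "cinner x (a *\<^sub>C y) = a * cinner x y"
    and cinner_self: "cinner x x = complex_of_real ((norm x)\<^sup>2)"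

instantiation complex :: complex_hilbert
begin
definition scaleC_complex :: "complex \<Rightarrow> complex \<Rightarrow> complex" where
  "scaleC_complex a x = a * x"
definition cinner_complex :: "complex \<Rightarrow> complex \<Rightarrow> complex" where
  "cinner_complex x y = cnj x * y"
instance
proof
  fix x :: complex
  show "cinner x x = complex_of_real ((norm x)\<^sup>2)"
    unfolding cinner_complex_def by (subst mult.commute) (rule complex_norm_square [symmetric])
qed (auto simp: scaleC_complex_def cinner_complex_def algebra_simps norm_mult scaleR_conv_of_real)
end

instance complex_hilbert \<subseteq> banach ..


section \<open>Bounded operators\<close>

text \<open>
  Bounded operators are elements of the library type of bounded real-linear maps, together with
  the predicate \<open>clinear\<close>; real-linear and complex-linear operator norms agree.
\<close>

lemma bounded_linear_scaleC:
  "bounded_linear (\<lambda>x :: 'a :: complex_normed_vector. a *\<^sub>C x)"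
proof
  show "a *\<^sub>C (x + y) = a *\<^sub>C x + a *\<^sub>C y" for x y :: 'a
    by (rule scaleC_add_right)
  show "a *\<^sub>C (r *\<^sub>R x) = r *\<^sub>R (a *\<^sub>C x)" for r and x :: 'a
    by (simp add: scaleR_scaleC scaleC_scaleC mult.commute)
  show "\<exists>K. \<forall>x :: 'a. norm (a *\<^sub>C x) \<le> norm x * K"
    by (rule exI[of _ "cmod a"]) (simp add: norm_scaleC mult.commute)
qed

instantiation blinfun :: (real_normed_vector, complex_normed_vector) complex_normed_vector
begin

lift_definition scaleC_blinfun :: "complex \<Rightarrow> 'a \<Rightarrow>\<^sub>L 'b \<Rightarrow> 'a \<Rightarrow>\<^sub>L 'b" is "\<lambda>a f x. a *\<^sub>C f x"
  by (rule bounded_linear_compose[OF bounded_linear_scaleC])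

instance
proof
  fix a b :: complex and r :: real and f g :: "'a \<Rightarrow>\<^sub>L 'b"
  show "a *\<^sub>C (f + g) = a *\<^sub>C f + a *\<^sub>C g"
    by transfer (simp add: scaleC_add_right)
  show "(a + b) *\<^sub>C f = a *\<^sub>C f + b *\<^sub>C f"
    by transfer (simp add: scaleC_add_left)
  show assoc: "a *\<^sub>C (b *\<^sub>C f) = (a * b) *\<^sub>C f" for a b and f :: "'a \<Rightarrow>\<^sub>L 'b"
    by transfer (simp add: scaleC_scaleC)
  show "r *\<^sub>R f = complex_of_real r *\<^sub>C f"
    by transfer (simp add: scaleR_scaleC)
  have le: "norm (a *\<^sub>C f) \<le> cmod a * norm f" for a and f :: "'a \<Rightarrow>\<^sub>L 'b"
  proof (rule norm_blinfun_bound)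
    show "norm (blinfun_apply (a *\<^sub>C f) x) \<le> cmod a * norm f * norm x" for x
      by (simp add: scaleC_blinfun.rep_eq norm_scaleC mult.assoc mult_left_mono norm_blinfun)
  qed simp
  have one: "1 *\<^sub>C f = f"
    by transfer (simp flip: scaleR_scaleC[where r = 1, simplified])
  show "norm (a *\<^sub>C f) = cmod a * norm f"
  proof (cases "a = 0")
    case True
    then show ?thesis using le[of a f] by simp
  next
    case False
    have "norm f = norm (inverse a *\<^sub>C (a *\<^sub>C f))"
      using False one by (simp add: assoc)
    also have "\<dots> \<le> cmod (inverse a) * norm (a *\<^sub>C f)" by (rule le)
    finally have "cmod a * norm f \<le> norm (a *\<^sub>C f)"
      using False by (simp add: norm_inverse norm_divide field_simps)
    with le[of a f] show ?thesis by linarith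
  qed
qed

end

definition clinear :: "('a::complex_normed_vector \<Rightarrow>\<^sub>L 'b::complex_normed_vector) \<Rightarrow> bool" where
  "clinear A \<longleftrightarrow> (\<forall>a x. A (a *\<^sub>C x) = a *\<^sub>C A x)"

definition compact_operator ::
    "('a::complex_normed_vector \<Rightarrow>\<^sub>L 'b::complex_normed_vector) \<Rightarrow> bool" where
  "compact_operator A \<longleftrightarrow> clinear A \<and> compact (closure (A ` cball 0 1))"

definition bounded_selfadjoint :: "('a::complex_hilbert \<Rightarrow>\<^sub>L 'a) \<Rightarrow> bool" where
  "bounded_selfadjoint A \<longleftrightarrow> clinear A \<and> (\<forall>x y. cinner (A x) y = cinner x (A y))"

definition adjoint_blinfun :: "('a::complex_hilbert \<Rightarrow>\<^sub>L 'a) \<Rightarrow> 'a \<Rightarrow>\<^sub>L 'a" where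
  "adjoint_blinfun A = (THE B. \<forall>x y. cinner (blinfun_apply B x) y = cinner x (blinfun_apply A y))"

definition Im_blinfun :: "('a::complex_hilbert \<Rightarrow>\<^sub>L 'a) \<Rightarrow> 'a \<Rightarrow>\<^sub>L 'a" where
  "Im_blinfun A = (1 / (2 * \<i>)) *\<^sub>C (A - adjoint_blinfun A)"

definition nonneg_blinfun :: "('a::complex_hilbert \<Rightarrow>\<^sub>L 'a) \<Rightarrow> bool" where
  "nonneg_blinfun A \<longleftrightarrow> clinear A \<and> (\<forall>x. cinner x (A x) \<in> \<real> \<and> 0 \<le> Re (cinner x (A x)))"

definition sqrt_blinfun :: "('a::complex_hilbert \<Rightarrow>\<^sub>L 'a) \<Rightarrow> 'a \<Rightarrow>\<^sub>L 'a" where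
  "sqrt_blinfun A = (THE B. nonneg_blinfun B \<and> B o\<^sub>L B = A)"

definition invertible_blinfun :: "('a::real_normed_vector \<Rightarrow>\<^sub>L 'a) \<Rightarrow> bool" where
  "invertible_blinfun A \<longleftrightarrow> (\<exists>B. A o\<^sub>L B = id_blinfun \<and> B o\<^sub>L A = id_blinfun)"

text \<open>The inverse is \<open>0\<close> where the operator has no bounded inverse.\<close>

definition inv_blinfun :: "('a::real_normed_vector \<Rightarrow>\<^sub>L 'a) \<Rightarrow> 'a \<Rightarrow>\<^sub>L 'a" where
  "inv_blinfun A =
     (if invertible_blinfun A then THE B. A o\<^sub>L B = id_blinfun \<and> B o\<^sub>L A = id_blinfun else 0)"


section \<open>Vector-valued meromorphic functions\<close>

definition complex_differentiable :: "(complex \<Rightarrow> 'a::complex_normed_vector) \<Rightarrow> complex \<Rightarrow> bool"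
  where "complex_differentiable f z \<longleftrightarrow> (\<exists>D. (f has_derivative (\<lambda>h. h *\<^sub>C D)) (at z))"

definition pole_order_le ::
    "nat \<Rightarrow> (complex \<Rightarrow> 'a::complex_normed_vector) \<Rightarrow> complex \<Rightarrow> bool" where
  "pole_order_le n f z0 \<longleftrightarrow>
     (\<exists>\<epsilon>>0. \<exists>g. (\<forall>z\<in>ball z0 \<epsilon>. complex_differentiable g z) \<and>
        (\<forall>z\<in>ball z0 \<epsilon> - {z0}. f z = inverse ((z - z0) ^ n) *\<^sub>C g z))"

definition meromorphic_entire :: "(complex \<Rightarrow> 'a::complex_normed_vector) \<Rightarrow> bool" where
  "meromorphic_entire f \<longleftrightarrow> (\<forall>z0. \<exists>n. pole_order_le n f z0)"

text \<open>
  A meromorphic function is holomorphic at a point if its singularity there is removable; the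
  value that the HOL function takes at the point itself is irrelevant.
\<close>

definition holomorphic_at :: "(complex \<Rightarrow> 'a::complex_normed_vector) \<Rightarrow> complex \<Rightarrow> bool" where
  "holomorphic_at f z0 \<longleftrightarrow> pole_order_le 0 f z0"

definition meromorphic_ext :: "(real \<Rightarrow> 'a::complex_normed_vector) \<Rightarrow> real set \<Rightarrow> complex \<Rightarrow> 'a" where
  "meromorphic_ext f S =
     (SOME g. meromorphic_entire g \<and> (\<forall>s\<in>S. g (complex_of_real s) = f s))"

text \<open>The library's contour integral, for functions with values in a complex normed space.\<close>

definition contour_integral_vec ::
    "(real \<Rightarrow> complex) \<Rightarrow> (complex \<Rightarrow> 'a::complex_normed_vector) \<Rightarrow> 'a" where
  "contour_integral_vec g f =
     integral {0..1} (\<lambda>t. vector_derivative g (at t within {0..1}) *\<^sub>C f (g t))"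

definition small_radius :: "(complex \<Rightarrow> 'a::complex_normed_vector) \<Rightarrow> complex \<Rightarrow> real" where
  "small_radius f z0 = (SOME \<epsilon>. \<epsilon> > 0 \<and> (\<forall>z\<in>cball z0 \<epsilon> - {z0}. complex_differentiable f z))"

definition residue_vec :: "(complex \<Rightarrow> 'a::complex_normed_vector) \<Rightarrow> complex \<Rightarrow> 'a" where
  "residue_vec f z0 =
     (1 / (2 * complex_of_real pi * \<i>)) *\<^sub>C
       contour_integral_vec (circlepath z0 (small_radius f z0)) f"


section \<open>Unbounded operators as graphs\<close>

text \<open>
  An operator is identified with its graph, so \<open>Domain\<close> and \<open>Range\<close> are its domain and range,
  \<open>converse\<close> is inversion, and the product \<open>A B\<close> is the relation composition \<open>B O A\<close>.
\<close>

type_synonym ('a, 'b) operator = "('a \<times> 'b) set"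

definition linear_operator ::
    "('a::complex_normed_vector, 'b::complex_normed_vector) operator \<Rightarrow> bool" where
  "linear_operator A \<longleftrightarrow> single_valued A \<and> (0, 0) \<in> A \<and>
     (\<forall>x y x' y'. (x, y) \<in> A \<longrightarrow> (x', y') \<in> A \<longrightarrow> (x + x', y + y') \<in> A) \<and>
     (\<forall>a x y. (x, y) \<in> A \<longrightarrow> (a *\<^sub>C x, a *\<^sub>C y) \<in> A)"

definition densely_defined :: "('a::topological_space, 'b) operator \<Rightarrow> bool" where
  "densely_defined A \<longleftrightarrow> closure (Domain A) = UNIV"

definition op_adjoint ::
    "('a::complex_hilbert, 'b::complex_hilbert) operator \<Rightarrow> ('b, 'a) operator" where
  "op_adjoint A = {(y, x). \<forall>(u, v)\<in>A. cinner y v = cinner x u}"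

definition op_kernel :: "('a, 'b::zero) operator \<Rightarrow> 'a set" where
  "op_kernel A = {x. (x, 0) \<in> A}"

definition selfadjoint :: "('a::complex_hilbert, 'a) operator \<Rightarrow> bool" where
  "selfadjoint A \<longleftrightarrow> linear_operator A \<and> densely_defined A \<and> op_adjoint A = A"

definition op_graph ::
    "('a::real_normed_vector \<Rightarrow>\<^sub>L 'b::real_normed_vector) \<Rightarrow> ('a, 'b) operator" where
  "op_graph A = {(x, y). y = A x}"

definition op_add :: "('a, 'b::plus) operator \<Rightarrow> ('a, 'b) operator \<Rightarrow> ('a, 'b) operator" where
  "op_add A B = {(x, y + y') | x y y'. (x, y) \<in> A \<and> (x, y') \<in> B}"

definition op_scaleR :: "real \<Rightarrow> ('a, 'b::real_vector) operator \<Rightarrow> ('a, 'b) operator" where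
  "op_scaleR r A = {(x, r *\<^sub>R y) | x y. (x, y) \<in> A}"

definition resolvent_rel ::
    "('a::complex_normed_vector, 'a) operator \<Rightarrow> complex \<Rightarrow> ('a, 'a) operator" where
  "resolvent_rel H z = converse {(x, y - z *\<^sub>C x) | x y. (x, y) \<in> H}"

definition resolvent_set :: "('a::complex_normed_vector, 'a) operator \<Rightarrow> complex set" where
  "resolvent_set H = {z. \<exists>R. clinear R \<and> resolvent_rel H z = op_graph R}"

text \<open>For one, equivalently every, point of the resolvent set, the product of the operator
  with the resolvent is compact.\<close>

definition relatively_compact ::
    "('a::complex_hilbert, 'a) operator \<Rightarrow> ('a, 'a) operator \<Rightarrow> bool" where
  "relatively_compact V H \<longleftrightarrow> Domain H \<subseteq> Domain V \<and>
     (\<exists>z\<in>resolvent_set H. \<exists>K. compact_operator K \<and> resolvent_rel H z O V = op_graph K)"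


section \<open>The rigged affine space of operators\<close>

definition rigged_product ::
    "('h::complex_hilbert, 'k::complex_hilbert) operator \<Rightarrow> ('k \<Rightarrow>\<^sub>L 'k) \<Rightarrow> ('h, 'h) operator" where
  "rigged_product F J = F O op_graph J O op_adjoint F"

text \<open>
  The operator \<open>V = F* J F\<close>. The closure does nothing if the product of the three operators is
  itself self-adjoint. It is needed since \<open>J = 0\<close> is allowed: for unbounded \<open>F\<close> the product
  \<open>F* 0 F\<close> is the zero operator on \<open>dom F\<close> only, which is not self-adjoint.
\<close>

definition rigged_op ::
    "('h::complex_hilbert, 'k::complex_hilbert) operator \<Rightarrow> ('k \<Rightarrow>\<^sub>L 'k) \<Rightarrow> ('h, 'h) operator" where
  "rigged_op F J = closure (rigged_product F J)"

text \<open>The sandwiched resolvent; on \<open>dom F*\<close> it is the product of the three operators.\<close>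

definition T_op ::
    "('h::complex_hilbert, 'k::complex_hilbert) operator \<Rightarrow> ('h, 'h) operator \<Rightarrow> complex
       \<Rightarrow> 'k \<Rightarrow>\<^sub>L 'k" where
  "T_op F H z = (THE T. op_adjoint F O resolvent_rel H z O F \<subseteq> op_graph T)"

definition Lambda ::
    "('h::complex_hilbert, 'h) operator \<Rightarrow> ('h, 'k::complex_hilbert) operator \<Rightarrow> real set" where
  "Lambda H F = {l.
     (\<exists>L. ((\<lambda>y. T_op F H (Complex l y)) \<longlongrightarrow> L) (at_right 0)) \<and>
     (\<exists>L. ((\<lambda>y. T_op F H (Complex l (- y))) \<longlongrightarrow> L) (at_right 0))}"

text \<open>Boundary value at \<open>l + i0\<close> for \<open>\<sigma> = 1\<close> and at \<open>l - i0\<close> for \<open>\<sigma> = - 1\<close>.\<close>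

definition T_lim ::
    "('h::complex_hilbert, 'k::complex_hilbert) operator \<Rightarrow> ('h, 'h) operator \<Rightarrow> real \<Rightarrow> real
       \<Rightarrow> 'k \<Rightarrow>\<^sub>L 'k" where
  "T_lim F H l \<sigma> = Lim (at_right 0) (\<lambda>y. T_op F H (Complex l (\<sigma> * y)))"

text \<open>
  The sum of \<open>H\<close> and \<open>rigged_op F J\<close> has domain \<open>D\<close>, on which \<open>rigged_op F J\<close> is the product
  \<open>F* J F\<close>. Linear combinations in the vector space of all \<open>rigged_op F J\<close> are those of the \<open>J\<close>.
  Trivial cokernel means trivial kernel of the adjoint.
\<close>

locale rigged_affine_space =
  fixes F :: "('h::complex_hilbert, 'k::complex_hilbert) operator"
    and JJ :: "('k \<Rightarrow>\<^sub>L 'k) set"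
    and AA :: "('h, 'h) operator set"
    and D :: "'h set"
  assumes separable_H: "separable_space (euclidean :: 'h topology)"
    and separable_K: "separable_space (euclidean :: 'k topology)"
    and F_linear: "linear_operator F"
    and F_closed: "closed F"
    and F_dense: "densely_defined F"
    and F_kernel: "op_kernel F = {0}"
    and F_cokernel: "op_kernel (op_adjoint F) = {0}"
    and JJ_subspace: "subspace JJ"
    and JJ_selfadjoint: "\<And>J. J \<in> JJ \<Longrightarrow> bounded_selfadjoint J"
    and V_selfadjoint: "\<And>J. J \<in> JJ \<Longrightarrow> selfadjoint (rigged_op F J)"
    and AA_affine: "\<exists>H\<in>AA. AA = {op_add H (rigged_op F J) | J. J \<in> JJ}"
    and AA_selfadjoint: "\<And>H. H \<in> AA \<Longrightarrow> selfadjoint H"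
    and AA_domain: "\<And>H. H \<in> AA \<Longrightarrow> Domain H = D"
    and D_dense: "closure D = UNIV"
    and D_F: "D \<subseteq> Domain F"
    and D_V: "\<And>J. J \<in> JJ \<Longrightarrow> D \<subseteq> Domain (rigged_product F J)"
    and V_relatively_compact:
      "\<And>J H. J \<in> JJ \<Longrightarrow> H \<in> AA \<Longrightarrow> relatively_compact (rigged_op F J) H"
    and T_compact: "\<And>H z. H \<in> AA \<Longrightarrow> Im z \<noteq> 0 \<Longrightarrow>
      \<exists>T. compact_operator T \<and> op_adjoint F O resolvent_rel H z O F \<subseteq> op_graph T"
    and Lambda_full: "\<And>H. H \<in> AA \<Longrightarrow> - Lambda H F \<in> null_sets lebesgue"

definition essentially_regular ::
    "('h::complex_hilbert, 'h) operator set \<Rightarrow> ('h, 'k::complex_hilbert) operator \<Rightarrow> real set" where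
  "essentially_regular AA F = (\<Union>H\<in>AA. Lambda H F)"


section \<open>Resonance points of a path\<close>

text \<open>Here \<open>Hp\<close> is a path of operators, \<open>Hp r = H0 + r V\<close> in the intended use.\<close>

definition regular_points ::
    "('h::complex_hilbert, 'k::complex_hilbert) operator \<Rightarrow> (real \<Rightarrow> ('h, 'h) operator) \<Rightarrow> real
       \<Rightarrow> real set" where
  "regular_points F Hp l = {r. l \<in> Lambda (Hp r) F}"

definition A_fun where
  "A_fun F J Hp l \<sigma> = meromorphic_ext (\<lambda>s. T_lim F (Hp s) l \<sigma> o\<^sub>L J) (regular_points F Hp l)"

definition B_fun where
  "B_fun F J Hp l \<sigma> = meromorphic_ext (\<lambda>s. J o\<^sub>L T_lim F (Hp s) l \<sigma>) (regular_points F Hp l)"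

definition ImT_fun where
  "ImT_fun F Hp l = meromorphic_ext (\<lambda>s. Im_blinfun (T_lim F (Hp s) l 1)) (regular_points F Hp l)"

definition P_res where
  "P_res F J Hp l \<sigma> r = residue_vec (A_fun F J Hp l \<sigma>) (complex_of_real r)"

definition Q_res where
  "Q_res F J Hp l \<sigma> r = residue_vec (B_fun F J Hp l \<sigma>) (complex_of_real r)"

definition A_nil where
  "A_nil F J Hp l \<sigma> r =
     residue_vec (\<lambda>s. (s - complex_of_real r) *\<^sub>C A_fun F J Hp l \<sigma> s) (complex_of_real r)"

definition Upsilon where
  "Upsilon F J Hp l \<sigma> r = range (blinfun_apply (P_res F J Hp l \<sigma> r))"

definition c_coeff where
  "c_coeff F J Hp l \<sigma> r u j = Im (cinner u (blinfun_apply J ((blinfun_apply (A_nil F J Hp l \<sigma> r) ^^ (j - 1)) u)))"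

definition type_I where
  "type_I F J Hp l r \<longleftrightarrow> (\<exists>s\<in>regular_points F Hp l.
     sqrt_blinfun (Im_blinfun (T_lim F (Hp s) l 1)) o\<^sub>L J o\<^sub>L P_res F J Hp l 1 r = 0)"

definition w_fun where
  "w_fun F J H0 l \<sigma> s = sqrt_blinfun (Im_blinfun (T_lim F H0 l 1)) o\<^sub>L
     inv_blinfun (id_blinfun + s *\<^sub>C (J o\<^sub>L T_lim F H0 l \<sigma>))"

definition wJ_fun where
  "wJ_fun F J H0 l \<sigma> s = sqrt_blinfun (Im_blinfun (T_lim F H0 l 1)) o\<^sub>L J o\<^sub>L
     inv_blinfun (id_blinfun + s *\<^sub>C (T_lim F H0 l \<sigma> o\<^sub>L J))"

definition w_dagger where
  "w_dagger F J H0 l \<sigma> s = inv_blinfun (id_blinfun + s *\<^sub>C (T_lim F H0 l (- \<sigma>) o\<^sub>L J)) o\<^sub>L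
     sqrt_blinfun (Im_blinfun (T_lim F H0 l 1))"

end

(* The boundary values T(s) = T(0) (1 + s J T(0))^(-1) of the sandwiched resolvent along the path
   continue meromorphically to complex s, because T(0) is a norm limit of operators of finite rank
   and rank one perturbations can be inverted one at a time. With A the imaginary part of the
   boundary value at s = 0, w(s) = sqrt A (1 + s J T(0))^(-1) and Q the residue of J T(s), one has
   Im T(s) = w(conj s)^* w(s). The resolvent identity shows that Q absorbs every coefficient of the
   principal part of J T(s), so sqrt A Q = 0 removes the whole singularity of w. Conversely, a bound
   on J Im T(s) J for real s near the resonance bounds w(s) J there, and a pole that is bounded along
   the real line is removable. Since Im T does not depend on the sign of the boundary value, this
   links the two signs. *)

theory Submission
  imports Defs
begin

section \<open>Hilbert space geometry\<close>

text \<open>Every clause is matched with one equation, \<open>W \<odot> Q 1 = 0\<close>, taken at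
  the parameter 0. Three obstacles shape the route. The continuations are picked by
  \<open>SOME\<close>, and a meromorphic function has no prescribed value at a single point; hence
  identities are stated on punctured neighbourhoods and carried between points by an identity
  theorem. The imaginary part of an operator is not a holomorphic operation; it is continued as the
  difference of the two boundary values over 2i, and that difference factors around the imaginary
  part at 0 for either sign. Operators are bounded real-linear maps with a separate predicate
  \<open>clinear\<close>; complex analysis is done on matrix elements \<open>cinner x (A y)\<close>,
  with bounds uniform enough to return to the operator norm. For the coefficients in (vi) the point
  is that on the range of the residue \<open>P\<close> the function \<open>T(s) J\<close> reduces to
  its principal part, so the squared norm of \<open>w(s) J u\<close> at real \<open>s\<close> is a
  finite sum of negative powers whose coefficients are, up to sign, these numbers.\<close>

lemma scaleC_one [simp]: "1 *\<^sub>C x = (x :: 'a :: complex_normed_vector)"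
  using scaleR_scaleC[of 1 x] by simp

lemma bounded_bilinear_scaleC:
  "bounded_bilinear (scaleC :: complex \<Rightarrow> 'a \<Rightarrow> 'a :: complex_normed_vector)"
proof
  show "(r *\<^sub>R a) *\<^sub>C b = r *\<^sub>R a *\<^sub>C b" for r a and b :: 'a
    by (simp add: scaleR_scaleC[of r "a *\<^sub>C b"] scaleC_scaleC scaleR_conv_of_real)
  show "a *\<^sub>C r *\<^sub>R b = r *\<^sub>R a *\<^sub>C b" for r a and b :: 'a
    by (simp add: scaleR_scaleC scaleC_scaleC mult.commute)
  show "\<exists>K. \<forall>a (b :: 'a). norm (a *\<^sub>C b) \<le> norm a * norm b * K"
    by (rule exI[of _ 1]) (simp add: norm_scaleC)
qed (auto simp: scaleC_add_left scaleC_add_right)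

interpretation scaleC: bounded_bilinear
  "scaleC :: complex \<Rightarrow> 'a \<Rightarrow> 'a :: complex_normed_vector"
  by (rule bounded_bilinear_scaleC)

lemma scaleC_cancel [simp]: "a \<noteq> 0 \<Longrightarrow> inverse a *\<^sub>C a *\<^sub>C x = (x :: 'a :: complex_normed_vector)"
  by (simp add: scaleC_scaleC)

lemma scaleC_eq_0_iff [simp]: "a *\<^sub>C x = 0 \<longleftrightarrow> a = 0 \<or> x = (0 :: 'a :: complex_normed_vector)"
  by (metis norm_eq_zero norm_scaleC mult_eq_0_iff)

lemma cinner_add_left: "cinner (x + y) z = cinner x z + cinner (y :: 'a :: complex_hilbert) z"
  by (simp add: cinner_commute[of _ z] cinner_add_right)

lemma cinner_scaleC_left: "cinner (a *\<^sub>C x) y = cnj a * cinner (x :: 'a :: complex_hilbert) y"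
  by (simp add: cinner_commute[of _ y] cinner_scaleC_right)

lemma cinner_scaleR_right: "cinner x (r *\<^sub>R y) = r *\<^sub>R cinner (x :: 'a :: complex_hilbert) y"
  by (simp only: scaleR_scaleC[of r y] cinner_scaleC_right) (simp add: scaleR_conv_of_real)

lemma cinner_scaleR_left: "cinner (r *\<^sub>R x) y = r *\<^sub>R cinner (x :: 'a :: complex_hilbert) y"
  by (simp only: scaleR_scaleC[of r x] cinner_scaleC_left) (simp add: scaleR_conv_of_real)

lemma cinner_zero [simp]: "cinner x 0 = 0" "cinner 0 (x :: 'a :: complex_hilbert) = 0"
  using cinner_scaleR_right[of x 0 0] cinner_scaleR_left[of 0 0 x] by simp_all

lemma cinner_diff_right: "cinner x (y - z) = cinner x y - cinner (x :: 'a :: complex_hilbert) z"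
  using cinner_add_right[of x "y - z" z] by simp

lemma cinner_diff_left: "cinner (x - y) z = cinner x z - cinner (y :: 'a :: complex_hilbert) z"
  using cinner_add_left[of "x - y" y z] by simp

lemma norm_sq_cinner: "(norm (x :: 'a :: complex_hilbert))\<^sup>2 = Re (cinner x x)"
  by (simp add: cinner_self)

lemma norm_diff_sq:
  "(norm (x - y))\<^sup>2 = (norm x)\<^sup>2 - 2 * Re (cinner x y) + (norm (y :: 'a :: complex_hilbert))\<^sup>2"
  using cinner_commute[of y x]
  by (simp add: norm_sq_cinner cinner_diff_left cinner_diff_right)

lemma norm_add_sq:
  "(norm (x + y))\<^sup>2 = (norm x)\<^sup>2 + 2 * Re (cinner x y) + (norm (y :: 'a :: complex_hilbert))\<^sup>2"
  using cinner_commute[of y x]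
  by (simp add: norm_sq_cinner cinner_add_left cinner_add_right)

text \<open>For a unit vector \<open>y\<close> the factor is 1 and this is Pythagoras for the
  component of \<open>x\<close> along \<open>y\<close>; Cauchy-Schwarz and the minimality criterion
  use that case.\<close>

lemma norm_minus_scaleC_sq:
  "(norm (x - cinner y x *\<^sub>C y))\<^sup>2 =
     (norm x)\<^sup>2 - (2 - (norm (y :: 'a :: complex_hilbert))\<^sup>2) * (cmod (cinner y x))\<^sup>2"
proof -
  have "cinner x (cinner y x *\<^sub>C y) = complex_of_real ((cmod (cinner y x))\<^sup>2)"
    unfolding cinner_scaleC_right cinner_commute[of x y] by (simp only: complex_norm_square)
  then show ?thesis
    by (simp add: norm_diff_sq norm_scaleC power_mult_distrib algebra_simps)
qed

lemma cinner_cauchy_schwarz: "cmod (cinner x y) \<le> norm x * norm (y :: 'a :: complex_hilbert)"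
proof (cases "x = 0")
  case False
  define e where "e = (1 / norm x) *\<^sub>R x"
  have "norm e = 1" using False by (simp add: e_def)
  then have "(cmod (cinner e y))\<^sup>2 \<le> (norm y)\<^sup>2"
    using norm_minus_scaleC_sq[of y e] zero_le_power2[of "norm (y - cinner e y *\<^sub>C e)"] by simp
  then have "cmod (cinner e y) \<le> norm y" by (rule power2_le_imp_le) simp
  then show ?thesis using False by (simp add: e_def cinner_scaleR_left field_simps)
qed simp

text \<open>Real scalars pass through both slots, so conjugate linearity in the first is compatible
  with the real-bilinear interface, which supplies limits, continuity and sums.\<close>

lemma bounded_bilinear_cinner:
  "bounded_bilinear (cinner :: 'a :: complex_hilbert \<Rightarrow> 'a \<Rightarrow> complex)"
proof
  show "\<exists>K. \<forall>a (b :: 'a). norm (cinner a b) \<le> norm a * norm b * K"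
    by (rule exI[of _ 1]) (simp add: cinner_cauchy_schwarz)
qed (auto simp: cinner_add_left cinner_add_right cinner_scaleR_left cinner_scaleR_right)

interpretation cinner: bounded_bilinear "cinner :: 'a :: complex_hilbert \<Rightarrow> 'a \<Rightarrow> complex"
  by (rule bounded_bilinear_cinner)

lemma cinner_eq_0_self_iff [simp]: "cinner x x = 0 \<longleftrightarrow> x = (0 :: 'a :: complex_hilbert)"
  by (simp add: cinner_self)

lemma cinner_ext_right: "(\<And>x. cinner x y = cinner x z) \<Longrightarrow> y = (z :: 'a :: complex_hilbert)"
  using cinner_eq_0_self_iff[of "y - z"] by (simp add: cinner_diff_right)

lemma cinner_ext_left: "(\<And>x. cinner y x = cinner z x) \<Longrightarrow> y = (z :: 'a :: complex_hilbert)"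
  using cinner_eq_0_self_iff[of "y - z"] by (simp add: cinner_diff_left)

lemma blinfun_cinner_eqI:
  "(\<And>x y. cinner x (blinfun_apply A y) = cinner x (blinfun_apply B y)) \<Longrightarrow> A = B"
  for A B :: "'a :: real_normed_vector \<Rightarrow>\<^sub>L 'b :: complex_hilbert"
  by (rule blinfun_eqI, rule cinner_ext_right) auto

text \<open>Subtracting the component along the normalised \<open>s\<close> lowers the squared norm
  by exactly the square of that component, so minimality forces it to vanish.\<close>

lemma orthogonal_if_minimal:
  fixes w s :: "'a :: complex_hilbert"
  assumes "\<And>a. norm w \<le> norm (w - a *\<^sub>C s)"
  shows "cinner w s = 0"
proof (cases "s = 0")
  case False
  define e where "e = (1 / norm s) *\<^sub>R s"
  have e: "norm e = 1" using False by (simp add: e_def)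
  have "norm w \<le> norm (w - cinner e w *\<^sub>C e)"
    using assms[of "cinner e w * complex_of_real (1 / norm s)"]
    by (simp add: e_def scaleR_scaleC scaleC_scaleC)
  then have "(norm w)\<^sup>2 \<le> (norm (w - cinner e w *\<^sub>C e))\<^sup>2" by (simp add: power_mono)
  then have "(cmod (cinner e w))\<^sup>2 \<le> 0" using norm_minus_scaleC_sq[of w e] e by simp
  then have "cinner e w = 0" by simp
  then have "cinner s w = 0" using False by (simp add: e_def cinner_scaleR_left)
  then show ?thesis by (metis cinner_commute complex_cnj_zero)
qed simp

section \<open>Orthogonality to closed subspaces and the density criterion\<close>

definition csubspace :: "'a :: complex_normed_vector set \<Rightarrow> bool" where
  "csubspace S \<longleftrightarrow> 0 \<in> S \<and> (\<forall>x\<in>S. \<forall>y\<in>S. x + y \<in> S) \<and> (\<forall>a. \<forall>x\<in>S. a *\<^sub>C x \<in> S)"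

lemma csubspace_scaleR: "csubspace S \<Longrightarrow> x \<in> S \<Longrightarrow> r *\<^sub>R x \<in> S"
  by (simp add: csubspace_def scaleR_scaleC)

text \<open>\<open>w = x - p\<close> for the nearest point \<open>p\<close> of \<open>S\<close>:
  completeness turns a minimising sequence into \<open>p\<close>, and minimality makes
  \<open>w\<close> orthogonal to \<open>S\<close>.\<close>

lemma closed_csubspace_orthogonal:
  fixes S :: "'a :: complex_hilbert set"
  assumes S: "csubspace S" and "closed S" and x: "x \<notin> S"
  obtains w where "cinner w x \<noteq> 0" "\<And>y. y \<in> S \<Longrightarrow> cinner w y = 0"
proof -
  have S0: "0 \<in> S" and Sadd: "a \<in> S \<Longrightarrow> b \<in> S \<Longrightarrow> a + b \<in> S" for a b
    using S by (auto simp: csubspace_def)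
  define d where "d = infdist x S"
  have ne: "S \<noteq> {}" using S0 by auto
  have d0: "d \<ge> 0" by (simp add: d_def infdist_nonneg)
  have dle: "y \<in> S \<Longrightarrow> d \<le> norm (x - y)" for y
    unfolding d_def by (metis infdist_le dist_norm)
  have "\<exists>y\<in>S. (norm (x - y))\<^sup>2 < d\<^sup>2 + 1 / Suc n" for n
  proof -
    have "d < sqrt (d\<^sup>2 + 1 / Suc n)" using d0 by (intro real_less_rsqrt) simp
    then have "Inf (dist x ` S) < sqrt (d\<^sup>2 + 1 / Suc n)"
      using ne by (simp add: d_def infdist_def)
    then have "\<exists>r\<in>dist x ` S. r < sqrt (d\<^sup>2 + 1 / Suc n)"
      using cInf_lessD[of "dist x ` S"] ne by (metis image_is_empty)
    then obtain y where "y \<in> S" "dist x y < sqrt (d\<^sup>2 + 1 / Suc n)"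
      by blast
    moreover from this have "(norm (x - y))\<^sup>2 < (sqrt (d\<^sup>2 + 1 / Suc n))\<^sup>2"
      by (intro power_strict_mono) (auto simp: dist_norm)
    ultimately show ?thesis by auto
  qed
  then obtain y where yS: "\<And>n. y n \<in> S" and y: "\<And>n. (norm (x - y n))\<^sup>2 < d\<^sup>2 + 1 / Suc n"
    by metis
  \<comment> \<open>Parallelogram law: the midpoint of two near-minimisers lies in \<open>S\<close>,
    hence has distance at least \<open>d\<close> from \<open>x\<close>.\<close>
  have cauchy_bound: "(norm (y n - y m))\<^sup>2 \<le> 2 / Suc n + 2 / Suc m" for n m
  proof -
    have "d \<le> norm (x - (1/2) *\<^sub>R (y n + y m))"
      by (intro dle csubspace_scaleR[OF S] Sadd yS)
    also have "x - (1/2) *\<^sub>R (y n + y m) = (1/2) *\<^sub>R ((x - y n) + (x - y m))"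
      using scaleR_add_left[of "1/2" "1/2" x] by (simp add: algebra_simps)
    finally have "2 * d \<le> norm ((x - y n) + (x - y m))" by simp
    then have "(2 * d)\<^sup>2 \<le> (norm ((x - y n) + (x - y m)))\<^sup>2"
      using d0 by (intro power_mono) auto
    moreover have "(norm (y n - y m))\<^sup>2 =
        2 * (norm (x - y n))\<^sup>2 + 2 * (norm (x - y m))\<^sup>2 - (norm ((x - y n) + (x - y m)))\<^sup>2"
    proof -
      have "y n - y m = (x - y m) - (x - y n)" "(x - y n) + (x - y m) = (x - y m) + (x - y n)"
        by (simp_all add: add.commute)
      then have "(norm (y n - y m))\<^sup>2 = (norm ((x - y m) - (x - y n)))\<^sup>2"
        "(norm ((x - y n) + (x - y m)))\<^sup>2 = (norm ((x - y m) + (x - y n)))\<^sup>2" by (simp_all only: )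
      then show ?thesis
        using norm_diff_sq[of "x - y m" "x - y n"] norm_add_sq[of "x - y m" "x - y n"] by linarith
    qed
    moreover have "(2 * d)\<^sup>2 = 4 * d\<^sup>2" by (simp add: power_mult_distrib)
    moreover have "2 / real (Suc k) = 2 * (1 / real (Suc k))" for k by simp
    ultimately show ?thesis using y[of n] y[of m] by linarith
  qed
  have "Cauchy y"
  proof (rule metric_CauchyI)
    fix e :: real assume e: "e > 0"
    obtain N where N: "4 / e\<^sup>2 < real N" using reals_Archimedean2 by blast
    have "dist (y m) (y n) < e" if "m \<ge> N" "n \<ge> N" for m n
    proof -
      have "inverse (real (Suc m)) \<le> inverse (real (Suc N))" "inverse (real (Suc n)) \<le> inverse (real (Suc N))"
        using that by (intro le_imp_inverse_le; simp)+
      with cauchy_bound[of m n] have "(norm (y m - y n))\<^sup>2 \<le> 4 / Suc N"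
        unfolding divide_inverse by linarith
      also have "\<dots> < e\<^sup>2"
      proof -
        have "4 < real N * e\<^sup>2" using N e by (simp add: field_simps)
        also have "\<dots> \<le> real (Suc N) * e\<^sup>2" by (intro mult_right_mono) auto
        finally show ?thesis by (simp add: field_simps)
      qed
      finally show ?thesis unfolding dist_norm by (rule power2_less_imp_less) (use e in simp)
    qed
    then show "\<exists>M. \<forall>m\<ge>M. \<forall>n\<ge>M. dist (y m) (y n) < e" by blast
  qed
  then obtain p where p: "y \<longlonglongrightarrow> p" using Cauchy_convergent[of y] by (auto simp: convergent_def)
  have pS: "p \<in> S" by (rule closed_sequentially[OF \<open>closed S\<close> yS p])
  have "(\<lambda>n. (norm (x - y n))\<^sup>2) \<longlonglongrightarrow> (norm (x - p))\<^sup>2"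
    by (intro tendsto_intros p)
  moreover have "(\<lambda>n. d\<^sup>2 + 1 / Suc n) \<longlonglongrightarrow> d\<^sup>2 + 0"
    by (intro tendsto_intros LIMSEQ_Suc[OF lim_1_over_n])
  ultimately have "(norm (x - p))\<^sup>2 \<le> d\<^sup>2 + 0"
    by (rule LIMSEQ_le) (intro exI[of _ 0] allI impI less_imp_le y)
  then have pd: "norm (x - p) \<le> d" by (intro power2_le_imp_le[OF _ d0]) simp
  have orth: "cinner (x - p) s = 0" if s: "s \<in> S" for s
  proof (rule orthogonal_if_minimal)
    fix a
    have "p + a *\<^sub>C s \<in> S" using S s pS by (auto simp: csubspace_def)
    from pd order_trans[OF _ dle[OF this]] show "norm (x - p) \<le> norm (x - p - a *\<^sub>C s)"
      by (simp only: diff_diff_eq)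
  qed
  show ?thesis
  proof (rule that[OF _ orth])
    \<comment> \<open>As \<open>p\<close> is in \<open>S\<close>, the product is the squared norm of
      \<open>x - p\<close>, nonzero because \<open>x\<close> is outside \<open>S\<close>.\<close>
    have "cinner (x - p) x = cinner (x - p) (x - p) + cinner (x - p) p"
      by (simp flip: cinner_add_right)
    then show "cinner (x - p) x \<noteq> 0" using orth[OF pS] pS x by auto
  qed
qed

lemma csubspace_closure:
  assumes S: "csubspace S" shows "csubspace (closure S)"
proof -
  have "a *\<^sub>C x \<in> closure S" if "x \<in> closure S" for a x
  proof -
    from that obtain f where f: "\<And>n. f n \<in> S" "f \<longlonglongrightarrow> x" by (auto simp: closure_sequential)
    then have "(\<lambda>n. a *\<^sub>C f n) \<longlonglongrightarrow> a *\<^sub>C x" by (intro tendsto_intros scaleC.tendsto)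
    moreover have "\<And>n. a *\<^sub>C f n \<in> S" using f S by (simp add: csubspace_def)
    ultimately show ?thesis unfolding closure_sequential by (intro exI conjI allI)
  qed
  moreover have "x + y \<in> closure S" if "x \<in> closure S" "y \<in> closure S" for x y
  proof -
    from that obtain f g where f: "\<And>n. f n \<in> S" "f \<longlonglongrightarrow> x" "\<And>n. g n \<in> S" "g \<longlonglongrightarrow> y"
      by (auto simp: closure_sequential)
    then have "(\<lambda>n. f n + g n) \<longlonglongrightarrow> x + y" by (intro tendsto_intros)
    moreover have "\<And>n. f n + g n \<in> S" using f S by (simp add: csubspace_def)
    ultimately show ?thesis unfolding closure_sequential by (intro exI conjI allI)
  qed
  moreover have "0 \<in> closure S" using S closure_subset by (auto simp: csubspace_def)
  ultimately show ?thesis by (auto simp: csubspace_def)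
qed

lemma dense_csubspaceI:
  fixes S :: "'a :: complex_hilbert set"
  assumes S: "csubspace S" and orth: "\<And>w. (\<And>y. y \<in> S \<Longrightarrow> cinner w y = 0) \<Longrightarrow> w = 0"
  shows "closure S = UNIV"
proof (rule ccontr)
  assume "closure S \<noteq> UNIV"
  then obtain x where "x \<notin> closure S" by auto
  from closed_csubspace_orthogonal[OF csubspace_closure[OF S] closed_closure this]
  obtain w where w: "cinner w x \<noteq> 0" "\<And>y. y \<in> closure S \<Longrightarrow> cinner w y = 0"
    by metis
  have "w = 0" by (intro orth w closure_subset[THEN subsetD])
  with w show False by simp
qed

text \<open>Graphs of operators are subspaces of the product; orthogonality in it proves that the
  adjoint of \<open>F\<close> is densely defined.\<close>

instantiation prod :: (complex_normed_vector, complex_normed_vector) complex_normed_vector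
begin

definition scaleC_prod :: "complex \<Rightarrow> 'a \<times> 'b \<Rightarrow> 'a \<times> 'b" where
  "scaleC_prod a p = (a *\<^sub>C fst p, a *\<^sub>C snd p)"

instance
proof
  fix a :: complex and x :: "'a \<times> 'b"
  have "(cmod a * norm (fst x))\<^sup>2 + (cmod a * norm (snd x))\<^sup>2 =
      (cmod a)\<^sup>2 * ((norm (fst x))\<^sup>2 + (norm (snd x))\<^sup>2)"
    by (simp add: power_mult_distrib algebra_simps)
  then show "norm (a *\<^sub>C x) = cmod a * norm x"
    unfolding norm_prod_def scaleC_prod_def fst_conv snd_conv norm_scaleC
    by (simp only: real_sqrt_mult) simp
  fix r y b
  show "a *\<^sub>C (x + y) = a *\<^sub>C x + a *\<^sub>C y" "(a + b) *\<^sub>C x = a *\<^sub>C x + b *\<^sub>C x"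
    by (simp_all only: scaleC_prod_def scaleC_add_left scaleC_add_right fst_add snd_add add_Pair)
  show "a *\<^sub>C b *\<^sub>C x = (a * b) *\<^sub>C x"
    by (simp add: scaleC_prod_def scaleC_scaleC)
  show "r *\<^sub>R x = complex_of_real r *\<^sub>C x"
    unfolding scaleC_prod_def scaleR_prod_def scaleR_scaleC[of r "fst x"] scaleR_scaleC[of r "snd x"]
    by (rule refl)
qed

end

instantiation prod :: (complex_hilbert, complex_hilbert) complex_hilbert
begin

definition cinner_prod :: "'a \<times> 'b \<Rightarrow> 'a \<times> 'b \<Rightarrow> complex" where
  "cinner_prod p q = cinner (fst p) (fst q) + cinner (snd p) (snd q)"

instance
proof
  fix x y z :: "'a \<times> 'b" and a
  show "cinner x y = cnj (cinner y x)"
    by (simp add: cinner_prod_def cinner_commute[of "fst x"] cinner_commute[of "snd x"])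
  show "cinner x (y + z) = cinner x y + cinner x z"
    by (simp add: cinner_prod_def cinner_add_right)
  show "cinner x (a *\<^sub>C y) = a * cinner x y"
    by (simp add: cinner_prod_def scaleC_prod_def cinner_scaleC_right distrib_left)
  show "cinner x x = complex_of_real ((norm x)\<^sup>2)"
    by (simp add: cinner_prod_def cinner_self norm_prod_def)
qed

end

section \<open>Algebra of bounded operators\<close>

notation (input) blinfun_compose (infixl \<open>\<odot>\<close> 70)

interpretation comp: bounded_bilinear
  "blinfun_compose :: 'b::real_normed_vector \<Rightarrow>\<^sub>L 'c::real_normed_vector \<Rightarrow> 'a::real_normed_vector \<Rightarrow>\<^sub>L 'b \<Rightarrow> 'a \<Rightarrow>\<^sub>L 'c"
  by (rule bounded_bilinear_blinfun_compose)

declare scaleC_blinfun.rep_eq [simp]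

lemma comp_id [simp]: "A \<odot> id_blinfun = A" "id_blinfun \<odot> A = A"
  by (auto intro!: blinfun_eqI)

lemma comp_assoc: "(A \<odot> B) \<odot> C = A \<odot> (B \<odot> C)"
  by (auto intro!: blinfun_eqI)

lemma comp_scaleC_left: "(a *\<^sub>C A) \<odot> B = a *\<^sub>C (A \<odot> B)"
  by (auto intro!: blinfun_eqI)

text \<open>The left factor must be complex linear, since elements of the operator type are only
  real linear. This is the source of the \<open>clinear\<close> side conditions throughout.\<close>

lemma comp_scaleC_right: "clinear A \<Longrightarrow> A \<odot> (a *\<^sub>C B) = a *\<^sub>C (A \<odot> B)"
  by (auto intro!: blinfun_eqI simp: clinear_def)

lemmas comp_simps = comp.add_left comp.add_right comp.diff_left comp.diff_right
  comp.minus_left comp.minus_right comp_assoc comp_scaleC_left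

lemma clinear_intros:
  "clinear id_blinfun" "clinear 0" "clinear A \<Longrightarrow> clinear B \<Longrightarrow> clinear (A + B)"
  "clinear A \<Longrightarrow> clinear B \<Longrightarrow> clinear (A - B)" "clinear A \<Longrightarrow> clinear (- A)"
  "clinear A \<Longrightarrow> clinear (a *\<^sub>C A)"
  by (auto simp: clinear_def blinfun.bilinear_simps scaleC.add_right scaleC.diff_right
      scaleC.minus_right scaleC_scaleC mult.commute)

lemma clinear_comp: "clinear A \<Longrightarrow> clinear B \<Longrightarrow> clinear (A \<odot> B)"
  by (auto simp: clinear_def)

lemma clinear_tendsto:
  assumes "(f \<longlongrightarrow> L) F" "F \<noteq> bot" "\<forall>\<^sub>F x in F. clinear (f x)"
  shows "clinear L"
  unfolding clinear_def
proof (intro allI)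
  fix a x
  have "((\<lambda>s. f s (a *\<^sub>C x)) \<longlongrightarrow> L (a *\<^sub>C x)) F"
    by (intro tendsto_intros assms)
  moreover have "((\<lambda>s. a *\<^sub>C f s x) \<longlongrightarrow> a *\<^sub>C L x) F"
    by (intro scaleC.tendsto tendsto_intros assms)
  then have "((\<lambda>s. f s (a *\<^sub>C x)) \<longlongrightarrow> a *\<^sub>C L x) F"
    by (rule Lim_transform_eventually) (use assms(3) in eventually_elim, simp add: clinear_def)
  ultimately show "L (a *\<^sub>C x) = a *\<^sub>C L x"
    using tendsto_unique[OF assms(2)] by blast
qed

lemma inverse_unique_blinfun:
  fixes A :: "'a::real_normed_vector \<Rightarrow>\<^sub>L 'a"
  assumes "B \<odot> A = id_blinfun" "A \<odot> C = id_blinfun" shows "B = C"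
  using assms comp_assoc[of B A C] by simp

lemma inv_blinfunI:
  assumes "A \<odot> B = id_blinfun" "B \<odot> A = id_blinfun"
  shows "invertible_blinfun A" "inv_blinfun A = B"
proof -
  show inv: "invertible_blinfun A" using assms by (auto simp: invertible_blinfun_def)
  have "(THE B. A \<odot> B = id_blinfun \<and> B \<odot> A = id_blinfun) = B"
    using assms by (intro the_equality conjI) (auto intro: inverse_unique_blinfun)
  then show "inv_blinfun A = B" using inv by (simp add: inv_blinfun_def)
qed

lemma inv_blinfun:
  assumes "invertible_blinfun A"
  shows "A \<odot> inv_blinfun A = id_blinfun" "inv_blinfun A \<odot> A = id_blinfun"
  using assms inv_blinfunI(2) unfolding invertible_blinfun_def by metis+

lemma inv_blinfun_apply [simp]:
  assumes "invertible_blinfun A"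
  shows "A (inv_blinfun A x) = x" "inv_blinfun A (A x) = x"
  using inv_blinfun[OF assms] by (metis blinfun_apply_blinfun_compose blinfun_apply_id_blinfun id_apply)+

text \<open>Where \<open>A\<close> has no inverse, the default value 0 of \<open>inv_blinfun\<close>
  is complex linear as well, so the claim covers every parameter of a resolvent.\<close>

lemma clinear_inv: assumes "clinear A" shows "clinear (inv_blinfun A)"
proof (cases "invertible_blinfun A")
  case True
  show ?thesis unfolding clinear_def
  proof (intro allI)
    fix a x
    have "inv_blinfun A (a *\<^sub>C x) = inv_blinfun A (a *\<^sub>C A (inv_blinfun A x))"
      using True by simp
    also have "\<dots> = inv_blinfun A (A (a *\<^sub>C inv_blinfun A x))"
      using assms by (simp add: clinear_def)
    also have "\<dots> = a *\<^sub>C inv_blinfun A x" using True by simp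
    finally show "inv_blinfun A (a *\<^sub>C x) = a *\<^sub>C inv_blinfun A x" .
  qed
qed (simp add: inv_blinfun_def clinear_intros)

lemma norm_comp_le_mult:
  "norm A \<le> a \<Longrightarrow> norm B \<le> b \<Longrightarrow> norm (A \<odot> B) \<le> a * b"
  by (meson norm_blinfun_compose mult_mono norm_ge_zero order_trans)

text \<open>Neumann series: \<open>p n\<close> is the \<open>n\<close>-th power of
  \<open>- X\<close>. The recursion multiplies on the left and \<open>p_Suc'\<close> rewrites it on
  the right, because a two-sided inverse is wanted.\<close>

lemma invertible_id_plus:
  fixes X :: "'a::banach \<Rightarrow>\<^sub>L 'a"
  assumes "norm X < 1"
  shows "invertible_blinfun (id_blinfun + X)"
proof -
  define p where "p = rec_nat id_blinfun (\<lambda>_ Y. - (X \<odot> Y))"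
  have p0: "p 0 = id_blinfun" and p_Suc: "p (Suc n) = - (X \<odot> p n)" for n
    by (simp_all add: p_def)
  have p_Suc': "p (Suc n) = - (p n \<odot> X)" for n
  proof (induction n)
    case (Suc n)
    have "p (Suc (Suc n)) = X \<odot> p n \<odot> X"
      by (subst p_Suc, subst Suc) (simp add: comp_simps)
    then show ?case by (simp add: p_Suc[of n] comp_simps)
  qed (simp add: p0 p_Suc)
  have "norm (p n) \<le> norm X ^ n" for n
    by (induction n) (auto simp: p0 p_Suc norm_blinfun_id_le intro: norm_comp_le_mult)
  then have sm: "summable p"
    by (intro summable_comparison_test[of p "\<lambda>n. norm X ^ n"] summable_geometric)
      (use assms in auto)
  define S where "S = suminf p"
  have "(\<lambda>n. X \<odot> p n) sums (X \<odot> S)" "(\<lambda>n. p n \<odot> X) sums (S \<odot> X)"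
    using sm unfolding S_def
    by (intro bounded_linear.sums[OF comp.bounded_linear_right]
        bounded_linear.sums[OF comp.bounded_linear_left] summable_sums; simp)+
  then have "(\<lambda>n. p (Suc n)) sums (- (X \<odot> S))" "(\<lambda>n. p (Suc n)) sums (- (S \<odot> X))"
    using sums_minus[of "\<lambda>n. X \<odot> p n"] sums_minus[of "\<lambda>n. p n \<odot> X"]
    by (simp_all add: p_Suc flip: p_Suc')
  moreover have "(\<lambda>n. p (Suc n)) sums (S - id_blinfun)"
    using sums_Suc_iff[of p "S - id_blinfun"] summable_sums[OF sm] by (simp add: p0 S_def)
  ultimately have "S - id_blinfun = - (X \<odot> S)" "S - id_blinfun = - (S \<odot> X)"
    by (blast intro: sums_unique2)+
  then have "(id_blinfun + X) \<odot> S = id_blinfun" "S \<odot> (id_blinfun + X) = id_blinfun"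
    by (simp_all add: comp_simps) (simp_all add: algebra_simps eq_diff_eq)
  then show ?thesis by (rule inv_blinfunI)
qed

text \<open>\<open>N - L^-1 = N (L - M) L^-1\<close>, once \<open>N\<close> is known to stay
  bounded. The inverses are passed in as \<open>N\<close> because in the application a resolvent
  identity gives them in closed form.\<close>

lemma tendsto_inv_blinfun:
  fixes M :: "'b \<Rightarrow> ('a::banach \<Rightarrow>\<^sub>L 'a)"
  assumes lim: "(M \<longlongrightarrow> L) F" and inv: "invertible_blinfun L"
    and MN: "\<forall>\<^sub>F y in F. M y \<odot> N y = id_blinfun \<and> N y \<odot> M y = id_blinfun"
  shows "(N \<longlongrightarrow> inv_blinfun L) F"
proof -
  let ?I = "inv_blinfun L"
  \<comment> \<open>The summand 1 keeps \<open>c\<close> positive. Closeness within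
    \<open>1 / (2 * c)\<close> makes the error at most half of \<open>norm (N y)\<close>, which is
    then absorbed on the left.\<close>
  define c where "c = norm ?I + 1"
  have c: "c > 0" "norm ?I \<le> c" by (auto simp: c_def add_nonneg_pos)
  have "\<forall>\<^sub>F y in F. dist (M y) L < 1 / (2 * c)"
    by (rule tendstoD[OF lim]) (use c in simp)
  then have bound: "\<forall>\<^sub>F y in F. norm (N y - ?I) \<le> 2 * c * norm (M y - L) * c"
    using MN
  proof eventually_elim
    case (elim y)
    have e1: "N y - ?I = N y \<odot> (L - M y) \<odot> ?I"
      using elim(2) inv_blinfun[OF inv] by (simp add: comp.diff_left comp.diff_right) (simp add: comp_assoc)
    have e2: "norm (N y - ?I) \<le> norm (N y) * norm (M y - L) * c"
      unfolding e1 by (intro norm_comp_le_mult c) (simp_all add: norm_minus_commute)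
    also have "\<dots> \<le> norm (N y) * (1 / (2 * c)) * c"
      using elim(1) c by (intro mult_right_mono mult_left_mono) (auto simp: dist_norm)
    also have "\<dots> = norm (N y) / 2" using c by simp
    finally have "norm (N y) \<le> norm ?I + norm (N y) / 2"
      using norm_triangle_ineq[of ?I "N y - ?I"] by simp
    then have "norm (N y) \<le> 2 * c" using c by linarith
    then show ?case
      by (intro order_trans[OF e2] mult_right_mono) (use c in auto)
  qed
  have "((\<lambda>y. 2 * c * norm (M y - L) * c) \<longlongrightarrow> 2 * c * norm (L - L) * c) F"
    by (intro tendsto_intros lim)
  then have "((\<lambda>y. 2 * c * norm (M y - L) * c) \<longlongrightarrow> 0) F" by simp
  from tendsto_0_le[OF this, of "\<lambda>y. N y - ?I" 1] bound
  have "((\<lambda>y. N y - ?I) \<longlongrightarrow> 0) F"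
    using c by (simp add: abs_mult abs_of_nonneg eventually_mono)
  then show ?thesis by (simp add: LIM_zero_iff)
qed

text \<open>\<open>1 - Y (1 + X Y)^-1 X\<close> inverts \<open>1 + Y X\<close>. It carries
  \<open>J\<close> and \<open>T\<close> across resolvents and, with one of the spaces equal to the
  complex numbers, reduces a rank one perturbation to a scalar.\<close>

lemma invertible_swap:
  fixes X :: "'b::real_normed_vector \<Rightarrow>\<^sub>L 'a::real_normed_vector" and Y :: "'a \<Rightarrow>\<^sub>L 'b"
  assumes "invertible_blinfun (id_blinfun + X \<odot> Y)"
  shows "invertible_blinfun (id_blinfun + Y \<odot> X)"
    "inv_blinfun (id_blinfun + Y \<odot> X) = id_blinfun - Y \<odot> inv_blinfun (id_blinfun + X \<odot> Y) \<odot> X"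
    "X \<odot> inv_blinfun (id_blinfun + Y \<odot> X) = inv_blinfun (id_blinfun + X \<odot> Y) \<odot> X"
proof -
  define N where "N = inv_blinfun (id_blinfun + X \<odot> Y)"
  have a: "N + X \<odot> (Y \<odot> N) = id_blinfun" and b: "N + N \<odot> (X \<odot> Y) = id_blinfun"
    using inv_blinfun[OF assms] by (simp_all add: N_def comp_simps)
  have a': "X \<odot> (Y \<odot> N) = id_blinfun - N" using a by (simp add: eq_diff_eq add.commute)
  have b': "N \<odot> (X \<odot> Y) = id_blinfun - N" using b by (simp add: eq_diff_eq add.commute)
  have a2: "X \<odot> (Y \<odot> (N \<odot> Z)) = Z - N \<odot> Z" for Z :: "'b \<Rightarrow>\<^sub>L 'a"
    using arg_cong[OF a', of "\<lambda>W. W \<odot> Z"] by (simp add: comp_simps)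
  have b2: "N \<odot> (X \<odot> (Y \<odot> Z)) = Z - N \<odot> Z" for Z :: "'b \<Rightarrow>\<^sub>L 'a"
    using arg_cong[OF b', of "\<lambda>W. W \<odot> Z"] by (simp add: comp_simps)
  have 1: "(id_blinfun + Y \<odot> X) \<odot> (id_blinfun - Y \<odot> N \<odot> X) = id_blinfun"
    by (simp add: comp_simps a2)
  have 2: "(id_blinfun - Y \<odot> N \<odot> X) \<odot> (id_blinfun + Y \<odot> X) = id_blinfun"
    by (simp add: comp_simps b2)
  show "invertible_blinfun (id_blinfun + Y \<odot> X)"
    and 3: "inv_blinfun (id_blinfun + Y \<odot> X) = id_blinfun - Y \<odot> inv_blinfun (id_blinfun + X \<odot> Y) \<odot> X"
    using inv_blinfunI[OF 1 2] by (simp_all add: N_def)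
  show "X \<odot> inv_blinfun (id_blinfun + Y \<odot> X) = inv_blinfun (id_blinfun + X \<odot> Y) \<odot> X"
    unfolding 3 N_def[symmetric] by (simp add: comp_simps a2)
qed

section \<open>Limits of operators of finite rank\<close>

definition rank_one :: "'b::complex_normed_vector \<Rightarrow> ('a::complex_normed_vector \<Rightarrow>\<^sub>L complex) \<Rightarrow> 'a \<Rightarrow>\<^sub>L 'b" where
  "rank_one a f = Blinfun (\<lambda>x. f x *\<^sub>C a)"

lemma rank_one_apply [simp]: "rank_one a f x = f x *\<^sub>C a"
  unfolding rank_one_def
  by (subst bounded_linear_Blinfun_apply)
    (auto intro!: bounded_linear_compose[OF scaleC.bounded_linear_left] blinfun.bounded_linear_right)

text \<open>Generated by adding rank one terms, so that rule induction is perturbation by one rank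
  at a time.\<close>

inductive finite_rank :: "('a::complex_normed_vector \<Rightarrow>\<^sub>L 'b::complex_normed_vector) \<Rightarrow> bool" where
  finite_rank_0: "finite_rank 0"
| finite_rank_add: "finite_rank G \<Longrightarrow> clinear f \<Longrightarrow> finite_rank (G + rank_one a f)"

lemma clinear_rank_one: "clinear f \<Longrightarrow> clinear (rank_one a f)"
  by (simp add: clinear_def scaleC_scaleC scaleC_complex_def)

lemma clinear_finite_rank: "finite_rank G \<Longrightarrow> clinear G"
  by (induction rule: finite_rank.induct) (auto intro: clinear_intros clinear_rank_one)

lemma finite_rank_comp_left: "finite_rank G \<Longrightarrow> clinear X \<Longrightarrow> finite_rank (X \<odot> G)"
proof (induction rule: finite_rank.induct)
  case (finite_rank_add G f a)
  have "X \<odot> (G + rank_one a f) = X \<odot> G + rank_one (X a) f"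
    using finite_rank_add.prems by (auto intro!: blinfun_eqI simp: blinfun.bilinear_simps clinear_def)
  then show ?case using finite_rank_add by (simp add: finite_rank.finite_rank_add)
qed (simp add: finite_rank_0)

lemma finite_rank_comp_right: "finite_rank G \<Longrightarrow> clinear X \<Longrightarrow> finite_rank (G \<odot> X)"
proof (induction rule: finite_rank.induct)
  case (finite_rank_add G f a)
  have "(G + rank_one a f) \<odot> X = G \<odot> X + rank_one a (f \<odot> X)"
    by (auto intro!: blinfun_eqI simp: blinfun.bilinear_simps)
  then show ?case using finite_rank_add by (simp add: finite_rank.finite_rank_add clinear_comp)
qed (simp add: finite_rank_0)

text \<open>The form in which compactness is used: it survives norm limits and compositions by plain
  norm estimates, and it is what the analytic Fredholm theorem takes as input.\<close>

definition finite_rank_limit :: "('a::complex_normed_vector \<Rightarrow>\<^sub>L 'b::complex_normed_vector) \<Rightarrow> bool" where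
  "finite_rank_limit K \<longleftrightarrow> clinear K \<and> (\<forall>\<epsilon>>0. \<exists>G. finite_rank G \<and> norm (K - G) < \<epsilon>)"

lemma finite_rank_limit_comp_left:
  assumes K: "finite_rank_limit K" and X: "clinear X"
  shows "finite_rank_limit (X \<odot> K)"
  unfolding finite_rank_limit_def
proof (intro conjI allI impI)
  show "clinear (X \<odot> K)" using assms by (simp add: clinear_comp finite_rank_limit_def)
  fix \<epsilon> :: real assume "\<epsilon> > 0"
  then have "\<epsilon> / (norm X + 1) > 0" by (intro divide_pos_pos) (auto intro: add_nonneg_pos)
  then obtain G where G: "finite_rank G" "norm (K - G) < \<epsilon> / (norm X + 1)"
    using K unfolding finite_rank_limit_def by metis
  have "norm (X \<odot> K - X \<odot> G) \<le> norm X * norm (K - G)"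
    by (metis comp.diff_right norm_blinfun_compose)
  also have "\<dots> \<le> (norm X + 1) * norm (K - G)" by (simp add: algebra_simps)
  also have "\<dots> < \<epsilon>" using G(2) by (simp add: pos_less_divide_eq add_nonneg_pos mult.commute)
  finally show "\<exists>G. finite_rank G \<and> norm (X \<odot> K - G) < \<epsilon>"
    using finite_rank_comp_left[OF G(1) X] by blast
qed

lemma finite_rank_limit_comp_right:
  assumes K: "finite_rank_limit K" and X: "clinear X"
  shows "finite_rank_limit (K \<odot> X)"
  unfolding finite_rank_limit_def
proof (intro conjI allI impI)
  show "clinear (K \<odot> X)" using assms by (simp add: clinear_comp finite_rank_limit_def)
  fix \<epsilon> :: real assume "\<epsilon> > 0"
  then have "\<epsilon> / (norm X + 1) > 0" by (intro divide_pos_pos) (auto intro: add_nonneg_pos)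
  then obtain G where G: "finite_rank G" "norm (K - G) < \<epsilon> / (norm X + 1)"
    using K unfolding finite_rank_limit_def by metis
  have "norm (K \<odot> X - G \<odot> X) \<le> norm (K - G) * norm X"
    by (metis comp.diff_left norm_blinfun_compose)
  also have "\<dots> \<le> norm (K - G) * (norm X + 1)" by (simp add: algebra_simps)
  also have "\<dots> < \<epsilon>" using G(2) by (simp add: pos_less_divide_eq add_nonneg_pos)
  finally show "\<exists>G. finite_rank G \<and> norm (K \<odot> X - G) < \<epsilon>"
    using finite_rank_comp_right[OF G(1) X] by blast
qed

lemma finite_rank_limit_tendsto:
  assumes lim: "(f \<longlongrightarrow> L) F" "F \<noteq> bot" and f: "\<forall>\<^sub>F x in F. finite_rank_limit (f x)"
  shows "finite_rank_limit L"
  unfolding finite_rank_limit_def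
proof (intro conjI allI impI)
  show "clinear L"
    by (rule clinear_tendsto[OF lim]) (use f in eventually_elim, simp add: finite_rank_limit_def)
  fix \<epsilon> :: real assume e: "\<epsilon> > 0"
  have "\<forall>\<^sub>F x in F. dist (f x) L < \<epsilon> / 2" using tendstoD[OF lim(1), of "\<epsilon>/2"] e by simp
  with f have "\<forall>\<^sub>F x in F. finite_rank_limit (f x) \<and> dist (f x) L < \<epsilon> / 2"
    by (rule eventually_conj)
  then obtain x where x: "finite_rank_limit (f x)" "dist (f x) L < \<epsilon> / 2"
    using eventually_happens'[OF lim(2)] by blast
  from x(1) e obtain G where G: "finite_rank G" "norm (f x - G) < \<epsilon> / 2"
    unfolding finite_rank_limit_def by (meson half_gt_zero)
  have "norm (L - G) \<le> norm (L - f x) + norm (f x - G)"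
    using norm_triangle_ineq[of "L - f x" "f x - G"] by simp
  also have "\<dots> < \<epsilon>" using G x(2) by (simp add: dist_norm norm_minus_commute)
  finally show "\<exists>G. finite_rank G \<and> norm (L - G) < \<epsilon>" using G(1) by blast
qed

definition cinner_blinfun :: "'a::complex_hilbert \<Rightarrow> 'a \<Rightarrow>\<^sub>L complex" where
  "cinner_blinfun e = Blinfun (cinner e)"

lemma cinner_blinfun_apply [simp]: "cinner_blinfun e x = cinner e x"
  unfolding cinner_blinfun_def
  by (subst bounded_linear_Blinfun_apply) (auto intro: cinner.bounded_linear_right)

lemma clinear_cinner_blinfun: "clinear (cinner_blinfun e)"
  by (simp add: clinear_def cinner_scaleC_right scaleC_complex_def)

text \<open>Gram-Schmidt phrased with projections: each new vector adds the rank one projection onto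
  its normalised component \<open>e\<close> orthogonal to the earlier range. The induction carries
  idempotence and symmetry, from which the norm bound follows by Pythagoras.\<close>

lemma finite_rank_projection:
  fixes Y :: "'a::complex_hilbert set"
  assumes "finite Y"
  obtains P :: "'a \<Rightarrow>\<^sub>L 'a" where "finite_rank P" "\<And>y. y \<in> Y \<Longrightarrow> P y = y" "\<And>x. norm (x - P x) \<le> norm x"
proof -
  have "\<exists>P. finite_rank P \<and> (\<forall>y\<in>Y. P y = y) \<and> (\<forall>x. P (P x) = P x) \<and>
      (\<forall>x y. cinner (P x) y = cinner x (P y))"
    using assms
  proof (induction rule: finite_induct)
    case empty
    then show ?case by (intro exI[of _ 0]) (simp add: finite_rank_0)
  next
    case (insert y Y)
    then obtain P where P: "finite_rank P" "\<And>y. y \<in> Y \<Longrightarrow> P y = y" "\<And>x. P (P x) = P x"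
      and sa: "\<And>x y. cinner (P x) y = cinner x (P y)" by blast
    show ?case
    proof (cases "P y = y")
      case True
      then show ?thesis using P sa by blast
    next
      case False
      define d where "d = y - P y"
      define e where "e = (1 / norm d) *\<^sub>R d"
      have d: "d \<noteq> 0" using False by (simp add: d_def)
      have Pd: "P d = 0" using P(3) by (simp add: d_def blinfun.bilinear_simps)
      then have Pe: "P e = 0" by (simp add: e_def blinfun.bilinear_simps)
      have clP: "clinear P" using P(1) by (rule clinear_finite_rank)
      have ePx: "cinner e (P x) = 0" for x using Pe by (simp flip: sa)
      have ee: "cinner e e = 1" using d
        by (simp add: e_def cinner_scaleR_left cinner_scaleR_right cinner_self scaleR_conv_of_real
            power2_eq_square)
      define Q where "Q = P + rank_one e (cinner_blinfun e)"
      have Q: "Q x = P x + cinner e x *\<^sub>C e" for x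
        by (simp add: Q_def blinfun.bilinear_simps)
      have "finite_rank Q" unfolding Q_def
        by (intro finite_rank_add P clinear_cinner_blinfun)
      moreover have "Q (Q x) = Q x" for x
        using clP Pe
        by (simp add: Q blinfun.bilinear_simps clinear_def P ePx ee cinner_add_right cinner_scaleC_right)
      moreover have "cinner (Q x) z = cinner x (Q z)" for x z
        using cinner_commute[of x e]
        by (simp add: Q cinner_add_left cinner_add_right cinner_scaleC_left cinner_scaleC_right sa)
      moreover have "Q x = x" if "x \<in> Y" for x
        using P(2)[OF that] ePx[of x] by (simp add: Q)
      moreover have "Q y = y"
      proof -
        have "cinner d y = cinner d d + cinner d (P y)"
          by (simp add: d_def cinner_diff_right)
        also have "cinner d (P y) = 0" using Pd by (simp flip: sa)
        finally have "cinner e y *\<^sub>C e = d"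
          using d
          by (simp add: e_def cinner_scaleC_left cinner_self scaleR_scaleC[of _ d] scaleC_scaleC
              scaleR_conv_of_real power2_eq_square)
        then show ?thesis by (simp add: Q d_def)
      qed
      ultimately show ?thesis by blast
    qed
  qed
  then obtain P where P: "finite_rank P" "\<And>y. y \<in> Y \<Longrightarrow> P y = y" "\<And>x. P (P x) = P x"
    and sa: "\<And>x y. cinner (P x) y = cinner x (P y)" by blast
  have "norm (x - P x) \<le> norm x" for x
  proof (rule power2_le_imp_le)
    have "cinner (P x) (x - P x) = 0"
      by (simp add: cinner_diff_right sa P)
    then have "(norm (P x + (x - P x)))\<^sup>2 = (norm (P x))\<^sup>2 + (norm (x - P x))\<^sup>2"
      by (subst norm_add_sq) simp
    then show "(norm (x - P x))\<^sup>2 \<le> (norm x)\<^sup>2" by simp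
  qed simp
  with P(1,2) that show ?thesis by blast
qed

text \<open>Compose with a projection \<open>P\<close> that fixes a finite net of the image of the
  unit ball. Since \<open>x - P x\<close> is never longer than \<open>x\<close>, the error at
  \<open>K x\<close> is at most the distance from \<open>K x\<close> to the net; mesh
  \<open>\<epsilon>/2\<close> leaves room for the strict inequality.\<close>

lemma finite_rank_limit_compact:
  fixes K :: "'a::complex_normed_vector \<Rightarrow>\<^sub>L 'b::complex_hilbert"
  assumes "compact_operator K"
  shows "finite_rank_limit K"
  unfolding finite_rank_limit_def
proof (intro conjI allI impI)
  show cl: "clinear K" using assms by (simp add: compact_operator_def)
  fix \<epsilon> :: real assume e: "\<epsilon> > 0"
  have "compact (closure (K ` cball 0 1))" using assms by (simp add: compact_operator_def)
  then obtain Y where Y: "finite Y" "closure (K ` cball 0 1) \<subseteq> (\<Union>y\<in>Y. ball y (\<epsilon>/2))"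
    unfolding compact_eq_totally_bounded using e by (meson half_gt_zero)
  obtain P where P: "finite_rank P" "\<And>y. y \<in> Y \<Longrightarrow> blinfun_apply P y = y"
    "\<And>x. norm (x - blinfun_apply P x) \<le> norm x"
    using finite_rank_projection[OF Y(1)] by blast
  have bnd: "norm ((K - P \<odot> K) x) \<le> \<epsilon> / 2" if "norm x \<le> 1" for x
  proof -
    have "K x \<in> closure (K ` cball 0 1)"
      using that closure_subset[of "K ` cball 0 1"] by auto
    then obtain y where y: "y \<in> Y" "dist y (K x) < \<epsilon> / 2" using Y(2) by auto
    have "(K - P \<odot> K) x = (K x - y) - P (K x - y)"
      using P(2)[OF y(1)] by (simp add: blinfun.bilinear_simps)
    then show ?thesis using P(3)[of "K x - y"] y(2) by (simp add: dist_norm norm_minus_commute)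
  qed
  have "norm (K - P \<odot> K) \<le> \<epsilon> / 2"
  proof (rule norm_blinfun_bound)
    fix x
    show "norm ((K - P \<odot> K) x) \<le> \<epsilon> / 2 * norm x"
    proof (cases "x = 0")
      case False
      then have "norm ((K - P \<odot> K) ((1 / norm x) *\<^sub>R x)) \<le> \<epsilon> / 2" by (intro bnd) simp
      then show ?thesis using False by (simp add: blinfun.scaleR_right field_simps)
    qed (simp add: blinfun.bilinear_simps)
  qed (use e in simp)
  then show "\<exists>G. finite_rank G \<and> norm (K - G) < \<epsilon>"
    using finite_rank_comp_right[OF P(1) cl] e by (intro exI[of _ "P \<odot> K"]) auto
qed

section \<open>Holomorphic functions with values in spaces of operators\<close>

lemma complex_differentiable_const [simp]: "complex_differentiable (\<lambda>_. c) z"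
  unfolding complex_differentiable_def by (rule exI[of _ 0]) (simp add: scaleC.zero_right)

lemma complex_differentiable_add:
  assumes "complex_differentiable f z" "complex_differentiable g z"
  shows "complex_differentiable (\<lambda>s. f s + g s) z"
proof -
  obtain D E where "(f has_derivative (\<lambda>h. h *\<^sub>C D)) (at z)" "(g has_derivative (\<lambda>h. h *\<^sub>C E)) (at z)"
    using assms by (auto simp: complex_differentiable_def)
  then have "((\<lambda>s. f s + g s) has_derivative (\<lambda>h. h *\<^sub>C (D + E))) (at z)"
    unfolding scaleC.add_right by (rule has_derivative_add)
  then show ?thesis by (auto simp: complex_differentiable_def)
qed

lemma complex_differentiable_bounded_linear:
  assumes f: "complex_differentiable f z" and T: "bounded_linear T" "\<And>a x. T (a *\<^sub>C x) = a *\<^sub>C T x"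
  shows "complex_differentiable (\<lambda>s. T (f s)) z"
proof -
  obtain D where "(f has_derivative (\<lambda>h. h *\<^sub>C D)) (at z)"
    using assms by (auto simp: complex_differentiable_def)
  from bounded_linear.has_derivative[OF T(1) this]
  have "((\<lambda>s. T (f s)) has_derivative (\<lambda>h. h *\<^sub>C T D)) (at z)" by (simp add: T(2))
  then show ?thesis by (auto simp: complex_differentiable_def)
qed

lemma complex_differentiable_diff:
  assumes "complex_differentiable f z" "complex_differentiable g z"
  shows "complex_differentiable (\<lambda>s. f s - g s) z"
proof -
  have "complex_differentiable (\<lambda>s. - g s) z"
    using complex_differentiable_bounded_linear[OF assms(2), of uminus]
    by (simp add: bounded_linear_minus scaleC.minus_right bounded_linear_ident)
  from complex_differentiable_add[OF assms(1) this] show ?thesis by simp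
qed

lemma complex_differentiable_scaleC:
  assumes "h field_differentiable (at z)" "complex_differentiable f z"
  shows "complex_differentiable (\<lambda>s. h s *\<^sub>C f s) z"
proof -
  obtain D d where f: "(f has_derivative (\<lambda>h. h *\<^sub>C D)) (at z)"
    and h: "(h has_derivative (\<lambda>h. d * h)) (at z)"
    using assms by (auto simp: complex_differentiable_def field_differentiable_def has_field_derivative_def)
  have "((\<lambda>s. h s *\<^sub>C f s) has_derivative (\<lambda>t. h z *\<^sub>C (t *\<^sub>C D) + (d * t) *\<^sub>C f z)) (at z)"
    by (rule scaleC.FDERIV[OF h f])
  also have "(\<lambda>t. h z *\<^sub>C (t *\<^sub>C D) + (d * t) *\<^sub>C f z) = (\<lambda>t. t *\<^sub>C (h z *\<^sub>C D + d *\<^sub>C f z))"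
    by (simp add: scaleC.add_right scaleC_scaleC mult.commute)
  finally show ?thesis by (auto simp: complex_differentiable_def)
qed

lemma complex_differentiable_isCont: "complex_differentiable f z \<Longrightarrow> isCont f z"
  by (auto simp: complex_differentiable_def intro: has_derivative_continuous)

lemma complex_differentiable_cong:
  assumes "complex_differentiable f z" "\<forall>\<^sub>F s in nhds z. f s = g s"
  shows "complex_differentiable g z"
proof -
  obtain D where f: "(f has_derivative (\<lambda>h. h *\<^sub>C D)) (at z)"
    using assms by (auto simp: complex_differentiable_def)
  have "f z = g z" using assms(2) by (rule eventually_nhds_x_imp_x)
  moreover have "\<forall>\<^sub>F s in at z. f s = g s"
    unfolding eventually_at_filter by (rule eventually_mono[OF assms(2)]) simp
  ultimately have "(g has_derivative (\<lambda>h. h *\<^sub>C D)) (at z)"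
    by (intro has_derivative_transform_eventually[OF f]) simp_all
  then show ?thesis by (auto simp: complex_differentiable_def)
qed

text \<open>Test functionals, chiefly the matrix elements of \<open>cfunctional_cinner\<close>:
  residues, Cauchy's formula and isolation of zeros are carried from scalar to operator-valued
  functions through them.\<close>

definition cfunctional :: "('v::complex_normed_vector \<Rightarrow> complex) \<Rightarrow> bool" where
  "cfunctional \<Phi> \<longleftrightarrow> bounded_linear \<Phi> \<and> (\<forall>a x. \<Phi> (a *\<^sub>C x) = a * \<Phi> x)"

lemma cfunctional_cinner: "cfunctional (\<lambda>A. cinner x (blinfun_apply A y))"
  unfolding cfunctional_def
  by (intro conjI bounded_linear_compose[OF cinner.bounded_linear_right] blinfun.bounded_linear_left)
    (simp add: cinner_scaleC_right)

lemma cfunctional_compose: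
  "cfunctional \<Phi> \<Longrightarrow> bounded_linear T \<Longrightarrow> (\<And>a x. T (a *\<^sub>C x) = a *\<^sub>C T x) \<Longrightarrow> cfunctional (\<lambda>x. \<Phi> (T x))"
  by (auto simp: cfunctional_def intro: bounded_linear_compose)

lemma cfunctional_field_differentiable:
  assumes "complex_differentiable f z" "cfunctional \<Phi>"
  shows "(\<lambda>s. \<Phi> (f s)) field_differentiable (at z)"
proof -
  obtain D where f: "(f has_derivative (\<lambda>h. h *\<^sub>C D)) (at z)"
    using assms by (auto simp: complex_differentiable_def)
  have "((\<lambda>s. \<Phi> (f s)) has_derivative (\<lambda>h. \<Phi> D * h)) (at z)"
    using bounded_linear.has_derivative[OF _ f, of \<Phi>] assms(2)
    by (simp add: cfunctional_def mult.commute)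
  then show ?thesis by (auto simp: field_differentiable_def has_field_derivative_def)
qed

lemma cfunctional_holomorphic_on:
  assumes "\<And>z. z \<in> S \<Longrightarrow> complex_differentiable f z" "cfunctional \<Phi>"
  shows "(\<lambda>s. \<Phi> (f s)) holomorphic_on S"
  unfolding holomorphic_on_def
  using cfunctional_field_differentiable[OF _ assms(2)] assms(1) field_differentiable_at_within by blast

section \<open>Removable singularities of operator-valued functions\<close>

lemma norm_blinfun_le_entries:
  fixes A :: "'a::real_normed_vector \<Rightarrow>\<^sub>L 'b::complex_hilbert"
  assumes "c \<ge> 0" "\<And>x y. cmod (cinner x (A y)) \<le> c * norm x * norm y"
  shows "norm A \<le> c"
proof (rule norm_blinfun_bound)
  fix y
  have "norm (A y) * norm (A y) \<le> (c * norm y) * norm (A y)"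
    using assms(2)[of "A y" y] by (simp add: cinner_self power2_eq_square mult_ac norm_mult)
  then show "norm (A y) \<le> c * norm y"
    using assms(1) by (cases "norm (A y) = 0") auto
qed (rule assms)

lemma eventually_at_punctured_ball: "r > 0 \<Longrightarrow> \<forall>\<^sub>F w in at z. w \<in> ball z r - {z}"
  using eventually_at_ball'[of r z UNIV] by simp

text \<open>Extend over \<open>z\<close> and apply Cauchy's estimate on circles of radius
  \<open>r/4\<close> about points of the half-size ball: they stay inside \<open>ball z r\<close>
  and give the derivative bound \<open>4 * M / r\<close>.\<close>

lemma bounded_holomorphic_lipschitz:
  fixes f :: "complex \<Rightarrow> complex"
  assumes holo: "f holomorphic_on ball z r - {z}" and r: "r > 0"
    and bound: "\<And>w. w \<in> ball z r - {z} \<Longrightarrow> cmod (f w) \<le> M"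
    and st: "s \<in> ball z (r/2) - {z}" "t \<in> ball z (r/2) - {z}"
  shows "cmod (f s - f t) \<le> 4 * M / r * cmod (s - t)"
proof -
  note near = eventually_at_punctured_ball[OF r, of z]
  then have ev: "\<forall>\<^sub>F w in at z. cmod (f w) \<le> M" by eventually_elim (rule bound)
  have zi: "z \<in> interior (ball z r)" using r by simp
  obtain g where g: "g holomorphic_on ball z r" "\<And>w. w \<in> ball z r - {z} \<Longrightarrow> g w = f w"
    using holomorphic_on_extend_bounded[OF holo zi] ev by blast
  have "isCont g z"
    using holomorphic_on_imp_continuous_on[OF g(1)] r by (simp add: continuous_on_eq_continuous_at)
  then have "(g \<longlongrightarrow> g z) (at z)" by (simp add: isCont_def)
  moreover have "\<forall>\<^sub>F w in at z. cmod (g w) \<le> M"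
    using near by eventually_elim (use g(2) bound in auto)
  ultimately have gz: "cmod (g z) \<le> M"
    by (intro tendsto_upperbound[OF tendsto_norm]) auto
  have gM: "cmod (g w) \<le> M" if "w \<in> ball z r" for w
    using gz g(2)[of w] bound[of w] that by (cases "w = z") auto
  have deriv: "cmod (deriv g w) \<le> 4 * M / r" if w: "w \<in> ball z (r/2)" for w
  proof -
    have sub: "cball w (r/4) \<subseteq> ball z r"
    proof
      fix u assume "u \<in> cball w (r/4)"
      then show "u \<in> ball z r" using w r dist_triangle[of z u w] by auto
    qed
    have "norm ((deriv ^^ 1) g w) \<le> fact 1 * M / (r/4) ^ 1"
    proof (rule Cauchy_inequality)
      show "g holomorphic_on ball w (r/4)"
        using g(1) sub ball_subset_cball holomorphic_on_subset by blast
      show "continuous_on (cball w (r/4)) g"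
        using g(1) sub holomorphic_on_imp_continuous_on holomorphic_on_subset by blast
      show "cmod (g x) \<le> M" if "cmod (w - x) = r / 4" for x
        using sub that by (intro gM) (auto simp: dist_norm)
    qed (use r in simp)
    then show ?thesis by (simp add: mult.commute)
  qed
  have "norm (g s - g t) \<le> 4 * M / r * norm (s - t)"
  proof (rule field_differentiable_bound[OF convex_ball[of z "r/2"] _ deriv])
    fix w assume w: "w \<in> ball z (r/2)"
    then have "w \<in> ball z r" using r by simp
    then show "(g has_field_derivative deriv g w) (at w within ball z (r / 2))"
      using g(1) by (meson DERIV_subset holomorphic_derivI open_ball subset_UNIV)
  qed (use st in auto)
  then show ?thesis using g(2)[of s] g(2)[of t] st r by auto
qed

lemma at_within_punctured_ball: "r > 0 \<Longrightarrow> at z within (ball z r - {z}) = at z"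
  by (rule at_within_nhd[of _ "ball z r"]) auto

text \<open>The Lipschitz constants of the matrix elements scale with
  \<open>norm x * norm y\<close>, so the estimate passes to the operator norm; completeness then
  turns weak holomorphy into a norm limit.\<close>

lemma tendsto_if_weakly_holomorphic_bounded:
  fixes f :: "complex \<Rightarrow> 'a::real_normed_vector \<Rightarrow>\<^sub>L 'b::complex_hilbert"
  assumes r: "r > 0"
    and holo: "\<And>x y. (\<lambda>s. cinner x (f s y)) holomorphic_on ball z r - {z}"
    and bound: "\<And>w. w \<in> ball z r - {z} \<Longrightarrow> norm (f w) \<le> M"
  obtains L where "(f \<longlongrightarrow> L) (at z)"
    "\<And>s. s \<in> ball z (r/2) - {z} \<Longrightarrow> norm (f s - L) \<le> 4 * M / r * cmod (s - z)"
proof -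
  have "ball z r - {z} \<noteq> {}"
    using eventually_happens'[OF _ eventually_at_punctured_ball[OF r, of z]] by auto
  then have M: "M \<ge> 0" using bound norm_ge_zero order_trans by blast
  have lip: "norm (f s - f t) \<le> 4 * M / r * cmod (s - t)"
    if st: "s \<in> ball z (r/2) - {z}" "t \<in> ball z (r/2) - {z}" for s t
  proof (rule norm_blinfun_le_entries)
    show "0 \<le> 4 * M / r * cmod (s - t)" using M r by simp
    fix x y
    have "cmod (cinner x (f w y)) \<le> M * norm x * norm y" if "w \<in> ball z r - {z}" for w
    proof -
      have "cmod (cinner x (f w y)) \<le> norm x * norm (f w y)" by (rule cinner_cauchy_schwarz)
      also have "\<dots> \<le> norm x * (M * norm y)"
        by (intro mult_left_mono order_trans[OF norm_blinfun] mult_right_mono bound that) auto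
      finally show ?thesis by (simp add: mult_ac)
    qed
    from bounded_holomorphic_lipschitz[OF holo r this st]
    show "cmod (cinner x ((f s - f t) y)) \<le> 4 * M / r * cmod (s - t) * norm x * norm y"
      by (simp add: blinfun.bilinear_simps cinner_diff_right mult_ac)
  qed
  have "(4 * M / r)-lipschitz_on (ball z (r/2) - {z}) f"
    using lip M r by (intro lipschitz_onI) (auto simp: dist_norm)
  then have "uniformly_continuous_on (ball z (r/2) - {z}) f"
    by (rule lipschitz_on_uniformly_continuous)
  moreover have "z \<in> closure (ball z (r/2) - {z})"
    using r at_within_punctured_ball[of "r/2" z] at_within_eq_bot_iff[of z "ball z (r/2) - {z}"]
    by simp
  ultimately obtain L where "(f \<longlongrightarrow> L) (at z within (ball z (r/2) - {z}))"
    using uniformly_continuous_on_extension_at_closure by blast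
  then have L: "(f \<longlongrightarrow> L) (at z)" using r by (simp add: at_within_punctured_ball)
  have "norm (f s - L) \<le> 4 * M / r * cmod (s - z)" if s: "s \<in> ball z (r/2) - {z}" for s
  proof (rule tendsto_le)
    show "((\<lambda>t. norm (f s - f t)) \<longlongrightarrow> norm (f s - L)) (at z)" by (intro tendsto_intros L)
    show "((\<lambda>t. 4 * M / r * cmod (s - t)) \<longlongrightarrow> 4 * M / r * cmod (s - z)) (at z)"
      by (intro tendsto_intros)
    show "\<forall>\<^sub>F t in at z. norm (f s - f t) \<le> 4 * M / r * cmod (s - t)"
      by (rule eventually_mono[OF eventually_at_punctured_ball[of "r/2" z] lip[OF s]]) (use r in simp)
  qed simp
  with L that show ?thesis by blast
qed

text \<open>The preceding lemma is used twice: on \<open>f\<close> for the missing value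
  \<open>L\<close>, and on the difference quotient \<open>q\<close>, which the Lipschitz bound keeps
  bounded, for the derivative at \<open>z\<close>.\<close>

lemma removable_singularity:
  fixes f :: "complex \<Rightarrow> 'a::real_normed_vector \<Rightarrow>\<^sub>L 'b::complex_hilbert"
  assumes r: "r > 0"
    and diff: "\<And>w. w \<in> ball z r - {z} \<Longrightarrow> complex_differentiable f w"
    and bound: "\<And>w. w \<in> ball z r - {z} \<Longrightarrow> norm (f w) \<le> M"
  obtains g where "\<And>w. w \<in> ball z r \<Longrightarrow> complex_differentiable g w" "\<And>w. w \<noteq> z \<Longrightarrow> g w = f w"
proof -
  have holo: "(\<lambda>s. cinner x (f s y)) holomorphic_on ball z r - {z}" for x y
    using diff by (intro cfunctional_holomorphic_on cfunctional_cinner)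
  obtain L where L: "(f \<longlongrightarrow> L) (at z)"
    and Lb: "\<And>s. s \<in> ball z (r/2) - {z} \<Longrightarrow> norm (f s - L) \<le> 4 * M / r * cmod (s - z)"
    using tendsto_if_weakly_holomorphic_bounded[OF r holo bound] by blast
  define q where "q s = inverse (s - z) *\<^sub>C (f s - L)" for s
  have "complex_differentiable q w" if w: "w \<in> ball z (r/2) - {z}" for w
  proof -
    have "w \<in> ball z r - {z}" using w r by simp
    with w show ?thesis unfolding q_def
      by (intro complex_differentiable_scaleC complex_differentiable_diff diff derivative_intros
          complex_differentiable_const field_differentiable_inverse) auto
  qed
  then have "(\<lambda>s. cinner x (q s y)) holomorphic_on ball z (r/2) - {z}" for x y
    by (intro cfunctional_holomorphic_on cfunctional_cinner)
  moreover have "norm (q s) \<le> 4 * M / r" if s: "s \<in> ball z (r/2) - {z}" for s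
  proof -
    have "norm (q s) = norm (f s - L) / cmod (s - z)"
      by (simp add: q_def norm_scaleC norm_inverse divide_inverse mult.commute)
    also have "\<dots> \<le> 4 * M / r" using Lb[OF s] s by (subst pos_divide_le_eq) auto
    finally show ?thesis .
  qed
  ultimately obtain D where D: "(q \<longlongrightarrow> D) (at z)"
    by (rule tendsto_if_weakly_holomorphic_bounded[of "r/2" q z "4 * M / r", OF half_gt_zero[OF r]])
  define g where "g = f(z := L)"
  have "(g has_derivative (\<lambda>h. h *\<^sub>C D)) (at z)"
    unfolding has_derivative_def
  proof (intro conjI scaleC.bounded_linear_left)
    have "((\<lambda>y. q y - D) \<longlongrightarrow> 0) (at z)" using D by (simp add: LIM_zero)
    then have "((\<lambda>y. norm (q y - D)) \<longlongrightarrow> 0) (at z)" by (rule tendsto_norm_zero)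
    then have "((\<lambda>y. norm ((g y - g z - (y - z) *\<^sub>C D) /\<^sub>R norm (y - z))) \<longlongrightarrow> 0) (at z)"
    proof (rule Lim_transform_eventually)
      have "\<forall>\<^sub>F y in at z. y \<noteq> z" by (simp add: eventually_at_filter)
      then show "\<forall>\<^sub>F y in at z. norm (q y - D) = norm ((g y - g z - (y - z) *\<^sub>C D) /\<^sub>R norm (y - z))"
      proof eventually_elim
        case (elim y)
        then have "q y - D = inverse (y - z) *\<^sub>C (g y - g z - (y - z) *\<^sub>C D)"
          by (simp add: q_def g_def scaleC.diff_right)
        then show ?case by (simp add: norm_scaleC norm_inverse)
      qed
    qed
    \<comment> \<open>\<open>has_derivative_def\<close> spells the base point as the limit of the
      identity; \<open>Lim_ident_at\<close> gives back \<open>z\<close>.\<close>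
    then show "((\<lambda>y. (g y - g (Lim (at z) (\<lambda>x. x)) - (y - Lim (at z) (\<lambda>x. x)) *\<^sub>C D) /\<^sub>R
        norm (y - Lim (at z) (\<lambda>x. x))) \<longlongrightarrow> 0) (at z)"
      by (simp only: tendsto_norm_zero_iff Lim_ident_at trivial_limit_at not_False_eq_True)
  qed
  then have gz: "complex_differentiable g z" by (auto simp: complex_differentiable_def)
  have "complex_differentiable g w" if "w \<in> ball z r" for w
  proof (cases "w = z")
    case False
    have "\<forall>\<^sub>F s in nhds w. s \<in> - {z}" using False by (intro eventually_nhds_in_open) auto
    then have "\<forall>\<^sub>F s in nhds w. f s = g s" by eventually_elim (simp add: g_def)
    from complex_differentiable_cong[OF _ this] show ?thesis using diff[of w] False that by simp
  qed (use gz in simp)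
  then show ?thesis using that[of g] by (simp add: g_def)
qed

text \<open>Poles are controlled by growth, so no power series of operators are needed.\<close>

lemma pole_order_le_iff:
  fixes f :: "complex \<Rightarrow> 'a::real_normed_vector \<Rightarrow>\<^sub>L 'b::complex_hilbert"
  shows "pole_order_le n f z \<longleftrightarrow>
    (\<exists>C. \<forall>\<^sub>F s in at z. complex_differentiable f s \<and> cmod (s - z) ^ n * norm (f s) \<le> C)"
proof
  assume "pole_order_le n f z"
  then obtain r g where r: "r > 0" and g: "\<And>w. w \<in> ball z r \<Longrightarrow> complex_differentiable g w"
    and f: "\<And>w. w \<in> ball z r - {z} \<Longrightarrow> f w = inverse ((w - z) ^ n) *\<^sub>C g w"
    unfolding pole_order_le_def by blast
  have "isCont g z" using g r by (simp add: complex_differentiable_isCont)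
  then have "\<forall>\<^sub>F s in at z. dist (g s) (g z) < 1"
    unfolding isCont_def by (rule tendstoD) simp
  then have "\<forall>\<^sub>F s in at z. complex_differentiable f s \<and> cmod (s - z) ^ n * norm (f s) \<le> norm (g z) + 1"
    using eventually_at_punctured_ball[OF r, of z]
  proof eventually_elim
    case (elim s)
    have "norm (g s) \<le> norm (g z) + 1"
      using elim(1) norm_triangle_ineq2[of "g s" "g z"] by (simp add: dist_norm)
    then have "cmod (s - z) ^ n * norm (f s) \<le> norm (g z) + 1"
      using f[OF elim(2)] elim(2) by (simp add: norm_scaleC norm_inverse norm_power flip: mult.assoc)
    moreover have "complex_differentiable f s"
    proof (rule complex_differentiable_cong)
      show "complex_differentiable (\<lambda>w. inverse ((w - z) ^ n) *\<^sub>C g w) s"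
        using elim(2) by (intro complex_differentiable_scaleC g field_differentiable_inverse
            derivative_intros field_differentiable_power) auto
      have "\<forall>\<^sub>F w in nhds s. w \<in> ball z r - {z}"
        using elim(2) by (intro eventually_nhds_in_open) auto
      then show "\<forall>\<^sub>F w in nhds s. inverse ((w - z) ^ n) *\<^sub>C g w = f w"
        by eventually_elim (simp add: f)
    qed
    ultimately show ?case by blast
  qed
  then show "\<exists>C. \<forall>\<^sub>F s in at z. complex_differentiable f s \<and> cmod (s - z) ^ n * norm (f s) \<le> C" by blast
next
  assume "\<exists>C. \<forall>\<^sub>F s in at z. complex_differentiable f s \<and> cmod (s - z) ^ n * norm (f s) \<le> C"
  then obtain C r where r: "r > 0"
    and ev: "\<And>s. s \<in> ball z r - {z} \<Longrightarrow> complex_differentiable f s \<and> cmod (s - z) ^ n * norm (f s) \<le> C"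
    unfolding eventually_at by (auto simp: dist_commute)
  obtain g where g: "\<And>w. w \<in> ball z r \<Longrightarrow> complex_differentiable g w"
    "\<And>w. w \<noteq> z \<Longrightarrow> g w = (w - z) ^ n *\<^sub>C f w"
  proof (rule removable_singularity[OF r, of z "\<lambda>w. (w - z) ^ n *\<^sub>C f w" C])
    show "complex_differentiable (\<lambda>w. (w - z) ^ n *\<^sub>C f w) w" if "w \<in> ball z r - {z}" for w
      using ev[OF that] by (intro complex_differentiable_scaleC derivative_intros field_differentiable_power) auto
    show "norm ((w - z) ^ n *\<^sub>C f w) \<le> C" if "w \<in> ball z r - {z}" for w
      using ev[OF that] by (simp add: norm_scaleC norm_power)
  qed blast
  have "\<forall>w\<in>ball z r - {z}. f w = inverse ((w - z) ^ n) *\<^sub>C g w"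
    by (auto simp: g(2))
  then show "pole_order_le n f z" unfolding pole_order_le_def using r g(1) by blast
qed

section \<open>Residues and the resolvent identity\<close>

lemma eventually_at_eventually_nhds:
  fixes z :: complex
  assumes "\<forall>\<^sub>F s in at z. P s"
  shows "\<forall>\<^sub>F s in at z. \<forall>\<^sub>F w in nhds s. P w"
proof -
  obtain d where d: "d > 0" "\<And>s. s \<in> ball z d - {z} \<Longrightarrow> P s"
    using assms unfolding eventually_at by (auto simp: dist_commute)
  from eventually_at_punctured_ball[OF d(1), of z] show ?thesis
  proof eventually_elim
    case (elim s)
    then have "\<forall>\<^sub>F w in nhds s. w \<in> ball z d - {z}"
      by (intro eventually_nhds_in_open) auto
    then show ?case by eventually_elim (rule d)
  qed
qed

lemma pole_order_le_cong:
  assumes "pole_order_le n f z" and eq: "\<forall>\<^sub>F s in at z. f s = g s"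
  shows "pole_order_le n g z"
proof -
  obtain r h where r: "r > 0" and h: "\<And>w. w \<in> ball z r \<Longrightarrow> complex_differentiable h w"
    and f: "\<And>w. w \<in> ball z r - {z} \<Longrightarrow> f w = inverse ((w - z) ^ n) *\<^sub>C h w"
    using assms(1) unfolding pole_order_le_def by blast
  obtain d where d: "d > 0" "\<And>s. s \<in> ball z d - {z} \<Longrightarrow> f s = g s"
    using eq unfolding eventually_at by (auto simp: dist_commute)
  show ?thesis unfolding pole_order_le_def
  proof (intro exI[of _ "min r d"] exI[of _ h] conjI ballI)
    fix w assume "w \<in> ball z (min r d) - {z}"
    then show "g w = inverse ((w - z) ^ n) *\<^sub>C h w" using f[of w] d(2)[of w] by auto
  qed (use r d h in auto)
qed

lemma pole_order_le_const: "pole_order_le n (\<lambda>_. c) z"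
  unfolding pole_order_le_def
proof (intro exI[of _ 1] exI[of _ "\<lambda>w. (w - z) ^ n *\<^sub>C c"] conjI ballI)
  show "complex_differentiable (\<lambda>w. (w - z) ^ n *\<^sub>C c) w" for w
    by (intro complex_differentiable_scaleC complex_differentiable_const derivative_intros
        field_differentiable_power)
qed auto

lemma pole_order_le_linear:
  assumes "pole_order_le n f z" and T: "bounded_linear T" "\<And>a x. T (a *\<^sub>C x) = a *\<^sub>C T x"
  shows "pole_order_le n (\<lambda>s. T (f s)) z"
proof -
  obtain r h where r: "r > 0" and h: "\<And>w. w \<in> ball z r \<Longrightarrow> complex_differentiable h w"
    and f: "\<And>w. w \<in> ball z r - {z} \<Longrightarrow> f w = inverse ((w - z) ^ n) *\<^sub>C h w"
    using assms(1) unfolding pole_order_le_def by blast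
  show ?thesis unfolding pole_order_le_def
    by (intro exI[of _ r] exI[of _ "\<lambda>s. T (h s)"] conjI ballI
        complex_differentiable_bounded_linear[OF h T]) (use r f T in auto)
qed

text \<open>Both differences of exponents are truncated: for \<open>j \<le> n\<close> the order
  drops to \<open>n - j\<close>, and for \<open>j > n\<close> it is 0 while the surplus power joins
  the numerator.\<close>

lemma pole_order_le_power:
  assumes "pole_order_le n f z"
  shows "pole_order_le (n - j) (\<lambda>s. (s - z) ^ j *\<^sub>C f s) z"
proof -
  obtain r h where r: "r > 0" and h: "\<And>w. w \<in> ball z r \<Longrightarrow> complex_differentiable h w"
    and f: "\<And>w. w \<in> ball z r - {z} \<Longrightarrow> f w = inverse ((w - z) ^ n) *\<^sub>C h w"
    using assms unfolding pole_order_le_def by blast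
  show ?thesis unfolding pole_order_le_def
  proof (intro exI[of _ r] exI[of _ "\<lambda>w. (w - z) ^ (j - n) *\<^sub>C h w"] conjI ballI)
    show "complex_differentiable (\<lambda>w. (w - z) ^ (j - n) *\<^sub>C h w) w" if "w \<in> ball z r" for w
      by (intro complex_differentiable_scaleC h that derivative_intros field_differentiable_power)
    fix w assume w: "w \<in> ball z r - {z}"
    then have "(w - z) ^ j * inverse ((w - z) ^ n) = inverse ((w - z) ^ (n - j)) * (w - z) ^ (j - n)"
      by (cases "j \<le> n") (auto simp: field_simps simp flip: power_add)
    then show "(w - z) ^ j *\<^sub>C f w = inverse ((w - z) ^ (n - j)) *\<^sub>C (w - z) ^ (j - n) *\<^sub>C h w"
      using f[OF w] by (simp add: scaleC_scaleC)
  qed (use r in auto)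
qed

lemma pole_order_le_mono:
  assumes "pole_order_le n f z" "n \<le> m"
  shows "pole_order_le m f z"
proof -
  obtain r h where r: "r > 0" and h: "\<And>w. w \<in> ball z r \<Longrightarrow> complex_differentiable h w"
    and f: "\<And>w. w \<in> ball z r - {z} \<Longrightarrow> f w = inverse ((w - z) ^ n) *\<^sub>C h w"
    using assms unfolding pole_order_le_def by blast
  show ?thesis unfolding pole_order_le_def
  proof (intro exI[of _ r] exI[of _ "\<lambda>w. (w - z) ^ (m - n) *\<^sub>C h w"] conjI ballI)
    show "complex_differentiable (\<lambda>w. (w - z) ^ (m - n) *\<^sub>C h w) w" if "w \<in> ball z r" for w
      by (intro complex_differentiable_scaleC h that derivative_intros field_differentiable_power)
    fix w assume w: "w \<in> ball z r - {z}"
    then have "inverse ((w - z) ^ n) = inverse ((w - z) ^ m) * (w - z) ^ (m - n)"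
      using assms(2) by (auto simp: field_simps simp flip: power_add)
    then show "f w = inverse ((w - z) ^ m) *\<^sub>C (w - z) ^ (m - n) *\<^sub>C h w"
      using f[OF w] by (simp add: scaleC_scaleC)
  qed (use r in auto)
qed

lemma pole_order_le_diff:
  assumes f: "pole_order_le n f z" and g: "pole_order_le m g z"
  shows "pole_order_le (max n m) (\<lambda>s. f s - g s) z"
proof -
  obtain r h where r: "r > 0" and h: "\<And>w. w \<in> ball z r \<Longrightarrow> complex_differentiable h w"
    and f: "\<And>w. w \<in> ball z r - {z} \<Longrightarrow> f w = inverse ((w - z) ^ max n m) *\<^sub>C h w"
    using pole_order_le_mono[OF f max.cobounded1] unfolding pole_order_le_def by blast
  obtain r' h' where r': "r' > 0" and h': "\<And>w. w \<in> ball z r' \<Longrightarrow> complex_differentiable h' w"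
    and g: "\<And>w. w \<in> ball z r' - {z} \<Longrightarrow> g w = inverse ((w - z) ^ max n m) *\<^sub>C h' w"
    using pole_order_le_mono[OF g max.cobounded2] unfolding pole_order_le_def by blast
  show ?thesis unfolding pole_order_le_def
  proof (intro exI[of _ "min r r'"] exI[of _ "\<lambda>w. h w - h' w"] conjI ballI)
    show "complex_differentiable (\<lambda>w. h w - h' w) w" if "w \<in> ball z (min r r')" for w
      using that by (intro complex_differentiable_diff h h') auto
    fix w assume w: "w \<in> ball z (min r r') - {z}"
    then show "f w - g w = inverse ((w - z) ^ max n m) *\<^sub>C (h w - h' w)"
      using f[of w] g[of w] by (simp add: scaleC.diff_right)
  qed (use r r' in auto)
qed

lemma pole_order_le_eventually_differentiable:
  assumes "pole_order_le n f z"
  shows "\<forall>\<^sub>F s in at z. complex_differentiable f s"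
proof -
  obtain r h where r: "r > 0" and h: "\<And>w. w \<in> ball z r \<Longrightarrow> complex_differentiable h w"
    and f: "\<And>w. w \<in> ball z r - {z} \<Longrightarrow> f w = inverse ((w - z) ^ n) *\<^sub>C h w"
    using assms unfolding pole_order_le_def by blast
  from eventually_at_punctured_ball[OF r, of z] show ?thesis
  proof eventually_elim
    case (elim s)
    have "\<forall>\<^sub>F w in nhds s. w \<in> ball z r - {z}"
      using elim by (intro eventually_nhds_in_open) auto
    then have "\<forall>\<^sub>F w in nhds s. inverse ((w - z) ^ n) *\<^sub>C h w = f w"
      by eventually_elim (simp add: f)
    moreover have "complex_differentiable (\<lambda>w. inverse ((w - z) ^ n) *\<^sub>C h w) s"
      using elim by (intro complex_differentiable_scaleC h field_differentiable_inverse
            derivative_intros field_differentiable_power) auto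
    ultimately show ?case by (rule complex_differentiable_cong[rotated])
  qed
qed

lemma pole_order_le_functional_holomorphic:
  assumes "pole_order_le n f z" "cfunctional \<Phi>"
  obtains r where "r > 0" "(\<lambda>s. \<Phi> (f s)) holomorphic_on ball z r - {z}"
proof -
  obtain d where "d > 0" "\<And>s. s \<in> ball z d - {z} \<Longrightarrow> complex_differentiable f s"
    using pole_order_le_eventually_differentiable[OF assms(1)] unfolding eventually_at
    by (auto simp: dist_commute)
  then show ?thesis using that[of d] cfunctional_holomorphic_on[OF _ assms(2)] by blast
qed

text \<open>The radius chosen by \<^const>\<open>small_radius\<close> only guarantees differentiability on the closed
  punctured disc, so the contour may not be moved outwards; Cauchy's formula with continuity on
  the closed disc still applies.\<close>

lemma residue_vec_functional:
  fixes f :: "complex \<Rightarrow> 'v::{complex_normed_vector,banach}"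
  assumes pole: "pole_order_le n f z" and \<Phi>: "cfunctional \<Phi>"
  shows "\<Phi> (residue_vec f z) = residue (\<lambda>s. \<Phi> (f s)) z"
proof -
  have \<Phi>_bl: "bounded_linear \<Phi>" and \<Phi>_scaleC: "\<Phi> (a *\<^sub>C x) = a * \<Phi> x" for a x
    using \<Phi> by (auto simp: cfunctional_def)
  obtain r h where r: "r > 0" and h: "\<And>w. w \<in> ball z r \<Longrightarrow> complex_differentiable h w"
    and f: "\<And>w. w \<in> ball z r - {z} \<Longrightarrow> f w = inverse ((w - z) ^ n) *\<^sub>C h w"
    using pole unfolding pole_order_le_def by blast
  define \<epsilon> where "\<epsilon> = small_radius f z"
  have "\<exists>\<epsilon>>0. \<forall>w\<in>cball z \<epsilon> - {z}. complex_differentiable f w"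
  proof -
    obtain d where d: "d > 0" "\<And>s. s \<in> ball z d - {z} \<Longrightarrow> complex_differentiable f s"
      using pole_order_le_eventually_differentiable[OF pole] unfolding eventually_at
      by (auto simp: dist_commute)
    then show ?thesis by (intro exI[of _ "d/2"]) auto
  qed
  from someI_ex[OF this] have \<epsilon>: "\<epsilon> > 0" "\<And>w. w \<in> cball z \<epsilon> - {z} \<Longrightarrow> complex_differentiable f w"
    unfolding \<epsilon>_def small_radius_def by blast+
  define e where "e w = (if w = z then 0 else (w - z) ^ Suc n * \<Phi> (f w))" for w
  have e_diff: "e field_differentiable at w" if w: "w \<in> cball z \<epsilon>" for w
  proof (cases "w = z")
    case False
    have "(\<lambda>w. (w - z) ^ Suc n * \<Phi> (f w)) field_differentiable at w"
      using False w by (intro field_differentiable_mult field_differentiable_power derivative_intros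
          cfunctional_field_differentiable[OF _ \<Phi>] \<epsilon>) auto
    moreover have "\<forall>\<^sub>F u in nhds w. u \<in> - {z}" using False by (intro eventually_nhds_in_open) auto
    then have ev: "\<forall>\<^sub>F u in nhds w. (u - z) ^ Suc n * \<Phi> (f u) = e u"
      by eventually_elim (simp add: e_def)
    ultimately show ?thesis
      unfolding field_differentiable_def DERIV_cong_ev[OF refl ev refl] by blast
  next
    case True
    have "(\<lambda>w. (w - z) * \<Phi> (h w)) field_differentiable at w"
      using True r by (intro field_differentiable_mult derivative_intros
          cfunctional_field_differentiable[OF _ \<Phi>] h) auto
    moreover have "\<forall>\<^sub>F u in nhds w. u \<in> ball z r" using True r by (intro eventually_nhds_in_open) auto
    then have ev: "\<forall>\<^sub>F u in nhds w. (u - z) * \<Phi> (h u) = e u"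
      by eventually_elim (auto simp: e_def f \<Phi>_scaleC)
    ultimately show ?thesis
      unfolding field_differentiable_def DERIV_cong_ev[OF refl ev refl] by blast
  qed
  have e_cont: "continuous_on (cball z \<epsilon>) e"
    using e_diff by (intro continuous_at_imp_continuous_on ballI field_differentiable_imp_continuous_at)
  have e_holo: "e holomorphic_on ball z \<epsilon>"
    unfolding holomorphic_on_def using e_diff by (auto intro: field_differentiable_at_within)
  have ef: "e u / (u - z) ^ Suc n = \<Phi> (f u)" if "u \<noteq> z" for u
    using that by (simp add: e_def)
  have "residue (\<lambda>u. e u / (u - z) ^ Suc n) z = (deriv ^^ n) e z / fact n"
    using \<epsilon>(1) by (intro residue_holomorphic_over_power[of "ball z \<epsilon>"] e_holo) auto
  moreover have "residue (\<lambda>u. e u / (u - z) ^ Suc n) z = residue (\<lambda>u. \<Phi> (f u)) z"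
    by (intro residue_cong refl) (use ef in \<open>auto simp: eventually_at_filter\<close>)
  moreover have "((\<lambda>u. e u / (u - z) ^ Suc n) has_contour_integral
      ((2 * pi * \<i>) / fact n * (deriv ^^ n) e z)) (circlepath z \<epsilon>)"
    using \<epsilon>(1) by (intro Cauchy_has_contour_integral_higher_derivative_circlepath e_cont e_holo) auto
  ultimately have "((\<lambda>u. e u / (u - z) ^ Suc n) has_contour_integral
      (2 * pi * \<i> * residue (\<lambda>u. \<Phi> (f u)) z)) (circlepath z \<epsilon>)"
    by (simp only: times_divide_eq_left times_divide_eq_right)
  then have "((\<lambda>u. \<Phi> (f u)) has_contour_integral
      (2 * pi * \<i> * residue (\<lambda>u. \<Phi> (f u)) z)) (circlepath z \<epsilon>)"
    using \<epsilon>(1) by (subst has_contour_integral_cong[OF ef [symmetric] refl refl]) (auto simp: path_image_circlepath)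
  then have int: "integral {0..1} (\<lambda>t. \<Phi> (f (circlepath z \<epsilon> t)) *
      vector_derivative (circlepath z \<epsilon>) (at t within {0..1})) =
      2 * pi * \<i> * residue (\<lambda>u. \<Phi> (f u)) z"
    unfolding has_contour_integral_def by (rule integral_unique)
  let ?g = "\<lambda>t. vector_derivative (circlepath z \<epsilon>) (at t within {0..1}) *\<^sub>C f (circlepath z \<epsilon> t)"
  \<comment> \<open>Pulling \<open>\<Phi>\<close> out of the integral requires integrability of the
    vector-valued integrand, which follows from continuity on the circle.\<close>
  have "continuous_on (sphere z \<epsilon>) f"
    using \<epsilon> by (intro continuous_at_imp_continuous_on ballI complex_differentiable_isCont) auto
  then have "continuous_on {0..1} (\<lambda>t. f (circlepath z \<epsilon> t))"
    using \<epsilon>(1) path_image_circlepath[of z \<epsilon>] path_circlepath[of z \<epsilon>]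
    by (intro continuous_on_compose2[of "sphere z \<epsilon>" f "{0..1}" "circlepath z \<epsilon>"])
      (auto simp: path_def path_image_def)
  moreover have "continuous_on {0..1} (\<lambda>t. vector_derivative (circlepath z \<epsilon>) (at t within {0..1}))"
    by (subst continuous_on_cong[OF refl vector_derivative_circlepath01]) (auto intro!: continuous_intros)
  ultimately have "continuous_on {0..1} ?g" by (intro scaleC.continuous_on)
  then have "?g integrable_on {0..1}" by (rule integrable_continuous_interval)
  from integral_linear[OF this \<Phi>_bl]
  have "\<Phi> (contour_integral_vec (circlepath z \<epsilon>) f) = 2 * pi * \<i> * residue (\<lambda>u. \<Phi> (f u)) z"
    unfolding contour_integral_vec_def int[symmetric] by (simp add: o_def \<Phi>_scaleC mult.commute)
  then show ?thesis by (simp add: residue_vec_def \<Phi>_scaleC flip: \<epsilon>_def)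
qed

text \<open>The two sides may be integrals over circles of different radii, since
  \<open>small_radius\<close> depends on the function; scalar residues depend on the germ alone and
  decide the equality.\<close>

lemma residue_vec_cong:
  fixes f g :: "complex \<Rightarrow> 'a::real_normed_vector \<Rightarrow>\<^sub>L 'b::complex_hilbert"
  assumes "pole_order_le n f z" "\<forall>\<^sub>F s in at z. f s = g s"
  shows "residue_vec f z = residue_vec g z"
proof (rule blinfun_cinner_eqI)
  fix x y
  have "residue (\<lambda>s. cinner x (f s y)) z = residue (\<lambda>s. cinner x (g s y)) z"
    by (intro residue_cong refl eventually_mono[OF assms(2)]) simp
  then show "cinner x (residue_vec f z y) = cinner x (residue_vec g z y)"
    using residue_vec_functional[OF assms(1) cfunctional_cinner]
      residue_vec_functional[OF pole_order_le_cong[OF assms] cfunctional_cinner] by simp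
qed

lemma residue_vec_linear:
  fixes f :: "complex \<Rightarrow> 'v::{complex_normed_vector,banach}"
    and T :: "'v \<Rightarrow> 'a::real_normed_vector \<Rightarrow>\<^sub>L 'b::complex_hilbert"
  assumes "pole_order_le n f z" and T: "bounded_linear T" "\<And>a x. T (a *\<^sub>C x) = a *\<^sub>C T x"
  shows "residue_vec (\<lambda>s. T (f s)) z = T (residue_vec f z)"
proof (rule blinfun_cinner_eqI)
  fix x y
  show "cinner x (residue_vec (\<lambda>s. T (f s)) z y) = cinner x (T (residue_vec f z) y)"
    using residue_vec_functional[OF pole_order_le_linear[OF assms] cfunctional_cinner]
      residue_vec_functional[OF assms(1) cfunctional_compose[OF cfunctional_cinner T]] by simp
qed

lemma residue_vec_diff:
  fixes f g :: "complex \<Rightarrow> 'a::real_normed_vector \<Rightarrow>\<^sub>L 'b::complex_hilbert"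
  assumes f: "pole_order_le n f z" and g: "pole_order_le m g z"
  shows "residue_vec (\<lambda>s. f s - g s) z = residue_vec f z - residue_vec g z"
proof (rule blinfun_cinner_eqI)
  fix x y
  let ?e = "\<lambda>A :: 'a \<Rightarrow>\<^sub>L 'b. cinner x (blinfun_apply A y)"
  obtain r where r: "r > 0" "(\<lambda>s. ?e (f s)) holomorphic_on ball z r - {z}"
    using pole_order_le_functional_holomorphic[OF f cfunctional_cinner[of x y]] by blast
  obtain r' where r': "r' > 0" "(\<lambda>s. ?e (g s)) holomorphic_on ball z r' - {z}"
    using pole_order_le_functional_holomorphic[OF g cfunctional_cinner[of x y]] by blast
  have "residue (\<lambda>s. ?e (f s) - ?e (g s)) z = residue (\<lambda>s. ?e (f s)) z - residue (\<lambda>s. ?e (g s)) z"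
    by (rule residue_diff[of "ball z (min r r')"])
      (use r r' in \<open>auto intro: holomorphic_on_subset\<close>)
  then show "?e (residue_vec (\<lambda>s. f s - g s) z) = ?e (residue_vec f z - residue_vec g z)"
    using residue_vec_functional[OF f cfunctional_cinner[of x y]]
      residue_vec_functional[OF g cfunctional_cinner[of x y]]
      residue_vec_functional[OF pole_order_le_diff[OF f g] cfunctional_cinner[of x y]]
    by (simp add: blinfun.bilinear_simps cinner_diff_right)
qed

lemma residue_vec_removable:
  fixes f :: "complex \<Rightarrow> 'a::real_normed_vector \<Rightarrow>\<^sub>L 'b::complex_hilbert"
  assumes "pole_order_le 0 f z"
  shows "residue_vec f z = 0"
proof (rule blinfun_cinner_eqI)
  fix x y
  let ?e = "\<lambda>A :: 'a \<Rightarrow>\<^sub>L 'b. cinner x (blinfun_apply A y)"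
  obtain r h where r: "r > 0" and h: "\<And>w. w \<in> ball z r \<Longrightarrow> complex_differentiable h w"
    and f: "\<And>w. w \<in> ball z r - {z} \<Longrightarrow> f w = h w"
    using assms unfolding pole_order_le_def by (metis power_0 inverse_1 scaleC_one)
  have "residue (\<lambda>s. ?e (f s)) z = residue (\<lambda>s. ?e (h s)) z"
    by (intro residue_cong refl eventually_mono[OF eventually_at_punctured_ball[OF r]]) (simp add: f)
  also have "\<dots> = 0"
    using r by (intro residue_holo[of "ball z r"] cfunctional_holomorphic_on h cfunctional_cinner) auto
  finally show "?e (residue_vec f z) = ?e 0"
    using residue_vec_functional[OF assms cfunctional_cinner[of x y]] by simp
qed

text \<open>By Cauchy's formula the residue is \<open>C\<close> times the \<open>i\<close>-th
  derivative of \<open>(s - z) ^ k\<close> at \<open>z\<close> over \<open>fact i\<close>. For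
  \<open>k < i\<close> the derivative is identically zero, for \<open>k > i\<close> a zero at
  \<open>z\<close> is left.\<close>

lemma residue_vec_power_const:
  fixes C :: "'a::real_normed_vector \<Rightarrow>\<^sub>L 'b::complex_hilbert"
  shows "residue_vec (\<lambda>s. ((s - z) ^ k / (s - z) ^ Suc i) *\<^sub>C C) z = (if k = i then C else 0)"
    and "pole_order_le (Suc i) (\<lambda>s. ((s - z) ^ k / (s - z) ^ Suc i) *\<^sub>C C) z"
proof -
  show pole: "pole_order_le (Suc i) (\<lambda>s. ((s - z) ^ k / (s - z) ^ Suc i) *\<^sub>C C) z"
    unfolding pole_order_le_def
  proof (intro exI[of _ 1] exI[of _ "\<lambda>s. (s - z) ^ k *\<^sub>C C"] conjI ballI)
    show "complex_differentiable (\<lambda>w. (w - z) ^ k *\<^sub>C C) w" for w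
      by (intro complex_differentiable_scaleC complex_differentiable_const derivative_intros
          field_differentiable_power)
  qed (simp_all add: scaleC_scaleC divide_inverse mult.commute)
  show "residue_vec (\<lambda>s. ((s - z) ^ k / (s - z) ^ Suc i) *\<^sub>C C) z = (if k = i then C else 0)"
  proof (rule blinfun_cinner_eqI)
    fix x y
    have "residue (\<lambda>s. ((s - z) ^ k * cinner x (C y)) / (s - z) ^ Suc i) z =
        (deriv ^^ i) (\<lambda>s. (s - z) ^ k * cinner x (C y)) z / fact i"
      by (intro residue_holomorphic_over_power[of UNIV] holomorphic_intros) auto
    also have "(deriv ^^ i) (\<lambda>s. (s - z) ^ k * cinner x (C y)) z =
        cinner x (C y) * (deriv ^^ i) (\<lambda>s. (s - z) ^ k) z"
      using higher_deriv_cmult[of "\<lambda>s. (s - z) ^ k" UNIV z i "cinner x (C y)"]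
      by (simp add: mult.commute holomorphic_intros)
    also have "(deriv ^^ i) (\<lambda>s. (s - z) ^ k) z = (if k = i then fact i else 0)"
      by (cases "k = i"; cases "k < i") (auto simp: higher_deriv_power pochhammer_fact pochhammer_0_left)
    finally show "cinner x (residue_vec (\<lambda>s. ((s - z) ^ k / (s - z) ^ Suc i) *\<^sub>C C) z y) =
        cinner x ((if k = i then C else 0) y)"
      using residue_vec_functional[OF pole cfunctional_cinner[of x y]]
      by (simp add: cinner_scaleC_right mult_ac)
  qed
qed

text \<open>Differentiability at the zero of \<open>h\<close> bounds \<open>norm (h s)\<close> by
  \<open>cmod (s - z) * (1 + norm D)\<close> near \<open>z\<close>, which saves one power in the
  growth of \<open>f\<close>.\<close>

lemma pole_order_le_numerator:
  fixes f :: "complex \<Rightarrow> 'a::real_normed_vector \<Rightarrow>\<^sub>L 'b::complex_hilbert"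
  assumes r: "r > 0" and h: "\<And>w. w \<in> ball z r \<Longrightarrow> complex_differentiable h w"
    and f: "\<And>w. w \<in> ball z r - {z} \<Longrightarrow> f w = inverse ((w - z) ^ Suc n) *\<^sub>C h w"
    and "h z = 0"
  shows "pole_order_le n f z"
proof -
  have pole: "pole_order_le (Suc n) f z" unfolding pole_order_le_def using r h f by blast
  obtain D where D: "(h has_derivative (\<lambda>t. t *\<^sub>C D)) (at z)"
    using h[of z] r by (auto simp: complex_differentiable_def)
  then obtain d where d: "d > 0"
    "\<And>y. norm (y - z) < d \<Longrightarrow> norm (h y - h z - (y - z) *\<^sub>C D) \<le> 1 * norm (y - z)"
    unfolding has_derivative_at_alt by (meson zero_less_one)
  have "\<forall>\<^sub>F s in at z. complex_differentiable f s \<and> cmod (s - z) ^ n * norm (f s) \<le> 1 + norm D"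
    using pole_order_le_eventually_differentiable[OF pole]
      eventually_at_punctured_ball[OF r, of z] eventually_at_punctured_ball[OF d(1), of z]
  proof eventually_elim
    case (elim s)
    have "norm (h s) \<le> norm (h s - h z - (s - z) *\<^sub>C D) + norm ((s - z) *\<^sub>C D)"
      using norm_triangle_ineq[of "h s - h z - (s - z) *\<^sub>C D" "(s - z) *\<^sub>C D"] \<open>h z = 0\<close> by simp
    also have "\<dots> \<le> cmod (s - z) + cmod (s - z) * norm D"
      using d(2)[of s] elim(3) by (auto simp: norm_scaleC dist_norm norm_minus_commute)
    finally have "norm (h s) \<le> cmod (s - z) * (1 + norm D)" by (simp add: algebra_simps)
    moreover have "cmod (s - z) ^ n * norm (f s) = norm (h s) / cmod (s - z)"
    proof -
      have "norm (f s) = inverse (cmod (s - z) ^ Suc n) * norm (h s)"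
        using elim(2) by (simp only: f norm_scaleC norm_inverse norm_power)
      then show ?thesis using elim(2) by (simp add: field_simps)
    qed
    moreover have "cmod (s - z) > 0" using elim(2) by simp
    ultimately show ?case using elim(1) by (simp add: pos_divide_le_eq mult.commute)
  qed
  then show ?thesis unfolding pole_order_le_iff by blast
qed

text \<open>The factor \<open>(s - z) ^ n\<close> turns the leading Laurent coefficient, the value
  \<open>h z\<close> of the numerator, into a residue. Iteration removes the whole principal
  part.\<close>

lemma pole_order_le_reduce:
  fixes f :: "complex \<Rightarrow> 'a::real_normed_vector \<Rightarrow>\<^sub>L 'b::complex_hilbert"
  assumes pole: "pole_order_le (Suc n) f z" and res: "residue_vec (\<lambda>s. (s - z) ^ n *\<^sub>C f s) z = 0"
  shows "pole_order_le n f z"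
proof -
  obtain r h where r: "r > 0" and h: "\<And>w. w \<in> ball z r \<Longrightarrow> complex_differentiable h w"
    and f: "\<And>w. w \<in> ball z r - {z} \<Longrightarrow> f w = inverse ((w - z) ^ Suc n) *\<^sub>C h w"
    using pole unfolding pole_order_le_def by blast
  have "h z = 0"
  proof (rule blinfun_cinner_eqI)
    fix x y
    let ?e = "\<lambda>A :: 'a \<Rightarrow>\<^sub>L 'b. cinner x (blinfun_apply A y)"
    have "0 = ?e (residue_vec (\<lambda>s. (s - z) ^ n *\<^sub>C f s) z)" by (simp add: res)
    also have "\<dots> = residue (\<lambda>s. ?e ((s - z) ^ n *\<^sub>C f s)) z"
      by (rule residue_vec_functional[OF pole_order_le_power[OF pole] cfunctional_cinner])
    also have "\<dots> = residue (\<lambda>s. ?e (h s) / (s - z) ^ Suc 0) z"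
    proof (intro residue_cong refl eventually_mono[OF eventually_at_punctured_ball[OF r]])
      fix s assume "s \<in> ball z r - {z}"
      then show "?e ((s - z) ^ n *\<^sub>C f s) = ?e (h s) / (s - z) ^ Suc 0"
        by (simp add: f cinner_scaleC_right scaleC_scaleC divide_inverse mult.commute)
    qed
    also have "\<dots> = ?e (h z)"
      using residue_holomorphic_over_power[OF open_ball[of z r] _
          cfunctional_holomorphic_on[OF h cfunctional_cinner[of x y]], of z 0] r by simp
    finally show "?e (h z) = ?e 0" by simp
  qed
  from pole_order_le_numerator[OF r h f this] show ?thesis .
qed

lemma pole_order_le_0_if_residues_0:
  fixes f :: "complex \<Rightarrow> 'a::real_normed_vector \<Rightarrow>\<^sub>L 'b::complex_hilbert"
  assumes "pole_order_le n f z" "\<And>j. residue_vec (\<lambda>s. (s - z) ^ j *\<^sub>C f s) z = 0"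
  shows "pole_order_le 0 f z"
  using assms by (induction n) (auto intro: pole_order_le_reduce)

lemma clinear_residue_vec:
  fixes f :: "complex \<Rightarrow> 'a::complex_normed_vector \<Rightarrow>\<^sub>L 'b::complex_hilbert"
  assumes pole: "pole_order_le n f z" and cl: "\<forall>\<^sub>F s in at z. clinear (f s)"
  shows "clinear (residue_vec f z)"
  unfolding clinear_def
proof (intro allI, rule cinner_ext_right)
  fix a x y
  obtain r where r: "r > 0" "(\<lambda>s. cinner x (f s y)) holomorphic_on ball z r - {z}"
    using pole_order_le_functional_holomorphic[OF pole cfunctional_cinner[of x y]] by blast
  have "cinner x (residue_vec f z (a *\<^sub>C y)) = residue (\<lambda>s. cinner x (f s (a *\<^sub>C y))) z"
    by (rule residue_vec_functional[OF pole cfunctional_cinner])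
  also have "\<dots> = residue (\<lambda>s. a * cinner x (f s y)) z"
    by (intro residue_cong refl eventually_mono[OF cl]) (simp add: clinear_def cinner_scaleC_right)
  also have "\<dots> = a * residue (\<lambda>s. cinner x (f s y)) z"
    by (rule residue_lmul[OF _ _ r(2)]) (use r in auto)
  also have "\<dots> = cinner x (a *\<^sub>C residue_vec f z y)"
    using residue_vec_functional[OF pole cfunctional_cinner[of x y]] by (simp add: cinner_scaleC_right)
  finally show "cinner x (residue_vec f z (a *\<^sub>C y)) = cinner x (a *\<^sub>C residue_vec f z y)" .
qed

lemma
  assumes "clinear X"
  shows bounded_linear_comp_left: "bounded_linear (\<lambda>A. X \<odot> A)"
    and comp_left_scaleC: "X \<odot> (a *\<^sub>C A) = a *\<^sub>C (X \<odot> A)"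
  using assms by (auto simp: comp_scaleC_right intro: comp.bounded_linear_right)

lemma residue_vec_sum:
  fixes f :: "'i \<Rightarrow> complex \<Rightarrow> 'a::real_normed_vector \<Rightarrow>\<^sub>L 'b::complex_hilbert"
  assumes "finite I" "\<And>i. i \<in> I \<Longrightarrow> \<exists>n. pole_order_le n (f i) z"
  shows "residue_vec (\<lambda>s. \<Sum>i\<in>I. f i s) z = (\<Sum>i\<in>I. residue_vec (f i) z) \<and>
    (\<exists>n. pole_order_le n (\<lambda>s. \<Sum>i\<in>I. f i s) z)"
  using assms
proof (induction I rule: finite_induct)
  case empty
  have "pole_order_le 0 (\<lambda>s. 0 :: 'a \<Rightarrow>\<^sub>L 'b) z" by (rule pole_order_le_const)
  then show ?case using residue_vec_removable by auto
next
  case (insert i I)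
  obtain n where n: "pole_order_le n (f i) z" using insert by auto
  obtain m where m: "pole_order_le m (\<lambda>s. \<Sum>i\<in>I. f i s) z"
    and res: "residue_vec (\<lambda>s. \<Sum>i\<in>I. f i s) z = (\<Sum>i\<in>I. residue_vec (f i) z)"
    using insert by auto
  have m': "pole_order_le m (\<lambda>s. - (\<Sum>i\<in>I. f i s)) z"
    using pole_order_le_linear[OF m, of uminus]
    by (simp add: bounded_linear_minus bounded_linear_ident scaleC.minus_right)
  have res': "residue_vec (\<lambda>s. - (\<Sum>i\<in>I. f i s)) z = - (\<Sum>i\<in>I. residue_vec (f i) z)"
    using residue_vec_linear[OF m, of uminus] res
    by (simp add: bounded_linear_minus bounded_linear_ident scaleC.minus_right)
  show ?case
    using residue_vec_diff[OF n m'] pole_order_le_diff[OF n m'] res' insert by auto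
qed

text \<open>Isolates what the Laurent calculus uses, since it is applied both to
  \<open>J T(s)\<close> and to \<open>T(s) J\<close>. The identity is asked for \<open>t\<close>
  near \<open>z\<close> first and then for \<open>s\<close> near \<open>z\<close>, so the
  exceptional \<open>s\<close> may depend on \<open>t\<close>.\<close>

locale resolvent_pole =
  fixes B :: "complex \<Rightarrow> 'a::complex_hilbert \<Rightarrow>\<^sub>L 'a" and z :: complex and n :: nat
  assumes pole: "pole_order_le n B z"
    and clin: "\<forall>\<^sub>F s in at z. clinear (B s)"
    and resolvent: "\<forall>\<^sub>F t in at z. \<forall>\<^sub>F s in at z. B s - B t = (t - s) *\<^sub>C (B s \<odot> B t)"
begin

text \<open>The Laurent coefficient of \<open>(s - z)\<close> to the power \<open>- (j + 1)\<close>: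
  \<open>N 0\<close> is the residue projection and \<open>N 1\<close> the nilpotent part.\<close>

definition N :: "nat \<Rightarrow> 'a \<Rightarrow>\<^sub>L 'a" where
  "N j = residue_vec (\<lambda>s. (s - z) ^ j *\<^sub>C B s) z"

lemma N_eq_0: "j \<ge> n \<Longrightarrow> N j = 0"
  unfolding N_def using pole_order_le_power[OF pole, of j] by (intro residue_vec_removable) simp

lemma clinear_N: "clinear (N j)"
  unfolding N_def
  by (rule clinear_residue_vec[OF pole_order_le_power[OF pole]])
    (use clin in eventually_elim, simp add: clinear_intros)

text \<open>Multiply the resolvent identity by \<open>(s - z) ^ j\<close>, write
  \<open>t - s\<close> as \<open>(t - z) - (s - z)\<close>, and take residues in \<open>s\<close>
  with \<open>t\<close> fixed. The term containing only \<open>B t\<close> is holomorphic in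
  \<open>s\<close> and drops out.\<close>

lemma N_comp: "\<forall>\<^sub>F t in at z. \<forall>j. (t - z) *\<^sub>C (N j \<odot> B t) = N j + N (Suc j) \<odot> B t"
  using resolvent
proof eventually_elim
  case (elim t)
  show ?case
  proof
    fix j
    let ?f = "\<lambda>j s. (s - z) ^ j *\<^sub>C B s"
    have 1: "(s - z) ^ j *\<^sub>C B s - (s - z) ^ j *\<^sub>C B t =
        (t - z) *\<^sub>C (?f j s \<odot> B t) - ?f (Suc j) s \<odot> B t"
      if "B s - B t = (t - s) *\<^sub>C (B s \<odot> B t)" for s
    proof -
      have "(s - z) ^ j *\<^sub>C B s - (s - z) ^ j *\<^sub>C B t = (s - z) ^ j *\<^sub>C ((t - s) *\<^sub>C (B s \<odot> B t))"
        by (simp only: that flip: scaleC.diff_right)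
      also have "\<dots> = (((t - z) * (s - z) ^ j - (s - z) ^ Suc j)) *\<^sub>C (B s \<odot> B t)"
        by (simp add: scaleC_scaleC algebra_simps)
      finally show ?thesis by (simp add: comp_scaleC_left scaleC_scaleC scaleC.diff_left)
    qed
    note pole_j = pole_order_le_power[OF pole]
    have lin: "bounded_linear (\<lambda>X. X \<odot> B t)" "(a *\<^sub>C X) \<odot> B t = a *\<^sub>C (X \<odot> B t)" for a X
      by (auto intro: comp.bounded_linear_left simp: comp_scaleC_left)
    have lin': "bounded_linear (\<lambda>X. (t - z) *\<^sub>C (X \<odot> B t))"
        "(t - z) *\<^sub>C ((a *\<^sub>C X) \<odot> B t) = a *\<^sub>C (t - z) *\<^sub>C (X \<odot> B t)" for a X
      by (auto intro: bounded_linear_compose[OF scaleC.bounded_linear_right] comp.bounded_linear_left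
          simp: comp_scaleC_left scaleC_scaleC mult.commute)
    have const: "pole_order_le 0 (\<lambda>s. (s - z) ^ j *\<^sub>C B t) z"
      using pole_order_le_power[OF pole_order_le_const[of 0 "B t" z], of j] by simp
    have "N j = residue_vec (\<lambda>s. (s - z) ^ j *\<^sub>C B s - (s - z) ^ j *\<^sub>C B t) z"
      unfolding residue_vec_diff[OF pole_j const] by (simp add: N_def residue_vec_removable[OF const])
    also have "\<dots> = residue_vec (\<lambda>s. (t - z) *\<^sub>C (?f j s \<odot> B t) - ?f (Suc j) s \<odot> B t) z"
      by (rule residue_vec_cong[OF pole_order_le_diff[OF pole_j const]])
        (use elim in eventually_elim, rule 1)
    also have "\<dots> = (t - z) *\<^sub>C (N j \<odot> B t) - N (Suc j) \<odot> B t"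
      unfolding N_def
      by (simp only: residue_vec_diff[OF pole_order_le_linear[OF pole_j lin'] pole_order_le_linear[OF pole_j lin]]
          residue_vec_linear[OF pole_j lin] residue_vec_linear[OF pole_j lin'])
    finally show "(t - z) *\<^sub>C (N j \<odot> B t) = N j + N (Suc j) \<odot> B t"
      by (simp add: algebra_simps)
  qed
qed

text \<open>Solve \<open>N_comp\<close> for \<open>N j \<odot> B t\<close> and iterate
  \<open>n\<close> times; the remainder carries \<open>N (j + n)\<close>, which vanishes.\<close>

lemma N_expansion:
  "\<forall>\<^sub>F t in at z. \<forall>j. N j \<odot> B t = (\<Sum>i<n. (1 / (t - z) ^ Suc i) *\<^sub>C N (j + i))"
  using N_comp eventually_at_punctured_ball[OF zero_less_one, of z]
proof eventually_elim
  case (elim t)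
  have x: "t - z \<noteq> 0" using elim by simp
  have step: "N j \<odot> B t = (1 / (t - z)) *\<^sub>C N j + (1 / (t - z)) *\<^sub>C (N (Suc j) \<odot> B t)" for j
  proof -
    have "N j \<odot> B t = (1 / (t - z)) *\<^sub>C (t - z) *\<^sub>C (N j \<odot> B t)"
      using x by (simp add: scaleC_scaleC)
    then show ?thesis using elim by (simp add: scaleC.add_right)
  qed
  have "N j \<odot> B t = (\<Sum>i<m. (1 / (t - z) ^ Suc i) *\<^sub>C N (j + i)) + (1 / (t - z) ^ m) *\<^sub>C (N (j + m) \<odot> B t)" for j m
  proof (induction m)
    case (Suc m)
    have "(1 / (t - z) ^ m) *\<^sub>C (N (j + m) \<odot> B t) =
        (1 / (t - z) ^ Suc m) *\<^sub>C N (j + m) + (1 / (t - z) ^ Suc m) *\<^sub>C (N (j + Suc m) \<odot> B t)"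
      by (subst step) (simp add: scaleC.add_right scaleC_scaleC mult.commute)
    then show ?case using Suc by (simp add: add.assoc)
  qed simp
  from this[of _ n] show ?case by (simp add: N_eq_0)
qed

text \<open>The residue of the expansion weighted with \<open>(t - z) ^ k\<close> keeps the term
  \<open>i = k\<close>; for \<open>k \<ge> n\<close> no term is left and the right side is zero as
  well. In particular \<open>N 0\<close> is idempotent and every \<open>N j\<close> factors through
  it.\<close>

lemma N_mult: "N j \<odot> N k = N (j + k)"
proof -
  have lin: "bounded_linear (\<lambda>X. N j \<odot> X)" "N j \<odot> (a *\<^sub>C X) = a *\<^sub>C (N j \<odot> X)" for a X
    using bounded_linear_comp_left[OF clinear_N] comp_left_scaleC[OF clinear_N] by auto
  note pole_k = pole_order_le_power[OF pole, of k]
  let ?f = "\<lambda>i t. ((t - z) ^ k / (t - z) ^ Suc i) *\<^sub>C N (j + i)"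
  have "N j \<odot> N k = residue_vec (\<lambda>t. N j \<odot> ((t - z) ^ k *\<^sub>C B t)) z"
    unfolding N_def[of k] by (rule residue_vec_linear[OF pole_k lin, symmetric])
  also have "\<dots> = residue_vec (\<lambda>t. \<Sum>i<n. ?f i t) z"
  proof (rule residue_vec_cong[OF pole_order_le_linear[OF pole_k lin]])
    show "\<forall>\<^sub>F t in at z. N j \<odot> ((t - z) ^ k *\<^sub>C B t) = (\<Sum>i<n. ?f i t)"
      using N_expansion
    proof eventually_elim
      case (elim t)
      then have "N j \<odot> ((t - z) ^ k *\<^sub>C B t) = (t - z) ^ k *\<^sub>C (\<Sum>i<n. (1 / (t - z) ^ Suc i) *\<^sub>C N (j + i))"
        by (simp only: lin)
      also have "\<dots> = (\<Sum>i<n. ?f i t)" by (simp add: scaleC.sum_right scaleC_scaleC)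
      finally show ?case .
    qed
  qed
  also have "\<dots> = (\<Sum>i<n. residue_vec (?f i) z)"
    using residue_vec_sum[of "{..<n}" ?f z] residue_vec_power_const(2) by blast
  also have "\<dots> = (\<Sum>i<n. if k = i then N (j + i) else 0)"
    by (simp only: residue_vec_power_const)
  also have "\<dots> = N (j + k)" by (auto simp: N_eq_0)
  finally show ?thesis .
qed

lemma removable_comp:
  fixes X :: "'a \<Rightarrow>\<^sub>L 'b::complex_hilbert"
  assumes X: "clinear X" and "X \<odot> N 0 = 0"
  shows "pole_order_le 0 (\<lambda>s. X \<odot> B s) z"
proof (rule pole_order_le_0_if_residues_0)
  note lin = bounded_linear_comp_left[OF X] comp_left_scaleC[OF X]
  show "pole_order_le n (\<lambda>s. X \<odot> B s) z" by (rule pole_order_le_linear[OF pole lin])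
  fix j
  have "residue_vec (\<lambda>s. X \<odot> ((s - z) ^ j *\<^sub>C B s)) z = X \<odot> N j"
    unfolding N_def by (rule residue_vec_linear[OF pole_order_le_power[OF pole] lin])
  also have "\<dots> = X \<odot> N 0 \<odot> N j" by (simp add: comp_assoc N_mult)
  finally show "residue_vec (\<lambda>s. (s - z) ^ j *\<^sub>C (X \<odot> B s)) z = 0"
    using assms by (simp add: lin)
qed

lemma commute_N:
  assumes X: "clinear X" and "\<forall>\<^sub>F s in at z. X \<odot> B s = B s \<odot> X"
  shows "X \<odot> N 0 = N 0 \<odot> X"
proof -
  note lin = bounded_linear_comp_left[OF X] comp_left_scaleC[OF X]
  have "X \<odot> residue_vec B z = residue_vec (\<lambda>s. X \<odot> B s) z"
    by (rule residue_vec_linear[OF pole lin, symmetric])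
  also have "\<dots> = residue_vec (\<lambda>s. B s \<odot> X) z"
    by (rule residue_vec_cong[OF pole_order_le_linear[OF pole lin] assms(2)])
  also have "\<dots> = residue_vec B z \<odot> X"
    by (rule residue_vec_linear[OF pole])
      (auto intro: comp.bounded_linear_left simp: comp_scaleC_left)
  finally show ?thesis by (simp add: N_def)
qed

end

section \<open>Identity theorem for meromorphic functions\<close>

text \<open>The points near which \<open>P\<close> holds and those near which it fails form disjoint
  open sets, and the dichotomy makes them cover \<open>U\<close>. Punctured neighbourhoods tolerate
  isolated exceptions such as poles.\<close>

lemma eventually_at_connected:
  fixes P :: "complex \<Rightarrow> bool"
  assumes U: "open U" "connected U" and z0: "z0 \<in> U" "\<forall>\<^sub>F s in at z0. P s"
    and dich: "\<And>z. z \<in> U \<Longrightarrow> \<exists>\<^sub>F s in at z. P s \<Longrightarrow> \<forall>\<^sub>F s in at z. P s"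
    and z: "z \<in> U"
  shows "\<forall>\<^sub>F s in at z. P s"
proof -
  have op: "open {z. \<forall>\<^sub>F s in at z. R s}" for R :: "complex \<Rightarrow> bool"
  proof (subst open_subopen, intro ballI)
    fix z assume "z \<in> {z. \<forall>\<^sub>F s in at z. R s}"
    then obtain d where d: "d > 0" "\<And>s. s \<in> ball z d - {z} \<Longrightarrow> R s"
      unfolding eventually_at by (auto simp: dist_commute)
    have "\<forall>\<^sub>F s in at w. R s" if w: "w \<in> ball z d" for w
    proof (cases "w = z")
      case True
      then show ?thesis using eventually_at_punctured_ball[OF d(1), of z] d(2) by (auto elim: eventually_mono)
    next
      case False
      have "\<forall>\<^sub>F s in nhds w. s \<in> ball z d - {z}"
        using w False by (intro eventually_nhds_in_open) auto
      then have "\<forall>\<^sub>F s in nhds w. R s" by eventually_elim (rule d)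
      then show ?thesis by (simp add: eventually_at_filter eventually_mono)
    qed
    then show "\<exists>T. open T \<and> z \<in> T \<and> T \<subseteq> {z. \<forall>\<^sub>F s in at z. R s}"
      using d(1) by (intro exI[of _ "ball z d"]) auto
  qed
  let ?A = "{z. \<forall>\<^sub>F s in at z. P s}" and ?B = "{z. \<forall>\<^sub>F s in at z. \<not> P s}"
  have "U \<subseteq> ?A \<union> ?B" using dich by (auto simp: frequently_def)
  moreover have "?A \<inter> ?B \<inter> U = {}"
  proof -
    have False if "\<forall>\<^sub>F s in at w. P s" "\<forall>\<^sub>F s in at w. \<not> P s" for w
    proof -
      have "\<forall>\<^sub>F s in at w. False" using that by eventually_elim simp
      then show False by simp
    qed
    then show ?thesis by blast
  qed
  ultimately have "?A \<inter> U = {} \<or> ?B \<inter> U = {}"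
    using connectedD[OF U(2) op op, of P "\<lambda>s. \<not> P s"] by blast
  then show ?thesis using z z0 \<open>U \<subseteq> ?A \<union> ?B\<close> by blast
qed

text \<open>Off \<open>z\<close> the zeros of \<open>f\<close> are those of the holomorphic
  numerator \<open>h\<close>; if they accumulate at \<open>z\<close>, each matrix element of
  \<open>h\<close> vanishes identically.\<close>

lemma meromorphic_dichotomy:
  fixes f :: "complex \<Rightarrow> 'a::real_normed_vector \<Rightarrow>\<^sub>L 'b::complex_hilbert"
  assumes "pole_order_le n f z" "\<exists>\<^sub>F s in at z. f s = 0"
  shows "\<forall>\<^sub>F s in at z. f s = 0"
proof -
  obtain r h where r: "r > 0" and h: "\<And>w. w \<in> ball z r \<Longrightarrow> complex_differentiable h w"
    and f: "\<And>w. w \<in> ball z r - {z} \<Longrightarrow> f w = inverse ((w - z) ^ n) *\<^sub>C h w"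
    using assms unfolding pole_order_le_def by blast
  have fh: "f w = 0 \<longleftrightarrow> h w = 0" if "w \<in> ball z r - {z}" for w
    using f[OF that] that by simp
  let ?U = "{w \<in> ball z r. h w = 0}"
  have "\<exists>\<^sub>F w in at z. w \<in> ?U"
    using frequently_eventually_frequently[OF assms(2) eventually_at_punctured_ball[OF r]]
    by (rule frequently_elim1) (use fh in auto)
  then have lim: "z islimpt ?U" by (simp add: islimpt_iff_eventually frequently_def)
  have "h w = 0" if w: "w \<in> ball z r" for w
  proof (rule blinfun_cinner_eqI)
    fix x y
    have "cinner x (h w y) = 0"
      by (rule analytic_continuation[OF cfunctional_holomorphic_on[OF h cfunctional_cinner]
            open_ball connected_ball _ _ lim _ w]) (use r in auto)
    then show "cinner x (h w y) = cinner x (blinfun_apply 0 y)" by simp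
  qed
  then show ?thesis
    by (intro eventually_mono[OF eventually_at_punctured_ball[OF r]]) (use fh in auto)
qed

text \<open>The difference obeys the zero dichotomy at every point and the plane is connected. Since
  \<open>meromorphic_entire\<close> leaves the value at any single point free, agreement is claimed
  on punctured neighbourhoods.\<close>

lemma meromorphic_identity:
  fixes f g :: "complex \<Rightarrow> 'a::real_normed_vector \<Rightarrow>\<^sub>L 'b::complex_hilbert"
  assumes "meromorphic_entire f" "meromorphic_entire g" "\<exists>\<^sub>F s in at z0. f s = g s"
  shows "\<forall>\<^sub>F s in at z. f s = g s"
proof -
  have dich: "\<forall>\<^sub>F s in at z. f s - g s = 0" if "\<exists>\<^sub>F s in at z. f s - g s = 0" for z
  proof -
    obtain n m where "pole_order_le n f z" "pole_order_le m g z"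
      using assms(1,2) unfolding meromorphic_entire_def by blast
    from meromorphic_dichotomy[OF pole_order_le_diff[OF this] that] show ?thesis .
  qed
  have "\<forall>\<^sub>F s in at z. f s - g s = 0"
    using eventually_at_connected[OF open_UNIV connected_UNIV UNIV_I dich dich UNIV_I, of z0 z] assms(3)
    by simp
  then show ?thesis by simp
qed

section \<open>The analytic Fredholm theorem\<close>

lemma inverse_resolvent_identity:
  fixes K :: "'a::complex_normed_vector \<Rightarrow>\<^sub>L 'a"
  assumes "clinear K"
    and s: "invertible_blinfun (id_blinfun + s *\<^sub>C K)" and t: "invertible_blinfun (id_blinfun + t *\<^sub>C K)"
  shows "inv_blinfun (id_blinfun + s *\<^sub>C K) - inv_blinfun (id_blinfun + t *\<^sub>C K) =
    (t - s) *\<^sub>C (inv_blinfun (id_blinfun + s *\<^sub>C K) \<odot> K \<odot> inv_blinfun (id_blinfun + t *\<^sub>C K))"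
proof -
  define G where "G s = inv_blinfun (id_blinfun + s *\<^sub>C K)" for s
  have clG: "clinear (G s)"
    unfolding G_def by (intro clinear_inv clinear_intros assms)
  have "G s - G t = G s \<odot> ((id_blinfun + t *\<^sub>C K) \<odot> G t) - (G s \<odot> (id_blinfun + s *\<^sub>C K)) \<odot> G t"
    by (simp only: G_def inv_blinfun[OF s] inv_blinfun[OF t] comp_id)
  also have "\<dots> = G s \<odot> ((id_blinfun + t *\<^sub>C K) - (id_blinfun + s *\<^sub>C K)) \<odot> G t"
    by (simp only: comp.diff_left comp.diff_right comp_assoc)
  also have "(id_blinfun + t *\<^sub>C K) - (id_blinfun + s *\<^sub>C K) = (t - s) *\<^sub>C K"
    by (simp add: scaleC.diff_left)
  finally show ?thesis
    using comp_scaleC_right[OF clG, of "t - s" K] by (simp add: comp_scaleC_left G_def)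
qed

text \<open>The resolvent identity suggests the derivative
  \<open>D = - (G z \<odot> K \<odot> G z)\<close>; the remainder is \<open>s - z\<close> times
  \<open>(G z - G s) \<odot> (K \<odot> G z)\<close>, small by continuity of inversion.\<close>

lemma complex_differentiable_inverse:
  fixes K :: "'a::complex_hilbert \<Rightarrow>\<^sub>L 'a"
  assumes K: "clinear K" and inv: "\<forall>\<^sub>F s in nhds z. invertible_blinfun (id_blinfun + s *\<^sub>C K)"
  shows "complex_differentiable (\<lambda>s. inv_blinfun (id_blinfun + s *\<^sub>C K)) z"
proof -
  define G where "G s = inv_blinfun (id_blinfun + s *\<^sub>C K)" for s
  have invz: "invertible_blinfun (id_blinfun + z *\<^sub>C K)" using inv by (rule eventually_nhds_x_imp_x)
  have inv_at: "\<forall>\<^sub>F s in at z. invertible_blinfun (id_blinfun + s *\<^sub>C K)"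
    using inv by (simp add: eventually_at_filter eventually_mono)
  have "((\<lambda>s. id_blinfun + s *\<^sub>C K) \<longlongrightarrow> id_blinfun + z *\<^sub>C K) (at z)"
    by (intro tendsto_intros scaleC.tendsto)
  from tendsto_inv_blinfun[OF this invz, of G] inv_at
  have lim: "(G \<longlongrightarrow> G z) (at z)"
    by (simp add: G_def eventually_mono inv_blinfun)
  have diff: "G s - G z = (z - s) *\<^sub>C (G s \<odot> K \<odot> G z)"
    if "invertible_blinfun (id_blinfun + s *\<^sub>C K)" for s
    unfolding G_def by (rule inverse_resolvent_identity[OF K that invz])
  define D where "D = - (G z \<odot> K \<odot> G z)"
  have "(G has_derivative (\<lambda>h. h *\<^sub>C D)) (at z)"
    unfolding has_derivative_def
  proof (intro conjI scaleC.bounded_linear_left)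
    have "((\<lambda>s. norm ((G z - G s) \<odot> (K \<odot> G z))) \<longlongrightarrow> norm ((G z - G z) \<odot> (K \<odot> G z))) (at z)"
      by (intro tendsto_intros comp.tendsto lim)
    then have "((\<lambda>s. norm ((G z - G s) \<odot> (K \<odot> G z))) \<longlongrightarrow> 0) (at z)" by simp
    then have "((\<lambda>s. norm ((G s - G z - (s - z) *\<^sub>C D) /\<^sub>R norm (s - z))) \<longlongrightarrow> 0) (at z)"
    proof (rule Lim_transform_eventually)
      have "\<forall>\<^sub>F s in at z. s \<noteq> z" by (simp add: eventually_at_filter)
      then show "\<forall>\<^sub>F s in at z. norm ((G z - G s) \<odot> (K \<odot> G z)) =
          norm ((G s - G z - (s - z) *\<^sub>C D) /\<^sub>R norm (s - z))"
        using inv_at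
      proof eventually_elim
        case (elim s)
        have "G s - G z - (s - z) *\<^sub>C D = (s - z) *\<^sub>C ((G z - G s) \<odot> (K \<odot> G z))"
          unfolding diff[OF elim(2)] D_def
          by (simp add: comp.diff_left comp_assoc scaleC.diff_left scaleC.diff_right scaleC.minus_right)
        then show ?case using elim(1) by (simp add: norm_scaleC)
      qed
    qed
    then show "((\<lambda>y. (G y - G (Lim (at z) (\<lambda>x. x)) - (y - Lim (at z) (\<lambda>x. x)) *\<^sub>C D) /\<^sub>R
        norm (y - Lim (at z) (\<lambda>x. x))) \<longlongrightarrow> 0) (at z)"
      by (simp only: tendsto_norm_zero_iff Lim_ident_at trivial_limit_at not_False_eq_True)
  qed
  then show ?thesis unfolding G_def complex_differentiable_def by blast
qed

lemma pole_order_le_ident: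
  fixes f :: "complex \<Rightarrow> 'a::real_normed_vector \<Rightarrow>\<^sub>L 'b::complex_hilbert"
  assumes "pole_order_le n f z"
  shows "pole_order_le n (\<lambda>s. s *\<^sub>C f s) z"
proof -
  obtain C where "\<forall>\<^sub>F s in at z. complex_differentiable f s \<and> cmod (s - z) ^ n * norm (f s) \<le> C"
    using assms pole_order_le_iff by blast
  then have "\<forall>\<^sub>F s in at z. complex_differentiable (\<lambda>s. s *\<^sub>C f s) s \<and>
      cmod (s - z) ^ n * norm (s *\<^sub>C f s) \<le> (cmod z + 1) * C"
    using eventually_at_punctured_ball[OF zero_less_one, of z]
  proof eventually_elim
    case (elim s)
    have "cmod s \<le> cmod z + 1"
      using elim(2) norm_triangle_ineq2[of s z] by (simp add: dist_norm norm_minus_commute)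
    then have "cmod s * (cmod (s - z) ^ n * norm (f s)) \<le> (cmod z + 1) * C"
      using elim(1) by (intro mult_mono) auto
    then show ?case using elim(1)
      by (auto simp: norm_scaleC mult_ac intro!: complex_differentiable_scaleC derivative_intros)
  qed
  then show ?thesis unfolding pole_order_le_iff by blast
qed

text \<open>Only zeros of finite order occur: factor out \<open>(s - z) ^ k\<close> and take half
  the modulus of the cofactor at \<open>z\<close> as \<open>c\<close>. A zero of a scalar
  denominator thereby costs only a power of \<open>s - z\<close>.\<close>

lemma holomorphic_lower_bound:
  assumes e: "e holomorphic_on ball z r" and r: "r > 0" and nz: "\<not> (\<forall>\<^sub>F s in at z. e s = 0)"
  obtains k c where "c > 0" "\<forall>\<^sub>F s in at z. c * cmod (s - z) ^ k \<le> cmod (e s)"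
proof -
  have lower: "\<forall>\<^sub>F s in at z. cmod (g z) / 2 \<le> cmod (g s)"
    if "g holomorphic_on ball z d" "d > 0" "g z \<noteq> 0" for g d
  proof -
    have "isCont g z"
      using holomorphic_on_imp_continuous_on[OF that(1)] that by (simp add: continuous_on_eq_continuous_at)
    then have "((\<lambda>s. cmod (g s)) \<longlongrightarrow> cmod (g z)) (at z)" unfolding isCont_def by (rule tendsto_norm)
    from order_tendstoD(1)[OF this, of "cmod (g z) / 2"] that(3)
    show ?thesis by (simp add: eventually_mono order_less_imp_le)
  qed
  show ?thesis
  proof (cases "e z = 0")
    case False
    then show ?thesis using lower[OF e r] that[of "cmod (e z) / 2" 0] by simp
  next
    case True
    have nc: "\<not> e constant_on ball z r"
    proof
      assume "e constant_on ball z r"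
      then have "\<And>s. s \<in> ball z r \<Longrightarrow> e s = 0"
        using True r unfolding constant_on_def by (metis centre_in_ball)
      then have "\<forall>\<^sub>F s in at z. e s = 0"
        by (intro eventually_mono[OF eventually_at_punctured_ball[OF r]]) auto
      with nz show False ..
    qed
    obtain g d k where g: "d > 0" "g holomorphic_on ball z d"
      "\<And>w. w \<in> ball z d \<Longrightarrow> e w = (w - z) ^ k * g w" "\<And>w. w \<in> ball z d \<Longrightarrow> g w \<noteq> 0"
      by (rule holomorphic_factor_zero_nonconstant[OF e open_ball connected_ball _ True nc]) (use r in auto)
    have gz: "g z \<noteq> 0" using g(1,4) by simp
    have "\<forall>\<^sub>F s in at z. cmod (g z) / 2 * cmod (s - z) ^ k \<le> cmod (e s)"
      using lower[OF g(2,1) gz] eventually_at_punctured_ball[OF g(1), of z]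
    proof eventually_elim
      case (elim s)
      then show ?case by (simp add: g(3) norm_mult norm_power mult_right_mono mult.commute)
    qed
    from that[OF _ this] gz show ?thesis by simp
  qed
qed

lemma invertible_comp:
  fixes A B :: "'a::real_normed_vector \<Rightarrow>\<^sub>L 'a"
  assumes "invertible_blinfun A" "invertible_blinfun B"
  shows "invertible_blinfun (A \<odot> B)" "inv_blinfun (A \<odot> B) = inv_blinfun B \<odot> inv_blinfun A"
proof -
  have "(A \<odot> B) \<odot> (inv_blinfun B \<odot> inv_blinfun A) = A \<odot> (B \<odot> inv_blinfun B) \<odot> inv_blinfun A"
    "(inv_blinfun B \<odot> inv_blinfun A) \<odot> (A \<odot> B) = inv_blinfun B \<odot> (inv_blinfun A \<odot> A) \<odot> B"
    by (simp_all add: comp_assoc)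
  then have "(A \<odot> B) \<odot> (inv_blinfun B \<odot> inv_blinfun A) = id_blinfun"
    "(inv_blinfun B \<odot> inv_blinfun A) \<odot> (A \<odot> B) = id_blinfun"
    using assms by (simp_all add: inv_blinfun)
  then show "invertible_blinfun (A \<odot> B)" "inv_blinfun (A \<odot> B) = inv_blinfun B \<odot> inv_blinfun A"
    by (rule inv_blinfunI)+
qed

text \<open>Restricted to a disc about 0: the finite rank approximation depends on the radius, with
  error below \<open>1 / R\<close>, and the centre 0 is where scalar denominators are known to be
  nonzero.\<close>

definition meromorphic_inverse :: "real \<Rightarrow> ('a::complex_hilbert \<Rightarrow>\<^sub>L 'a) \<Rightarrow> bool" where
  "meromorphic_inverse R K \<longleftrightarrow> (\<forall>z\<in>ball 0 R.
     (\<exists>n. pole_order_le n (\<lambda>s. inv_blinfun (id_blinfun + s *\<^sub>C K)) z) \<and>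
     (\<forall>\<^sub>F s in at z. invertible_blinfun (id_blinfun + s *\<^sub>C K)))"

lemma meromorphic_inverse_small:
  assumes K: "clinear K" and small: "norm K * R < 1"
  shows "meromorphic_inverse R K"
  unfolding meromorphic_inverse_def
proof (intro ballI)
  fix z :: complex assume z: "z \<in> ball 0 R"
  have inv: "invertible_blinfun (id_blinfun + s *\<^sub>C K)" if "s \<in> ball 0 R" for s
  proof (rule invertible_id_plus)
    have "cmod s * norm K \<le> R * norm K" using that by (intro mult_right_mono) auto
    then show "norm (s *\<^sub>C K) < 1" using small by (simp add: norm_scaleC mult.commute)
  qed
  obtain d where d: "d > 0" "ball z d \<subseteq> ball 0 R"
    using z open_ball openE by blast
  have diff: "complex_differentiable (\<lambda>s. inv_blinfun (id_blinfun + s *\<^sub>C K)) w" if "w \<in> ball z d" for w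
  proof (rule complex_differentiable_inverse[OF K])
    have "\<forall>\<^sub>F s in nhds w. s \<in> ball 0 R" using that d by (intro eventually_nhds_in_open) auto
    then show "\<forall>\<^sub>F s in nhds w. invertible_blinfun (id_blinfun + s *\<^sub>C K)"
      by eventually_elim (rule inv)
  qed
  have "pole_order_le 0 (\<lambda>s. inv_blinfun (id_blinfun + s *\<^sub>C K)) z"
    unfolding pole_order_le_def
    by (intro exI[of _ d] conjI exI[of _ "\<lambda>s. inv_blinfun (id_blinfun + s *\<^sub>C K)"] d(1) ballI)
      (simp_all add: diff)
  moreover have "\<forall>\<^sub>F s in at z. invertible_blinfun (id_blinfun + s *\<^sub>C K)"
    using eventually_at_punctured_ball[OF d(1), of z] by eventually_elim (use d inv in auto)
  ultimately show "(\<exists>n. pole_order_le n (\<lambda>s. inv_blinfun (id_blinfun + s *\<^sub>C K)) z) \<and>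
     (\<forall>\<^sub>F s in at z. invertible_blinfun (id_blinfun + s *\<^sub>C K))" by blast
qed

text \<open>A perturbation of rank one is inverted by the Sherman-Morrison formula; its scalar denominator
  does not vanish identically because it equals 1 at the centre.\<close>

lemma meromorphic_inverse_rank_one:
  fixes K :: "'a::complex_hilbert \<Rightarrow>\<^sub>L 'a"
  assumes mi: "meromorphic_inverse R K" and R: "R > 0" and K: "clinear K" and \<phi>: "clinear \<phi>"
  shows "meromorphic_inverse R (K + rank_one a \<phi>)"
  unfolding meromorphic_inverse_def
proof (intro ballI)
  define G where "G s = inv_blinfun (id_blinfun + s *\<^sub>C K)" for s
  \<comment> \<open>The embedding of the scalars along \<open>a\<close>, so that the perturbation is
    \<open>A \<odot> \<phi>\<close>. Swapping the factors moves the inversion to \<open>h s\<close>,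
    an operator on the complex numbers, that is, multiplication by \<open>h s 1\<close>.\<close>
  define A :: "complex \<Rightarrow>\<^sub>L 'a" where "A = rank_one a id_blinfun"
  define h where "h s = id_blinfun + \<phi> \<odot> (s *\<^sub>C (G s \<odot> A))" for s
  have A: "rank_one a \<phi> = A \<odot> \<phi>" "clinear A"
    by (auto intro!: blinfun_eqI clinear_rank_one clinear_intros simp: A_def)
  have clG: "clinear (G s)" for s unfolding G_def by (intro clinear_inv clinear_intros K)
  have clh: "clinear (h s)" for s unfolding h_def by (intro clinear_intros clinear_comp \<phi> clG A)
  have h_apply: "h s c = c * h s 1" for s c
    using clh[of s] by (metis clinear_def scaleC_complex_def mult.right_neutral)
  have poleG: "\<exists>n. pole_order_le n G z" and invG: "\<forall>\<^sub>F s in at z. invertible_blinfun (id_blinfun + s *\<^sub>C K)"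
    if "z \<in> ball 0 R" for z
    using mi that unfolding meromorphic_inverse_def G_def by auto
  have poleh: "\<exists>n. pole_order_le n h z" if z: "z \<in> ball 0 R" for z
  proof -
    obtain n where n: "pole_order_le n G z" using poleG[OF z] by blast
    have "pole_order_le n (\<lambda>s. - (\<phi> \<odot> (s *\<^sub>C G s \<odot> A))) z"
    proof (rule pole_order_le_linear[OF pole_order_le_ident[OF n]])
      show "bounded_linear (\<lambda>X. - (\<phi> \<odot> (X \<odot> A)))"
        by (intro bounded_linear_minus bounded_linear_compose[OF comp.bounded_linear_right]
            comp.bounded_linear_left)
      show "- (\<phi> \<odot> (b *\<^sub>C X \<odot> A)) = b *\<^sub>C - (\<phi> \<odot> (X \<odot> A))" for b X
        by (simp add: comp_scaleC_left comp_scaleC_right[OF \<phi>] scaleC.minus_right)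
    qed
    from pole_order_le_diff[OF pole_order_le_const this, of 0 id_blinfun]
    moreover have "h = (\<lambda>s. id_blinfun - - (\<phi> \<odot> (s *\<^sub>C G s \<odot> A)))"
      by (simp add: fun_eq_iff h_def comp_scaleC_left)
    ultimately show ?thesis by auto
  qed
  \<comment> \<open>Vanishing near \<open>z\<close> would spread through the connected disc to 0 by
    the zero dichotomy.\<close>
  have h_nz: "\<not> (\<forall>\<^sub>F s in at z. h s = 0)" if z: "z \<in> ball 0 R" for z
  proof
    assume *: "\<forall>\<^sub>F s in at z. h s = 0"
    have dich: "\<forall>\<^sub>F s in at w. h s = 0" if "w \<in> ball 0 R" "\<exists>\<^sub>F s in at w. h s = 0" for w
      using poleh[OF that(1)] meromorphic_dichotomy[OF _ that(2)] by blast
    have 0: "\<forall>\<^sub>F s in at 0. h s = 0"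
      by (rule eventually_at_connected[OF open_ball connected_ball z * dich]) (use R in auto)
    have "invertible_blinfun (id_blinfun + 0 *\<^sub>C K)"
      by (rule inv_blinfunI(1)[of _ id_blinfun]) (simp_all add: scaleC.zero_left)
    with invG[of 0] R have "\<forall>\<^sub>F s in nhds 0. invertible_blinfun (id_blinfun + s *\<^sub>C K)"
      unfolding eventually_at_filter by (auto elim!: eventually_mono)
    from complex_differentiable_isCont[OF complex_differentiable_inverse[OF K this]]
    have "(G \<longlongrightarrow> G 0) (at 0)" by (simp only: isCont_def G_def [abs_def])
    then have "((\<lambda>s. id_blinfun + \<phi> \<odot> (s *\<^sub>C (G s \<odot> A))) \<longlongrightarrow> id_blinfun + \<phi> \<odot> (0 *\<^sub>C (G 0 \<odot> A))) (at 0)"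
      by (intro tendsto_intros comp.tendsto scaleC.tendsto)
    then have "(h \<longlongrightarrow> id_blinfun) (at 0)" by (simp add: h_def [abs_def] scaleC.zero_left comp.zero_right)
    moreover have "(h \<longlongrightarrow> 0) (at 0)"
      by (rule Lim_transform_eventually[of "\<lambda>_. 0"]) (use 0 in \<open>auto elim: eventually_mono\<close>)
    ultimately have "id_blinfun = (0 :: complex \<Rightarrow>\<^sub>L complex)"
      using tendsto_unique[of "at (0::complex)"] by auto
    then have "blinfun_apply id_blinfun (1::complex) = blinfun_apply 0 1" by simp
    then show False by simp
  qed
  fix z :: complex assume z: "z \<in> ball 0 R"
  obtain n C1 where C1: "\<forall>\<^sub>F s in at z. complex_differentiable G s \<and> cmod (s - z) ^ n * norm (G s) \<le> C1"
    using poleG[OF z] pole_order_le_iff by blast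
  have "\<exists>k C2. \<forall>\<^sub>F s in at z. invertible_blinfun (h s) \<and> cmod (s - z) ^ k * norm (inv_blinfun (h s)) \<le> C2"
  proof -
    obtain m where "pole_order_le m h z" using poleh[OF z] by blast
    then obtain r g where r: "r > 0" and g: "\<And>w. w \<in> ball z r \<Longrightarrow> complex_differentiable g w"
      and hg: "\<And>w. w \<in> ball z r - {z} \<Longrightarrow> h w = inverse ((w - z) ^ m) *\<^sub>C g w"
      unfolding pole_order_le_def by blast
    define e where "e s = g s 1" for s
    have "cfunctional (\<lambda>X :: complex \<Rightarrow>\<^sub>L complex. X 1)"
      unfolding cfunctional_def by (simp add: blinfun.bounded_linear_left scaleC_complex_def)
    then have e: "e holomorphic_on ball z r"
      unfolding e_def by (intro cfunctional_holomorphic_on g)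
    have he: "h w 1 = inverse ((w - z) ^ m) * e w" if "w \<in> ball z r - {z}" for w
      by (simp add: hg[OF that] e_def scaleC_complex_def)
    have "\<not> (\<forall>\<^sub>F s in at z. e s = 0)"
    proof
      assume "\<forall>\<^sub>F s in at z. e s = 0"
      then have "\<forall>\<^sub>F s in at z. h s = 0"
        using eventually_at_punctured_ball[OF r, of z]
      proof eventually_elim
        case (elim s)
        show ?case by (rule blinfun_eqI, subst h_apply) (simp add: he[OF elim(2)] elim(1))
      qed
      with h_nz[OF z] show False ..
    qed
    from holomorphic_lower_bound[OF e r this] obtain k c
      where c: "c > 0" and low: "\<forall>\<^sub>F s in at z. c * cmod (s - z) ^ k \<le> cmod (e s)" by blast
    have "\<forall>\<^sub>F s in at z. invertible_blinfun (h s) \<and> cmod (s - z) ^ k * norm (inv_blinfun (h s)) \<le> 1 / c"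
      using low eventually_at_punctured_ball[OF r, of z] eventually_at_punctured_ball[OF zero_less_one, of z]
    proof eventually_elim
      case (elim s)
      define t where "t = cmod (s - z)"
      have t: "0 < t" "t < 1" using elim by (auto simp: t_def dist_norm norm_minus_commute)
      have "c * t ^ k > 0" using c t by simp
      then have e0: "e s \<noteq> 0" using elim(1) by (auto simp: t_def)
      then have d0: "h s 1 \<noteq> 0" using he[OF elim(2)] elim(2) by simp
      have h1: "h s \<odot> ((1 / h s 1) *\<^sub>C id_blinfun) = id_blinfun"
      proof (rule blinfun_eqI)
        fix c
        have "h s ((1 / h s 1) * c) = (1 / h s 1) * c * h s 1" by (rule h_apply)
        then show "(h s \<odot> ((1 / h s 1) *\<^sub>C id_blinfun)) c = id_blinfun c"
          using d0 by (simp add: scaleC_complex_def)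
      qed
      have h2: "((1 / h s 1) *\<^sub>C id_blinfun) \<odot> h s = id_blinfun"
      proof (rule blinfun_eqI)
        fix c
        show "(((1 / h s 1) *\<^sub>C id_blinfun) \<odot> h s) c = id_blinfun c"
          using h_apply[of s c] d0 by (simp add: scaleC_complex_def)
      qed
      note h = inv_blinfunI[OF h1 h2]
      \<comment> \<open>A pole of \<open>h\<close> only helps: it contributes \<open>t ^ m\<close>,
        which is at most 1.\<close>
      have "norm (inv_blinfun (h s)) \<le> 1 / cmod (h s 1)"
        unfolding h(2) using norm_blinfun_id_le[where 'a = complex]
        by (simp add: norm_scaleC norm_divide divide_right_mono)
      also have "\<dots> = t ^ m / cmod (e s)"
        using he[OF elim(2)] by (simp add: norm_mult norm_inverse norm_power norm_divide t_def field_simps)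
      also have "\<dots> \<le> 1 / (c * t ^ k)"
        using elim(1) \<open>c * t ^ k > 0\<close> t by (intro frac_le power_le_one) (auto simp: t_def)
      finally have "norm (inv_blinfun (h s)) \<le> 1 / (c * t ^ k)" .
      then have "t ^ k * norm (inv_blinfun (h s)) \<le> t ^ k * (1 / (c * t ^ k))"
        using t by (intro mult_left_mono) auto
      also have "\<dots> = 1 / c" using t c by simp
      finally show ?case using h(1) by (simp add: t_def)
    qed
    then show ?thesis by blast
  qed
  then obtain k C2 where
    C2: "\<forall>\<^sub>F s in at z. invertible_blinfun (h s) \<and> cmod (s - z) ^ k * norm (inv_blinfun (h s)) \<le> C2"
    by blast
  define K' where "K' = K + rank_one a \<phi>"
  have K': "clinear K'" unfolding K'_def by (intro clinear_intros clinear_rank_one K \<phi>)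
  have near: "\<forall>\<^sub>F s in at z. s \<in> ball z (R - cmod z) - {z}"
    by (rule eventually_at_punctured_ball) (use z in auto)
  \<comment> \<open>The swapped formula contains at most two factors \<open>G s\<close>, each
    costing \<open>n\<close> powers, and one inverse of \<open>h s\<close>, costing
    \<open>k\<close>. The term with a single \<open>G s\<close> has powers to spare, bounded by 1 as
    \<open>t < 1\<close>.\<close>
  have key: "\<forall>\<^sub>F s in at z. invertible_blinfun (id_blinfun + s *\<^sub>C K') \<and>
      cmod (s - z) ^ (n + n + k) * norm (inv_blinfun (id_blinfun + s *\<^sub>C K')) \<le>
      (1 + R * norm A * norm \<phi> * C1 * C2) * C1"
    using C1 C2 invG[OF z] eventually_at_punctured_ball[OF zero_less_one, of z]
      near
  proof eventually_elim
    case (elim s)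
    define t where "t = cmod (s - z)"
    have t: "0 < t" "t < 1" using elim by (auto simp: t_def dist_norm norm_minus_commute)
    have sR: "cmod s \<le> R" using elim(5) z norm_triangle_ineq2[of s z]
      by (simp add: dist_norm norm_minus_commute)
    define Y where "Y = s *\<^sub>C (G s \<odot> A)"
    have hY: "id_blinfun + \<phi> \<odot> Y = h s" by (simp add: h_def Y_def)
    have inv_h: "invertible_blinfun (id_blinfun + \<phi> \<odot> Y)" using elim(2) by (simp add: hY)
    note swap = invertible_swap[OF inv_h, unfolded hY]
    have clM: "clinear (id_blinfun + s *\<^sub>C K)" by (intro clinear_intros K)
    have "(id_blinfun + s *\<^sub>C K) \<odot> (Y \<odot> \<phi>) = s *\<^sub>C (((id_blinfun + s *\<^sub>C K) \<odot> G s) \<odot> A \<odot> \<phi>)"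
      unfolding Y_def by (simp add: comp_scaleC_left comp_scaleC_right[OF clM] comp_assoc)
    also have "\<dots> = s *\<^sub>C (A \<odot> \<phi>)"
      using inv_blinfun(1)[OF elim(3)] by (simp add: G_def)
    finally have "id_blinfun + s *\<^sub>C K' = (id_blinfun + s *\<^sub>C K) \<odot> (id_blinfun + Y \<odot> \<phi>)"
      by (simp add: comp.add_right K'_def A(1) scaleC.add_right add.assoc)
    then have inv': "invertible_blinfun (id_blinfun + s *\<^sub>C K')"
      "inv_blinfun (id_blinfun + s *\<^sub>C K') = (id_blinfun - Y \<odot> inv_blinfun (h s) \<odot> \<phi>) \<odot> G s"
      using invertible_comp[OF elim(3) swap(1)] by (simp_all add: swap(2) G_def)
    define N where "N = norm (G s)"
    define M where "M = norm (inv_blinfun (h s))"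
    have N: "0 \<le> N" "t ^ n * N \<le> C1" using elim(1) by (auto simp: N_def t_def)
    have M: "0 \<le> M" "t ^ k * M \<le> C2" using elim(2) by (auto simp: M_def t_def)
    have C1: "C1 \<ge> 0" using N t by (meson mult_nonneg_nonneg order_trans zero_le_power less_imp_le)
    have C2: "C2 \<ge> 0" using M t by (meson mult_nonneg_nonneg order_trans zero_le_power less_imp_le)
    have "norm Y \<le> R * (N * norm A)"
      unfolding Y_def norm_scaleC N_def using sR R by (intro mult_mono norm_blinfun_compose) auto
    then have "norm (Y \<odot> inv_blinfun (h s) \<odot> \<phi>) \<le> R * (N * norm A) * M * norm \<phi>"
      unfolding M_def by (intro norm_comp_le_mult) auto
    then have "norm (id_blinfun - Y \<odot> inv_blinfun (h s) \<odot> \<phi>) \<le> 1 + R * (N * norm A) * M * norm \<phi>"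
      using norm_triangle_ineq4[of "id_blinfun" "Y \<odot> inv_blinfun (h s) \<odot> \<phi>"]
        norm_blinfun_id_le[where 'a = 'a] by linarith
    then have "norm (inv_blinfun (id_blinfun + s *\<^sub>C K')) \<le> (1 + R * (N * norm A) * M * norm \<phi>) * N"
      unfolding inv' N_def by (intro norm_comp_le_mult) auto
    then have "t ^ (n + n + k) * norm (inv_blinfun (id_blinfun + s *\<^sub>C K')) \<le>
        t ^ (n + n + k) * ((1 + R * (N * norm A) * M * norm \<phi>) * N)"
      using t by (intro mult_left_mono) auto
    also have "\<dots> = (t ^ (n + k) + R * norm A * norm \<phi> * (t ^ n * N) * (t ^ k * M)) * (t ^ n * N)"
      by (simp add: power_add algebra_simps)
    also have "\<dots> \<le> (1 + R * norm A * norm \<phi> * C1 * C2) * C1"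
      using t N M C1 C2 R by (intro mult_mono add_mono power_le_one mult_nonneg_nonneg) auto
    finally show ?case using inv'(1) by (simp add: t_def)
  qed
  have "\<forall>\<^sub>F s in at z. complex_differentiable (\<lambda>s. inv_blinfun (id_blinfun + s *\<^sub>C K')) s"
    using eventually_at_eventually_nhds[OF key]
  proof eventually_elim
    case (elim s)
    then show ?case by (intro complex_differentiable_inverse K') (auto elim: eventually_mono)
  qed
  then have "pole_order_le (n + n + k) (\<lambda>s. inv_blinfun (id_blinfun + s *\<^sub>C K')) z"
    unfolding pole_order_le_iff using key
    by (intro exI[of _ "(1 + R * norm A * norm \<phi> * C1 * C2) * C1"]) (auto elim: eventually_elim2)
  moreover have "\<forall>\<^sub>F s in at z. invertible_blinfun (id_blinfun + s *\<^sub>C K')"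
    using key by eventually_elim simp
  ultimately show "(\<exists>n. pole_order_le n (\<lambda>s. inv_blinfun (id_blinfun + s *\<^sub>C (K + rank_one a \<phi>))) z) \<and>
     (\<forall>\<^sub>F s in at z. invertible_blinfun (id_blinfun + s *\<^sub>C (K + rank_one a \<phi>)))"
    unfolding K'_def by blast
qed

text \<open>The radius \<open>cmod z + 1\<close> puts the given \<open>z\<close> inside the disc;
  \<open>K - G\<close> is then small enough for the Neumann series on all of it, and the finite rank
  part \<open>G\<close> is restored by rule induction.\<close>

theorem analytic_fredholm:
  fixes K :: "'a::complex_hilbert \<Rightarrow>\<^sub>L 'a"
  assumes "finite_rank_limit K"
  shows "meromorphic_entire (\<lambda>s. inv_blinfun (id_blinfun + s *\<^sub>C K))"
    and "\<forall>\<^sub>F s in at z. invertible_blinfun (id_blinfun + s *\<^sub>C K)"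
proof -
  have mi: "meromorphic_inverse (cmod z + 1) K" for z
  proof -
    define R where "R = cmod z + 1"
    have R: "R > 0" by (simp add: R_def add_nonneg_pos)
    obtain G where G: "finite_rank G" "norm (K - G) < 1 / R"
      using assms R unfolding finite_rank_limit_def by (metis zero_less_divide_1_iff)
    have K: "clinear K" using assms by (simp add: finite_rank_limit_def)
    have clKG: "clinear (K - G)" by (intro clinear_intros K clinear_finite_rank G)
    have small: "meromorphic_inverse R (K - G)"
      using G(2) R by (intro meromorphic_inverse_small clKG) (simp add: field_simps)
    have "meromorphic_inverse R ((K - G) + F)" if "finite_rank F" for F
      using that
    proof (induction F rule: finite_rank.induct)
      case (finite_rank_add F f a)
      then have "meromorphic_inverse R (K - G + F + rank_one a f)"
        using clinear_finite_rank by (intro meromorphic_inverse_rank_one R clinear_intros(3)[OF clKG]) auto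
      then show ?case by (simp add: add.assoc)
    qed (simp add: small)
    from this[OF G(1)] show ?thesis by (simp add: R_def)
  qed
  show "meromorphic_entire (\<lambda>s. inv_blinfun (id_blinfun + s *\<^sub>C K))"
    unfolding meromorphic_entire_def
  proof
    fix z
    show "\<exists>n. pole_order_le n (\<lambda>s. inv_blinfun (id_blinfun + s *\<^sub>C K)) z"
      using mi[of z] unfolding meromorphic_inverse_def by auto
  qed
  show "\<forall>\<^sub>F s in at z. invertible_blinfun (id_blinfun + s *\<^sub>C K)"
    using mi[of z] unfolding meromorphic_inverse_def by auto
qed

section \<open>Square roots of nonnegative operators\<close>

text \<open>Polarisation: the form at \<open>x + y\<close> and at
  \<open>x + \<i> *\<^sub>C y\<close> isolates the sum and the difference of the mixed
  terms.\<close>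

lemma sesquilinear_zero:
  fixes X :: "'a::complex_hilbert \<Rightarrow>\<^sub>L 'a"
  assumes X: "clinear X" and zero: "\<And>x. cinner x (X x) = 0"
  shows "X = 0"
proof (rule blinfun_cinner_eqI)
  fix x y
  have "cinner x (X y) + cinner y (X x) = 0"
    using zero[of "x + y"] zero[of x] zero[of y]
    by (simp add: blinfun.add_right cinner_add_left cinner_add_right add.commute)
  moreover have "\<i> * cinner x (X y) - \<i> * cinner y (X x) = 0"
    using zero[of "x + \<i> *\<^sub>C y"] zero[of x] zero[of y] X
    by (simp add: blinfun.add_right cinner_add_left cinner_add_right clinear_def
        cinner_scaleC_left cinner_scaleC_right)
  then have "cinner x (X y) - cinner y (X x) = 0"
    by (metis complex_i_not_zero mult_eq_0_iff right_diff_distrib)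
  ultimately have "cinner x (X y) = 0" by (simp add: add_eq_0_iff2)
  then show "cinner x (X y) = cinner x (blinfun_apply 0 y)" by simp
qed

text \<open>Polarisation again: reality of the form at \<open>x + y\<close> gives the imaginary
  parts, and at \<open>x + \<i> *\<^sub>C y\<close> the real parts.\<close>

lemma nonneg_selfadjoint:
  assumes "nonneg_blinfun A"
  shows "cinner (A x) y = cinner x (A y)"
proof -
  have cl: "clinear A" and real: "Im (cinner z (A z)) = 0" for z
    using assms by (auto simp: nonneg_blinfun_def complex_is_Real_iff)
  have "Im (cinner x (A y)) + Im (cinner y (A x)) = 0"
    using real[of "x + y"] real[of x] real[of y]
    by (simp add: blinfun.add_right cinner_add_left cinner_add_right)
  moreover have "Re (cinner x (A y)) - Re (cinner y (A x)) = 0"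
    using real[of "x + \<i> *\<^sub>C y"] real[of x] real[of y] cl
    by (simp add: blinfun.add_right cinner_add_left cinner_add_right clinear_def
        cinner_scaleC_left cinner_scaleC_right)
  ultimately show ?thesis
    unfolding cinner_commute[of "A x" y] by (simp add: complex_eq_iff)
qed

lemma nonneg_scaleR:
  assumes "nonneg_blinfun A" "r \<ge> 0"
  shows "nonneg_blinfun (r *\<^sub>R A)"
proof -
  have "clinear (r *\<^sub>R A)"
    unfolding scaleR_scaleC[of r A] using assms(1) by (intro clinear_intros) (simp add: nonneg_blinfun_def)
  then show ?thesis
    using assms by (auto simp: nonneg_blinfun_def blinfun.scaleR_left cinner_scaleR_right complex_is_Real_iff)
qed

text \<open>Let \<open>x\<close> be the multiple of \<open>X y\<close> with the norm of
  \<open>y\<close>. Four times the real part of \<open>cinner x (X y)\<close> is the form at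
  \<open>x + y\<close> minus the form at \<open>x - y\<close>, hence at most four times the squared
  norm of \<open>y\<close>.\<close>

lemma norm_le_1_if_form_le_1:
  assumes X: "nonneg_blinfun X" and le: "\<And>x. Re (cinner x (X x)) \<le> (norm x)\<^sup>2"
  shows "norm X \<le> 1"
proof (rule norm_blinfun_bound)
  fix y
  show "norm (X y) \<le> 1 * norm y"
  proof (cases "X y = 0")
    case False
    define x where "x = (norm y / norm (X y)) *\<^sub>R X y"
    have nx: "norm x = norm y" using False by (simp add: x_def)
    have "Re (cinner (x - y) (X (x - y))) \<ge> 0" using X by (simp add: nonneg_blinfun_def)
    moreover have "Re (cinner (x + y) (X (x + y))) \<le> (norm (x + y))\<^sup>2" by (rule le)
    moreover have "(norm (x + y))\<^sup>2 \<le> (norm y + norm y)\<^sup>2"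
      using norm_triangle_ineq[of x y] nx by (intro power_mono) auto
    moreover have "Re (cinner y (X x)) = Re (cinner x (X y))"
      using nonneg_selfadjoint[OF X, of y x] arg_cong[OF cinner_commute[of "X y" x], of Re] by simp
    ultimately have "4 * Re (cinner x (X y)) \<le> 4 * (norm y)\<^sup>2"
      by (simp add: blinfun.bilinear_simps cinner_add_left cinner_add_right cinner_diff_left
          cinner_diff_right power2_eq_square)
    moreover have "Re (cinner x (X y)) = norm y * norm (X y)"
      using False by (simp add: x_def cinner_scaleR_left cinner_self power2_eq_square)
    ultimately have "norm y * norm (X y) \<le> norm y * norm y" by (simp add: power2_eq_square)
    moreover have "y \<noteq> 0" using False by (auto simp: blinfun.zero_right)
    ultimately show ?thesis by simp
  qed simp
qed simp

text \<open>The iteration \<open>Y \<mapsto> (X + Y\<^sup>2)/2\<close> is dominated by its scalar version at \<open>X = 1\<close>, and its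
  fixed point \<open>Y\<close> satisfies \<open>(1 - Y)\<^sup>2 = 1 - X\<close>.\<close>

lemma sqrt_exists_contraction:
  fixes A :: "'a::complex_hilbert \<Rightarrow>\<^sub>L 'a"
  assumes A: "nonneg_blinfun A" and le: "\<And>x. Re (cinner x (A x)) \<le> (norm x)\<^sup>2"
  obtains B where "nonneg_blinfun B" "B \<odot> B = A" "\<And>C. C \<odot> A = A \<odot> C \<Longrightarrow> C \<odot> B = B \<odot> C"
proof -
  define X where "X = id_blinfun - A"
  have clA: "clinear A" using A by (simp add: nonneg_blinfun_def)
  have clX: "clinear X" unfolding X_def by (intro clinear_intros clA)
  have "Re (cinner x (X x)) = (norm x)\<^sup>2 - Re (cinner x (A x))" "Im (cinner x (X x)) = 0" for x
    using A by (simp_all add: X_def blinfun.diff_left cinner_diff_right cinner_self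
        nonneg_blinfun_def complex_is_Real_iff)
  then have nnX: "nonneg_blinfun X" and leX: "Re (cinner x (X x)) \<le> (norm x)\<^sup>2" for x
    using clX le A by (auto simp: nonneg_blinfun_def complex_is_Real_iff)
  have nX: "norm X \<le> 1" by (rule norm_le_1_if_form_le_1[OF nnX leX])
  define Y where "Y = rec_nat 0 (\<lambda>_ Y. (1/2) *\<^sub>R (X + Y \<odot> Y))"
  define y :: "nat \<Rightarrow> real" where "y = rec_nat 0 (\<lambda>_ y. (1/2) * (1 + y * y))"
  have Y0: "Y 0 = 0" and Y_Suc: "Y (Suc n) = (1/2) *\<^sub>R (X + Y n \<odot> Y n)" for n
    by (simp_all add: Y_def)
  have y0: "y 0 = 0" and y_Suc: "y (Suc n) = (1/2) * (1 + y n * y n)" for n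
    by (simp_all add: y_def)
  have y01: "0 \<le> y n \<and> y n \<le> 1" for n
  proof (induction n)
    case (Suc n)
    then have "y n * y n \<le> 1" by (simp add: mult_le_one)
    then show ?case using Suc by (simp add: y_Suc)
  qed (simp add: y0)
  have nY: "norm (Y n) \<le> y n" for n
  proof (induction n)
    case (Suc n)
    have "norm (X + Y n \<odot> Y n) \<le> 1 + y n * y n"
      by (intro order_trans[OF norm_triangle_ineq] add_mono nX norm_comp_le_mult Suc)
    then show ?case by (simp add: Y_Suc y_Suc)
  qed (simp add: Y0 y0)
  have step: "norm (Y (Suc n) - Y n) \<le> y (Suc n) - y n" for n
  proof (induction n)
    case 0
    show ?case using nY[of 1] by (simp add: Y0 y0)
  next
    case (Suc n)
    define D where "D = Y (Suc n) - Y n"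
    have "Y (Suc (Suc n)) - Y (Suc n) = (1/2) *\<^sub>R (Y (Suc n) \<odot> Y (Suc n) - Y n \<odot> Y n)"
      by (simp only: Y_Suc[of "Suc n"] Y_Suc[of n] flip: scaleR_diff_right) simp
    also have "Y (Suc n) \<odot> Y (Suc n) - Y n \<odot> Y n = Y (Suc n) \<odot> D + D \<odot> Y n"
      by (simp add: D_def comp.diff_left comp.diff_right)
    also have "norm ((1/2) *\<^sub>R (Y (Suc n) \<odot> D + D \<odot> Y n)) \<le>
        (1/2) * (y (Suc n) * (y (Suc n) - y n) + (y (Suc n) - y n) * y n)"
      using Suc unfolding D_def[symmetric]
      by (simp add: order_trans[OF norm_triangle_ineq] add_mono norm_comp_le_mult nY)
    also have "\<dots> = y (Suc (Suc n)) - y (Suc n)"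
      by (simp only: y_Suc[of "Suc n"] y_Suc[of n]) (simp add: algebra_simps)
    finally show ?case .
  qed
  have y_mono: "incseq y"
    by (rule incseq_SucI) (use order_trans[OF norm_ge_zero step] in simp)
  have diff: "norm (Y m - Y n) \<le> y m - y n" if "n \<le> m" for m n
    using that
  proof (induction m rule: dec_induct)
    case (step m)
    then show ?case
      using norm_triangle_ineq[of "Y (Suc m) - Y m" "Y m - Y n"] \<open>\<And>n. norm (Y (Suc n) - Y n) \<le> y (Suc n) - y n\<close>[of m]
      by simp
  qed simp
  \<comment> \<open>Convergence alone matters here, not the limit: differences of \<open>Y\<close>
    are dominated by differences of \<open>y\<close>.\<close>
  have "convergent y"
    by (rule Bseq_mono_convergent[of y])
      (use y01 y_mono in \<open>auto intro!: BseqI'[of _ 1] simp: incseq_def\<close>)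
  then have Cy: "Cauchy y" by (rule convergent_Cauchy)
  have "Cauchy Y"
  proof (rule metric_CauchyI)
    fix e :: real assume "e > 0"
    then obtain M where M: "\<And>m n. m \<ge> M \<Longrightarrow> n \<ge> M \<Longrightarrow> dist (y m) (y n) < e"
      using metric_CauchyD[OF Cy] by blast
    have "dist (Y m) (Y n) < e" if "m \<ge> M" "n \<ge> M" for m n
    proof (cases "n \<le> m")
      case True
      then show ?thesis using diff[of n m] M[OF that] by (simp add: dist_norm)
    next
      case False
      then show ?thesis using diff[of m n] M[OF that]
        by (simp add: dist_norm norm_minus_commute[of "Y m"])
    qed
    then show "\<exists>M. \<forall>m\<ge>M. \<forall>n\<ge>M. dist (Y m) (Y n) < e" by blast
  qed
  then obtain L where L: "Y \<longlonglongrightarrow> L" using Cauchy_convergent[of Y] by (auto simp: convergent_def)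
  have "(\<lambda>n. Y (Suc n)) \<longlonglongrightarrow> (1/2) *\<^sub>R (X + L \<odot> L)"
    unfolding Y_Suc by (intro tendsto_intros comp.tendsto L)
  then have "L = (1/2) *\<^sub>R (X + L \<odot> L)"
    using LIMSEQ_Suc[OF L] LIMSEQ_unique by blast
  then have "2 *\<^sub>R L = 2 *\<^sub>R (1/2) *\<^sub>R (X + L \<odot> L)" by (rule arg_cong)
  then have L_eq: "L \<odot> L = L + L - X" by (simp add: scaleR_2)
  have clY: "clinear (Y n)" for n
    by (induction n) (auto simp: Y0 Y_Suc scaleR_scaleC intro!: clinear_intros clinear_comp clX)
  then have clL: "clinear L" using clinear_tendsto[OF L] by simp
  have saY: "cinner (Y n u) v = cinner u (Y n v)" for n u v
  proof (induction n arbitrary: u v)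
    case (Suc n)
    then show ?case
      using nonneg_selfadjoint[OF nnX]
      by (simp add: Y_Suc blinfun.bilinear_simps cinner_scaleR_left cinner_scaleR_right
          cinner_add_left cinner_add_right)
  qed (simp add: Y0)
  have saL: "cinner (L u) v = cinner u (L v)" for u v
  proof (rule LIMSEQ_unique)
    show "(\<lambda>n. cinner (Y n u) v) \<longlonglongrightarrow> cinner (L u) v"
      by (intro cinner.tendsto tendsto_intros L)
    show "(\<lambda>n. cinner (Y n u) v) \<longlonglongrightarrow> cinner u (L v)"
      unfolding saY by (intro cinner.tendsto tendsto_intros L)
  qed
  have nL: "norm L \<le> 1"
    by (rule tendsto_upperbound[OF tendsto_norm[OF L] always_eventually])
      (use order_trans[OF nY] y01 in auto)
  define B where "B = id_blinfun - L"
  have "nonneg_blinfun B"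
    unfolding nonneg_blinfun_def
  proof (intro conjI allI)
    show "clinear B" unfolding B_def by (intro clinear_intros clL)
    fix x
    have "cnj (cinner x (L x)) = cinner x (L x)" using cinner_commute[of "L x" x] saL[of x x] by simp
    then have "cinner x (L x) \<in> \<real>" by (simp add: Reals_cnj_iff)
    then show "cinner x (B x) \<in> \<real>"
      by (simp add: B_def blinfun.diff_left cinner_diff_right cinner_self Reals_diff)
    have "Re (cinner x (L x)) \<le> norm x * norm (L x)"
      using complex_Re_le_cmod cinner_cauchy_schwarz order_trans by blast
    also have "\<dots> \<le> norm x * (1 * norm x)"
      by (intro mult_left_mono order_trans[OF norm_blinfun] mult_right_mono nL) auto
    finally show "0 \<le> Re (cinner x (B x))"
      by (simp add: B_def blinfun.diff_left cinner_diff_right cinner_self power2_eq_square)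
  qed
  moreover have "B \<odot> B = A"
    by (simp add: B_def comp.diff_left comp.diff_right L_eq X_def)
  \<comment> \<open>Each \<open>Y n\<close> is a polynomial in \<open>X\<close>, so commutation with
    \<open>A\<close> passes to \<open>Y n\<close> and then to the limit.\<close>
  moreover have "C \<odot> B = B \<odot> C" if C: "C \<odot> A = A \<odot> C" for C
  proof -
    have CX: "C \<odot> X = X \<odot> C" using C by (simp add: X_def comp.diff_left comp.diff_right)
    have CY: "C \<odot> Y n = Y n \<odot> C" for n
    proof (induction n)
      case (Suc n)
      have "C \<odot> (Y n \<odot> Y n) = Y n \<odot> Y n \<odot> C"
        using Suc by (metis comp_assoc)
      then show ?case using CX
        by (simp add: Y_Suc comp.scaleR_left comp.scaleR_right comp.add_left comp.add_right)
    qed (simp add: Y0)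
    have "C \<odot> L = L \<odot> C"
    proof (rule LIMSEQ_unique)
      show "(\<lambda>n. C \<odot> Y n) \<longlonglongrightarrow> C \<odot> L" by (intro comp.tendsto tendsto_intros L)
      show "(\<lambda>n. C \<odot> Y n) \<longlonglongrightarrow> L \<odot> C" unfolding CY by (intro comp.tendsto tendsto_intros L)
    qed
    then show ?thesis by (simp add: B_def comp.diff_left comp.diff_right)
  qed
  ultimately show ?thesis using that by blast
qed

text \<open>Dividing by the norm brings the form below the squared norm. The commutation clause is
  kept because uniqueness of the root rests on it.\<close>

lemma sqrt_exists:
  fixes A :: "'a::complex_hilbert \<Rightarrow>\<^sub>L 'a"
  assumes A: "nonneg_blinfun A"
  obtains B where "nonneg_blinfun B" "B \<odot> B = A" "\<And>C. C \<odot> A = A \<odot> C \<Longrightarrow> C \<odot> B = B \<odot> C"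
proof (cases "A = 0")
  case True
  then show ?thesis using that[of 0] by (simp add: nonneg_blinfun_def clinear_intros)
next
  case False
  define c where "c = norm A"
  have c: "c > 0" using False by (simp add: c_def)
  define A' where "A' = (1 / c) *\<^sub>R A"
  have A': "nonneg_blinfun A'"
    unfolding A'_def using A c by (intro nonneg_scaleR) auto
  have "Re (cinner x (A' x)) \<le> (norm x)\<^sup>2" for x
  proof -
    have "Re (cinner x (A x)) \<le> norm x * norm (A x)"
      using complex_Re_le_cmod cinner_cauchy_schwarz order_trans by blast
    also have "\<dots> \<le> norm x * (c * norm x)"
      unfolding c_def by (intro mult_left_mono norm_blinfun) auto
    finally show ?thesis
      using c by (simp add: A'_def blinfun.scaleR_left cinner_scaleR_right power2_eq_square field_simps)
  qed
  from sqrt_exists_contraction[OF A' this] obtain B where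
    B: "nonneg_blinfun B" "B \<odot> B = A'" "\<And>C. C \<odot> A' = A' \<odot> C \<Longrightarrow> C \<odot> B = B \<odot> C" by blast
  show ?thesis
  proof (rule that[of "sqrt c *\<^sub>R B"])
    show "nonneg_blinfun (sqrt c *\<^sub>R B)" using B(1) c by (intro nonneg_scaleR) auto
    show "sqrt c *\<^sub>R B \<odot> sqrt c *\<^sub>R B = A"
      using c B(2) by (simp add: comp.scaleR_left comp.scaleR_right A'_def)
    fix C assume "C \<odot> A = A \<odot> C"
    then have "C \<odot> A' = A' \<odot> C" by (simp add: A'_def comp.scaleR_left comp.scaleR_right)
    from B(3)[OF this] show "C \<odot> sqrt c *\<^sub>R B = sqrt c *\<^sub>R B \<odot> C"
      by (simp add: comp.scaleR_left comp.scaleR_right)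
  qed
qed

text \<open>Uniqueness behind the \<open>THE\<close>: another root \<open>B\<close> commutes with
  \<open>A = B \<odot> B\<close>, hence with \<open>S\<close>, so
  \<open>(B + S) \<odot> D = 0\<close> for \<open>D = B - S\<close>. The forms of \<open>B\<close>
  and \<open>S\<close> are nonnegative and add up to zero on the range of \<open>D\<close>; this
  makes the cube of \<open>D\<close> zero, and symmetry strips the powers.\<close>

lemma sqrt_blinfun:
  fixes A :: "'a::complex_hilbert \<Rightarrow>\<^sub>L 'a"
  assumes A: "nonneg_blinfun A"
  shows "nonneg_blinfun (sqrt_blinfun A)" "sqrt_blinfun A \<odot> sqrt_blinfun A = A"
proof -
  obtain S where S: "nonneg_blinfun S" "S \<odot> S = A" "\<And>C. C \<odot> A = A \<odot> C \<Longrightarrow> C \<odot> S = S \<odot> C"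
    using sqrt_exists[OF A] by blast
  have uniq: "B = S" if B: "nonneg_blinfun B" "B \<odot> B = A" for B
  proof -
    have comm: "B \<odot> S = S \<odot> B" using B(2) by (intro S(3)) (simp add: comp_assoc flip: B(2))
    define D where "D = B - S"
    have clD: "clinear D" using B(1) S(1) unfolding D_def nonneg_blinfun_def by (intro clinear_intros) auto
    have saD: "cinner (D x) y = cinner x (D y)" for x y
      using nonneg_selfadjoint[OF B(1)] nonneg_selfadjoint[OF S(1)]
      by (simp add: D_def blinfun.diff_left cinner_diff_left cinner_diff_right)
    have "(B + S) \<odot> D = 0"
      using B(2) S(2) comm by (simp add: D_def comp.add_left comp.diff_right)
    then have "(B + S) (D x) = 0" for x by (metis blinfun_apply_blinfun_compose zero_blinfun.rep_eq)
    then have sum: "cinner (D x) (B (D x)) + cinner (D x) (S (D x)) = 0" for x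
      by (metis blinfun.add_left cinner_add_right cinner_zero(1))
    have "cinner (D x) (B (D x)) = 0 \<and> cinner (D x) (S (D x)) = 0" for x
    proof -
      have "0 \<le> Re (cinner (D x) (B (D x)))" "0 \<le> Re (cinner (D x) (S (D x)))"
        "Im (cinner (D x) (B (D x))) = 0" "Im (cinner (D x) (S (D x))) = 0"
        using B(1) S(1) by (auto simp: nonneg_blinfun_def complex_is_Real_iff)
      moreover have "Re (cinner (D x) (B (D x))) + Re (cinner (D x) (S (D x))) = 0"
        using arg_cong[OF sum[of x], of Re] by simp
      ultimately show ?thesis by (auto simp: complex_eq_iff)
    qed
    then have "cinner (D x) (D (D x)) = 0" for x
      by (simp add: D_def blinfun.diff_left cinner_diff_right)
    then have "cinner x (D (D (D x))) = 0" for x by (simp flip: saD)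
    then have "D \<odot> D \<odot> D = 0"
      by (intro sesquilinear_zero clinear_comp clD) simp
    then have D3: "D (D (D x)) = 0" for x by (metis blinfun_apply_blinfun_compose zero_blinfun.rep_eq)
    have "cinner (D (D x)) (D (D x)) = 0" for x by (simp add: saD D3 blinfun.zero_right)
    then have D2: "D (D x) = 0" for x by simp
    have "cinner (D x) (D x) = 0" for x by (simp add: saD D2)
    then have "D = 0" by (intro blinfun_eqI) simp
    then show "B = S" by (simp add: D_def)
  qed
  have "sqrt_blinfun A = S"
    unfolding sqrt_blinfun_def by (rule the_equality) (simp add: S(1,2), simp add: uniq)
  then show "nonneg_blinfun (sqrt_blinfun A)" "sqrt_blinfun A \<odot> sqrt_blinfun A = A"
    by (simp_all add: S(1,2))
qed

lemma norm_sqrt_blinfun: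
  assumes "nonneg_blinfun A"
  shows "cinner x (A y) = cinner (sqrt_blinfun A x) (sqrt_blinfun A y)"
  using nonneg_selfadjoint[OF sqrt_blinfun(1)[OF assms]] sqrt_blinfun(2)[OF assms]
  by (metis blinfun_apply_blinfun_compose)

text \<open>The squared norm of \<open>sqrt_blinfun A (X x)\<close> is the form of \<open>A\<close>
  at \<open>X x\<close>.\<close>

lemma sqrt_comp_eq_0_iff:
  assumes A: "nonneg_blinfun A"
  shows "sqrt_blinfun A \<odot> X = 0 \<longleftrightarrow> A \<odot> X = 0"
proof
  assume "sqrt_blinfun A \<odot> X = 0"
  then show "A \<odot> X = 0" using sqrt_blinfun(2)[OF A] comp_assoc[of "sqrt_blinfun A" "sqrt_blinfun A" X]
    by simp
next
  assume 0: "A \<odot> X = 0"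
  show "sqrt_blinfun A \<odot> X = 0"
  proof (rule blinfun_eqI)
    fix x
    have "A (X x) = 0" using 0 by (metis blinfun_apply_blinfun_compose zero_blinfun.rep_eq)
    then have "cinner (sqrt_blinfun A (X x)) (sqrt_blinfun A (X x)) = 0"
      using norm_sqrt_blinfun[OF A, of "X x" "X x"] by simp
    then show "(sqrt_blinfun A \<odot> X) x = blinfun_apply 0 x" by simp
  qed
qed

section \<open>Unbounded operators\<close>

lemma blinfun_eq_on_dense:
  fixes A B :: "'a::real_normed_vector \<Rightarrow>\<^sub>L 'b::real_normed_vector"
  assumes "closure S = UNIV" "\<And>x. x \<in> S \<Longrightarrow> A x = B x"
  shows "A = B"
proof (rule blinfun_eqI)
  fix x
  have "closed {x. A x = B x}"
    by (intro closed_Collect_eq blinfun.continuous_on continuous_intros)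
  then have "closure S \<subseteq> {x. A x = B x}"
    using assms(2) by (intro closure_minimal) auto
  then show "A x = B x" using assms(1) by auto
qed

lemma op_adjoint_iff:
  "(y, x) \<in> op_adjoint A \<longleftrightarrow> (\<forall>u v. (u, v) \<in> A \<longrightarrow> cinner y v = cinner x u)"
  unfolding op_adjoint_def by auto

lemma op_adjoint_closed: "closed (op_adjoint A)"
proof -
  have eq: "op_adjoint A = (\<Inter>p\<in>A. {q. cinner (fst q) (snd p) = cinner (snd q) (fst p)})"
    by (auto simp: op_adjoint_iff) (metis fst_conv snd_conv)
  show ?thesis
    unfolding eq by (intro closed_INT ballI closed_Collect_eq cinner.continuous_on continuous_intros)
qed

lemma op_adjoint_add:
  "(x, y) \<in> op_adjoint A \<Longrightarrow> (x', y') \<in> op_adjoint A \<Longrightarrow> (x + x', y + y') \<in> op_adjoint A"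
  by (simp add: op_adjoint_iff cinner_add_left)

lemma op_adjoint_scaleC: "(x, y) \<in> op_adjoint A \<Longrightarrow> (a *\<^sub>C x, a *\<^sub>C y) \<in> op_adjoint A"
  by (simp add: op_adjoint_iff cinner_scaleC_left)

lemma op_adjointD: "(y, x) \<in> op_adjoint A \<Longrightarrow> (u, v) \<in> A \<Longrightarrow> cinner y v = cinner x u"
  by (simp add: op_adjoint_iff)

lemma csubspace_graph: "linear_operator A \<Longrightarrow> csubspace A"
  by (auto simp: linear_operator_def csubspace_def scaleC_prod_def zero_prod_def)

text \<open>A pair \<open>(a, b)\<close> orthogonal to the graph of \<open>F\<close> yields
  \<open>(b, - a)\<close> in the adjoint. If \<open>\<phi>\<close> is orthogonal to the domain of
  the adjoint, \<open>(0, \<phi>)\<close> is therefore orthogonal to all such pairs and lies in the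
  closed graph, whence \<open>\<phi> = 0\<close>.\<close>

lemma op_adjoint_dense:
  fixes F :: "('h::complex_hilbert, 'k::complex_hilbert) operator"
  assumes F: "linear_operator F" and "closed F"
  shows "closure (Domain (op_adjoint F)) = UNIV"
proof (rule dense_csubspaceI)
  have "0 \<in> Domain (op_adjoint F)" by (rule DomainI[of _ 0]) (simp add: op_adjoint_def)
  then show "csubspace (Domain (op_adjoint F))"
    unfolding csubspace_def by (fast intro: op_adjoint_add op_adjoint_scaleC)
next
  fix \<phi> assume orth: "\<And>y. y \<in> Domain (op_adjoint F) \<Longrightarrow> cinner \<phi> y = 0"
  have "(0, \<phi>) \<in> F"
  proof (rule ccontr)
    assume "(0, \<phi>) \<notin> F"
    from closed_csubspace_orthogonal[OF csubspace_graph[OF F] \<open>closed F\<close> this]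
    obtain w where w: "cinner w (0, \<phi>) \<noteq> 0" "\<And>p. p \<in> F \<Longrightarrow> cinner w p = 0" by metis
    obtain a b where ab: "w = (a, b)" by (cases w)
    have "(b, - a) \<in> op_adjoint F"
      unfolding op_adjoint_def
    proof clarify
      fix u v assume "(u, v) \<in> F"
      then have "cinner a u + cinner b v = 0" using w(2)[of "(u, v)"] by (simp add: ab cinner_prod_def)
      then show "cinner b v = cinner (- a) u"
        by (simp add: cinner.minus_left add_eq_0_iff)
    qed
    then have "cinner \<phi> b = 0" by (intro orth) blast
    then have "cinner b \<phi> = 0" using cinner_commute[of b \<phi>] by simp
    then show False using w(1) by (simp add: ab cinner_prod_def)
  qed
  then show "\<phi> = 0" using F by (auto simp: linear_operator_def single_valued_def)
qed

lemma selfadjoint_symmetric: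
  "selfadjoint H \<Longrightarrow> (x, y) \<in> H \<Longrightarrow> (u, v) \<in> H \<Longrightarrow> cinner x v = cinner y u"
  using op_adjointD[of x y H u v] by (simp add: selfadjoint_def)

text \<open>\<open>H - z\<close> is bounded below by \<open>\<bar>Im z\<bar>\<close>, so its range
  \<open>S\<close> is closed. A vector orthogonal to \<open>S\<close> satisfies the eigenvalue
  equation of \<open>H\<close> for \<open>cnj z\<close>, which symmetry allows only for the zero
  vector.\<close>

lemma selfadjoint_resolvent:
  fixes H :: "('h::complex_hilbert, 'h) operator"
  assumes H: "selfadjoint H" and z: "Im z \<noteq> 0"
  obtains x y where "(x, y) \<in> H" "y - z *\<^sub>C x = f"
proof -
  have lin: "linear_operator H" and adj: "op_adjoint H = H"
    using H by (auto simp: selfadjoint_def)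
  have H_add: "(x, y) \<in> H \<Longrightarrow> (x', y') \<in> H \<Longrightarrow> (x + x', y + y') \<in> H"
    and H_scaleC: "(x, y) \<in> H \<Longrightarrow> (a *\<^sub>C x, a *\<^sub>C y) \<in> H" for a x y x' y'
    using lin by (auto simp: linear_operator_def)
  have H_diff: "(x - x', y - y') \<in> H" if "(x, y) \<in> H" "(x', y') \<in> H" for x y x' y'
    using H_add[OF that(1) H_scaleC[OF that(2), of "-1"]] by (simp add: scaleC.minus_left)
  define S where "S = {y - z *\<^sub>C x | x y. (x, y) \<in> H}"
  have lower: "\<bar>Im z\<bar> * norm x \<le> norm (y - z *\<^sub>C x)" if xy: "(x, y) \<in> H" for x y
  proof -
    have "cinner x y = cnj (cinner x y)"
      using selfadjoint_symmetric[OF H xy xy] cinner_commute[of y x] by simp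
    then have "Im (cinner x y) = 0" by (metis Reals_cnj_iff complex_is_Real_iff)
    then have "Im (cinner x (y - z *\<^sub>C x)) = - Im z * (norm x)\<^sup>2"
      by (simp add: cinner_diff_right cinner_scaleC_right cinner_self del: of_real_power)
    then have "\<bar>Im z\<bar> * (norm x)\<^sup>2 = \<bar>Im (cinner x (y - z *\<^sub>C x))\<bar>" by (simp add: abs_mult)
    also have "\<dots> \<le> norm x * norm (y - z *\<^sub>C x)"
      using abs_Im_le_cmod cinner_cauchy_schwarz order_trans by blast
    finally have "norm x * (\<bar>Im z\<bar> * norm x) \<le> norm x * norm (y - z *\<^sub>C x)"
      by (simp add: power2_eq_square mult_ac)
    then show ?thesis by (cases "x = 0") auto
  qed
  have S: "csubspace S"
    unfolding csubspace_def
  proof (intro conjI ballI allI)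
    have "(0, 0) \<in> H" using lin by (simp add: linear_operator_def)
    then show "0 \<in> S" unfolding S_def
      by (intro CollectI exI[of _ 0] conjI) (simp_all add: scaleC.zero_right)
    fix u assume "u \<in> S"
    then obtain x y where xy: "(x, y) \<in> H" "u = y - z *\<^sub>C x" by (auto simp: S_def)
    show "a *\<^sub>C u \<in> S" for a
      unfolding S_def using H_scaleC[OF xy(1), of a]
      by (intro CollectI exI[of _ "a *\<^sub>C x"] exI[of _ "a *\<^sub>C y"])
        (simp add: xy(2) scaleC.diff_right scaleC_scaleC mult.commute)
    fix v assume "v \<in> S"
    then obtain x' y' where xy': "(x', y') \<in> H" "v = y' - z *\<^sub>C x'" by (auto simp: S_def)
    show "u + v \<in> S"
      unfolding S_def using H_add[OF xy(1) xy'(1)]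
      by (intro CollectI exI[of _ "x + x'"] exI[of _ "y + y'"]) (simp add: xy xy' scaleC.add_right)
  qed
  have "closed S"
    unfolding closed_sequential_limits
  proof (intro allI impI, elim conjE)
    fix u l assume "\<forall>n. u n \<in> S" and l: "u \<longlonglongrightarrow> l"
    then have "\<forall>n. \<exists>x y. u n = y - z *\<^sub>C x \<and> (x, y) \<in> H" by (simp add: S_def)
    then obtain x y where xy: "\<And>n. (x n, y n) \<in> H" and u: "\<And>n. u n = y n - z *\<^sub>C x n" by metis
    have "Cauchy x"
    proof (rule metric_CauchyI)
      fix e :: real assume "e > 0"
      then have "\<bar>Im z\<bar> * e > 0" using z by simp
      then obtain M where M: "\<And>m n. m \<ge> M \<Longrightarrow> n \<ge> M \<Longrightarrow> dist (u m) (u n) < \<bar>Im z\<bar> * e"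
        using metric_CauchyD[OF LIMSEQ_imp_Cauchy[OF l]] by blast
      have "dist (x m) (x n) < e" if "m \<ge> M" "n \<ge> M" for m n
      proof -
        have "\<bar>Im z\<bar> * norm (x m - x n) \<le> norm ((y m - y n) - z *\<^sub>C (x m - x n))"
          by (intro lower H_diff xy)
        also have "(y m - y n) - z *\<^sub>C (x m - x n) = u m - u n"
          by (simp add: u scaleC.diff_right)
        also have "norm (u m - u n) < \<bar>Im z\<bar> * e" using M[OF that] by (simp add: dist_norm)
        finally show ?thesis using z by (simp add: dist_norm)
      qed
      then show "\<exists>M. \<forall>m\<ge>M. \<forall>n\<ge>M. dist (x m) (x n) < e" by blast
    qed
    then obtain p where p: "x \<longlonglongrightarrow> p" using Cauchy_convergent[of x] by (auto simp: convergent_def)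
    have y: "y \<longlonglongrightarrow> l + z *\<^sub>C p"
    proof -
      have "(\<lambda>n. u n + z *\<^sub>C x n) \<longlonglongrightarrow> l + z *\<^sub>C p" by (intro tendsto_intros scaleC.tendsto l p)
      then show ?thesis by (simp add: u)
    qed
    have "closed H" using op_adjoint_closed[of H] adj by simp
    from closed_sequentially[OF this xy tendsto_Pair[OF p y]]
    show "l \<in> S" unfolding S_def by force
  qed
  moreover have "closure S = UNIV"
  proof (rule dense_csubspaceI[OF S])
    fix w assume w: "\<And>s. s \<in> S \<Longrightarrow> cinner w s = 0"
    have "(w, cnj z *\<^sub>C w) \<in> op_adjoint H"
      unfolding op_adjoint_def
    proof clarify
      fix u v assume "(u, v) \<in> H"
      then have "v - z *\<^sub>C u \<in> S" by (auto simp: S_def)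
      from w[OF this] show "cinner w v = cinner (cnj z *\<^sub>C w) u"
        by (simp add: cinner_diff_right cinner_scaleC_right cinner_scaleC_left)
    qed
    then have wH: "(w, cnj z *\<^sub>C w) \<in> H" by (simp add: adj)
    have "cnj z * cinner w w = z * cinner w w"
      using selfadjoint_symmetric[OF H wH wH] by (simp add: cinner_scaleC_right cinner_scaleC_left)
    moreover have "cnj z \<noteq> z" using z by (simp add: complex_eq_iff)
    ultimately show "w = 0" by simp
  qed
  ultimately have "f \<in> S" by simp
  then show ?thesis using that by (auto simp: S_def)
qed

section \<open>The sandwiched resolvent\<close>

context rigged_affine_space
begin

lemma dense_adjoint_F: "closure (Domain (op_adjoint F)) = UNIV"
  by (rule op_adjoint_dense[OF F_linear F_closed])

lemma F_unique: "(x, g) \<in> F \<Longrightarrow> (x, g') \<in> F \<Longrightarrow> g = g'"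
  using F_linear by (auto simp: linear_operator_def single_valued_def)

text \<open>Witnesses for the three factors of the sandwiched resolvent at \<open>\<phi>\<close>.
  Identities for \<open>T_op\<close> are verified on such chains and extended by density.\<close>

lemma resolvent_chain:
  assumes H: "H \<in> AA" and z: "Im z \<noteq> 0" and \<phi>: "\<phi> \<in> Domain (op_adjoint F)"
  obtains f x y g where "(\<phi>, f) \<in> op_adjoint F" "(x, y) \<in> H" "y - z *\<^sub>C x = f" "(x, g) \<in> F"
proof -
  obtain f where f: "(\<phi>, f) \<in> op_adjoint F" using \<phi> by blast
  obtain x y where xy: "(x, y) \<in> H" "y - z *\<^sub>C x = f"
    using selfadjoint_resolvent[OF AA_selfadjoint[OF H] z] by blast
  then have "x \<in> D" using AA_domain[OF H] by blast
  then obtain g where "(x, g) \<in> F" using D_F by blast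
  with f xy that show ?thesis by blast
qed

lemma chain_relation:
  assumes "(\<phi>, f) \<in> op_adjoint F" "(x, y) \<in> H" "y - z *\<^sub>C x = f" "(x, g) \<in> F"
  shows "(\<phi>, g) \<in> op_adjoint F O resolvent_rel H z O F"
  using assms unfolding resolvent_rel_def by blast

text \<open>The \<open>THE\<close> in \<open>T_op\<close> denotes: chains exist over the dense
  domain of the adjoint and fix the values of a bounded operator there.\<close>

lemma T_op_properties:
  assumes H: "H \<in> AA" and z: "Im z \<noteq> 0"
  shows "compact_operator (T_op F H z)"
    and "op_adjoint F O resolvent_rel H z O F \<subseteq> op_graph (T_op F H z)"
proof -
  obtain T where T: "compact_operator T" "op_adjoint F O resolvent_rel H z O F \<subseteq> op_graph T"
    using T_compact[OF assms] by blast
  have uniq: "T' = T" if T': "op_adjoint F O resolvent_rel H z O F \<subseteq> op_graph T'" for T'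
  proof (rule blinfun_eq_on_dense[OF dense_adjoint_F])
    fix \<phi> assume "\<phi> \<in> Domain (op_adjoint F)"
    from resolvent_chain[OF H z this] obtain f x y g where
      "(\<phi>, f) \<in> op_adjoint F" "(x, y) \<in> H" "y - z *\<^sub>C x = f" "(x, g) \<in> F" by metis
    then have "(\<phi>, g) \<in> op_adjoint F O resolvent_rel H z O F" by (rule chain_relation)
    with T(2) T' have "g = T \<phi>" "g = T' \<phi>" by (auto simp: op_graph_def)
    then show "T' \<phi> = T \<phi>" by simp
  qed
  have "T_op F H z = T"
    unfolding T_op_def by (rule the_equality) (use T(2) uniq in blast)+
  then show "compact_operator (T_op F H z)"
    "op_adjoint F O resolvent_rel H z O F \<subseteq> op_graph (T_op F H z)"
    using T by simp_all
qed

lemma T_op_apply: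
  assumes "H \<in> AA" "Im z \<noteq> 0"
    and "(\<phi>, f) \<in> op_adjoint F" "(x, y) \<in> H" "y - z *\<^sub>C x = f" "(x, g) \<in> F"
  shows "T_op F H z \<phi> = g"
  using T_op_properties(2)[OF assms(1,2)] chain_relation[OF assms(3-6)] by (auto simp: op_graph_def)

text \<open>On chains this is the symmetry of \<open>H\<close>. It is extended one argument at a
  time, as an equality of bounded functionals on a dense set.\<close>

lemma T_op_adjoint:
  assumes H: "H \<in> AA" and z: "Im z \<noteq> 0"
  shows "cinner (T_op F H (cnj z) \<phi>) \<psi> = cinner \<phi> (T_op F H z \<psi>)"
proof -
  have z': "Im (cnj z) \<noteq> 0" using z by simp
  have core: "cinner (T_op F H (cnj z) \<phi>) \<psi> = cinner \<phi> (T_op F H z \<psi>)"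
    if dom: "\<phi> \<in> Domain (op_adjoint F)" "\<psi> \<in> Domain (op_adjoint F)" for \<phi> \<psi>
  proof -
    obtain f x y g where 1: "(\<phi>, f) \<in> op_adjoint F" "(x, y) \<in> H" "y - cnj z *\<^sub>C x = f" "(x, g) \<in> F"
      using resolvent_chain[OF H z' dom(1)] by metis
    obtain f' x' y' g' where 2: "(\<psi>, f') \<in> op_adjoint F" "(x', y') \<in> H" "y' - z *\<^sub>C x' = f'" "(x', g') \<in> F"
      using resolvent_chain[OF H z dom(2)] by metis
    have "cinner \<psi> g = cinner f' x" by (rule op_adjointD[OF 2(1) 1(4)])
    then have "cinner g \<psi> = cinner x f'" using cinner_commute[of g \<psi>] cinner_commute[of x f'] by simp
    also have "\<dots> = cinner x y' - z * cinner x x'"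
      by (simp add: cinner_diff_right cinner_scaleC_right flip: 2(3))
    also have "cinner x y' = cinner y x'"
      by (rule selfadjoint_symmetric[OF AA_selfadjoint[OF H] 1(2) 2(2)])
    also have "cinner y x' - z * cinner x x' = cinner f x'"
      by (simp add: cinner_diff_left cinner_scaleC_left flip: 1(3))
    also have "\<dots> = cinner \<phi> g'" by (rule op_adjointD[OF 1(1) 2(4), symmetric])
    finally show ?thesis
      by (simp add: T_op_apply[OF H z' 1] T_op_apply[OF H z 2])
  qed
  have step: "cinner (T_op F H (cnj z) \<phi>) \<psi> = cinner \<phi> (T_op F H z \<psi>)"
    if "\<phi> \<in> Domain (op_adjoint F)" for \<phi> \<psi>
  proof -
    have "cinner_blinfun (T_op F H (cnj z) \<phi>) = cinner_blinfun \<phi> \<odot> T_op F H z"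
      by (rule blinfun_eq_on_dense[OF dense_adjoint_F]) (simp add: core that)
    then have "blinfun_apply (cinner_blinfun (T_op F H (cnj z) \<phi>)) \<psi> =
        blinfun_apply (cinner_blinfun \<phi> \<odot> T_op F H z) \<psi>" by (rule arg_cong)
    then show ?thesis by simp
  qed
  have "cinner_blinfun \<psi> \<odot> T_op F H (cnj z) = cinner_blinfun (T_op F H z \<psi>)"
  proof (rule blinfun_eq_on_dense[OF dense_adjoint_F])
    fix \<phi> assume "\<phi> \<in> Domain (op_adjoint F)"
    from step[OF this, of \<psi>] show "blinfun_apply (cinner_blinfun \<psi> \<odot> T_op F H (cnj z)) \<phi> =
        blinfun_apply (cinner_blinfun (T_op F H z \<psi>)) \<phi>"
      using cinner_commute[of \<psi>] cinner_commute[of "T_op F H z \<psi>"] by simp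
  qed
  then have "blinfun_apply (cinner_blinfun \<psi> \<odot> T_op F H (cnj z)) \<phi> =
        blinfun_apply (cinner_blinfun (T_op F H z \<psi>)) \<phi>" by (rule arg_cong)
  then show ?thesis
    using cinner_commute[of _ \<psi>] cinner_commute[of _ "T_op F H z \<psi>"] by simp
qed

text \<open>Along a chain the imaginary part equals \<open>Im z\<close> times the squared norm of
  \<open>x\<close>; the condition on \<open>\<phi>\<close> is closed, so density suffices.\<close>

lemma T_op_Im_nonneg:
  assumes H: "H \<in> AA" and z: "Im z > 0"
  shows "0 \<le> Im (cinner \<phi> (T_op F H z \<phi>))"
proof -
  have z': "Im z \<noteq> 0" using z by simp
  have "closed {\<phi>. 0 \<le> Im (cinner \<phi> (T_op F H z \<phi>))}"
    by (intro closed_Collect_le continuous_intros cinner.continuous_on blinfun.continuous_on)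
  moreover have "0 \<le> Im (cinner \<phi> (T_op F H z \<phi>))" if dom: "\<phi> \<in> Domain (op_adjoint F)" for \<phi>
  proof -
    obtain f x y g where 1: "(\<phi>, f) \<in> op_adjoint F" "(x, y) \<in> H" "y - z *\<^sub>C x = f" "(x, g) \<in> F"
      using resolvent_chain[OF H z' dom] by metis
    have "cinner y x = cnj (cinner y x)"
      using selfadjoint_symmetric[OF AA_selfadjoint[OF H] 1(2) 1(2)] cinner_commute[of y x] by simp
    then have "Im (cinner y x) = 0" by (metis Reals_cnj_iff complex_is_Real_iff)
    moreover have "cinner \<phi> g = cinner y x - cnj z * cinner x x"
      using op_adjointD[OF 1(1,4)] by (simp add: cinner_diff_left cinner_scaleC_left flip: 1(3))
    ultimately show ?thesis
      using z by (simp add: T_op_apply[OF H z' 1] cinner_self del: of_real_power)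
  qed
  ultimately have "closure (Domain (op_adjoint F)) \<subseteq> {\<phi>. 0 \<le> Im (cinner \<phi> (T_op F H z \<phi>))}"
    by (intro closure_minimal) auto
  then show ?thesis using dense_adjoint_F by auto
qed

text \<open>On \<open>D\<close> the closure in \<open>rigged_op\<close> adds no new value: the
  product is already defined there and its self-adjoint closure is single valued.\<close>

lemma rigged_op_on_D:
  assumes J: "J \<in> JJ" and x: "x \<in> D" and v: "(x, v) \<in> rigged_op F J" and g: "(x, g) \<in> F"
  shows "(J g, v) \<in> op_adjoint F"
proof -
  obtain v' where v': "(x, v') \<in> rigged_product F J" using D_V[OF J] x by blast
  then have "(x, v') \<in> rigged_op F J" unfolding rigged_op_def using closure_subset by blast
  then have "v' = v"
    using V_selfadjoint[OF J] v by (auto simp: selfadjoint_def linear_operator_def single_valued_def)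
  moreover obtain g' where "(x, g') \<in> F" "(J g', v') \<in> op_adjoint F"
    using v' unfolding rigged_product_def op_graph_def by blast
  ultimately show ?thesis using F_unique[OF g] by metis
qed

lemma rigged_op_memI:
  assumes "(x, g) \<in> F" "(blinfun_apply J g, v) \<in> op_adjoint F"
  shows "(x, v) \<in> rigged_op F J"
proof -
  have "(x, v) \<in> rigged_product F J" unfolding rigged_product_def op_graph_def using assms by blast
  then show ?thesis unfolding rigged_op_def using closure_subset by blast
qed

lemma D_rigged_op:
  assumes J: "J \<in> JJ" and x: "x \<in> D"
  obtains g v where "(x, g) \<in> F" "(x, v) \<in> rigged_op F J" "(J g, v) \<in> op_adjoint F"
proof -
  obtain v where "(x, v) \<in> rigged_product F J" using D_V[OF J] x by blast
  then obtain g where "(x, g) \<in> F" "(J g, v) \<in> op_adjoint F"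
    unfolding rigged_product_def op_graph_def by blast
  then show ?thesis using that rigged_op_memI by blast
qed

lemma op_adjoint_scaleR: "(x, y) \<in> op_adjoint A \<Longrightarrow> (r *\<^sub>R x, r *\<^sub>R y) \<in> op_adjoint A"
  unfolding scaleR_scaleC by (rule op_adjoint_scaleC)

text \<open>The candidate \<open>H1\<close> comes from \<open>J0 + r *\<^sub>R J\<close>. Sums of
  closures are compared on \<open>D\<close>, where the products themselves apply; one inclusion
  gives equality because both sides have domain \<open>D\<close> and \<open>H1\<close> is single
  valued.\<close>

lemma path_in_AA:
  assumes H0: "H0 \<in> AA" and J: "J \<in> JJ"
  shows "op_add H0 (op_scaleR r (rigged_op F J)) \<in> AA"
proof -
  obtain H where H: "H \<in> AA" "AA = {op_add H (rigged_op F J) | J. J \<in> JJ}" using AA_affine by blast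
  then obtain J0 where J0: "J0 \<in> JJ" "H0 = op_add H (rigged_op F J0)" using H0 by blast
  define J1 where "J1 = J0 + r *\<^sub>R J"
  have J1: "J1 \<in> JJ" unfolding J1_def using JJ_subspace J J0 by (auto intro: subspace_add subspace_scale)
  define H1 where "H1 = op_add H (rigged_op F J1)"
  have H1: "H1 \<in> AA" unfolding H1_def using H(2) J1 by blast
  let ?L = "op_add H0 (op_scaleR r (rigged_op F J))"
  have sub: "?L \<subseteq> H1"
  proof clarify
    fix x y assume "(x, y) \<in> ?L"
    then obtain h v where hv: "(x, h) \<in> H0" "(x, v) \<in> rigged_op F J" "y = h + r *\<^sub>R v"
      by (auto simp: op_add_def op_scaleR_def)
    then obtain h' v0 where h': "(x, h') \<in> H" "(x, v0) \<in> rigged_op F J0" "h = h' + v0"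
      by (auto simp: J0(2) op_add_def)
    have x: "x \<in> D" using AA_domain[OF H0] hv(1) by blast
    obtain g where g: "(x, g) \<in> F" using D_F x by blast
    have "(J0 g + r *\<^sub>R J g, v0 + r *\<^sub>R v) \<in> op_adjoint F"
      by (intro op_adjoint_add op_adjoint_scaleR rigged_op_on_D[OF _ x] J J0 h' hv g)
    then have "(x, v0 + r *\<^sub>R v) \<in> rigged_op F J1"
      by (intro rigged_op_memI[OF g]) (simp add: J1_def blinfun.bilinear_simps)
    with h' hv(3) show "(x, y) \<in> H1" by (auto simp: H1_def op_add_def add.assoc)
  qed
  have "H1 \<subseteq> ?L"
  proof clarify
    fix x y assume xy: "(x, y) \<in> H1"
    then have x: "x \<in> D" using AA_domain[OF H1] by blast
    obtain h where h: "(x, h) \<in> H0" using AA_domain[OF H0] x by blast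
    obtain g v where v: "(x, v) \<in> rigged_op F J" using D_rigged_op[OF J x] by metis
    have L: "(x, h + r *\<^sub>R v) \<in> ?L" using h v by (auto simp: op_add_def op_scaleR_def)
    then have "(x, h + r *\<^sub>R v) \<in> H1" using sub by blast
    then have "y = h + r *\<^sub>R v"
      using AA_selfadjoint[OF H1] xy by (auto simp: selfadjoint_def linear_operator_def single_valued_def)
    with L show "(x, y) \<in> ?L" by simp
  qed
  with sub H1 show ?thesis by simp
qed

text \<open>Adding zero times an unbounded operator could shrink the domain; it does not, since
  \<open>D\<close> lies in the domain of that operator.\<close>

lemma path_zero:
  assumes H0: "H0 \<in> AA" and J: "J \<in> JJ"
  shows "op_add H0 (op_scaleR 0 (rigged_op F J)) = H0"
proof (intro equalityI subsetI; clarify)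
  fix x y assume xy: "(x, y) \<in> H0"
  then have "x \<in> D" using AA_domain[OF H0] by blast
  from D_rigged_op[OF J this] obtain v where "(x, v) \<in> rigged_op F J" by metis
  then show "(x, y) \<in> op_add H0 (op_scaleR 0 (rigged_op F J))"
    using xy unfolding op_add_def op_scaleR_def by force
qed (auto simp: op_add_def op_scaleR_def)

text \<open>Second resolvent identity on chains: the \<open>x\<close> that solves the equation for
  \<open>H_s\<close> with right side \<open>f\<close> solves the one for \<open>H_t\<close> with
  right side \<open>f + (t - s) *\<^sub>R v\<close>. So \<open>g\<close> is also the image of
  \<open>\<phi> + (t - s) *\<^sub>R J g\<close> at \<open>t\<close>.\<close>

lemma T_op_path:
  assumes H0: "H0 \<in> AA" and J: "J \<in> JJ" and z: "Im z \<noteq> 0"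
    and Hp: "\<And>r. Hp r = op_add H0 (op_scaleR r (rigged_op F J))"
  shows "T_op F (Hp t) z \<odot> (id_blinfun + (t - s) *\<^sub>R (J \<odot> T_op F (Hp s) z)) = T_op F (Hp s) z"
proof (rule blinfun_eq_on_dense[OF dense_adjoint_F])
  have AA: "Hp r \<in> AA" for r unfolding Hp by (rule path_in_AA[OF H0 J])
  fix \<phi> assume "\<phi> \<in> Domain (op_adjoint F)"
  from resolvent_chain[OF AA z this] obtain f x y g where
    1: "(\<phi>, f) \<in> op_adjoint F" "(x, y) \<in> Hp s" "y - z *\<^sub>C x = f" "(x, g) \<in> F" by metis
  have g: "T_op F (Hp s) z \<phi> = g" by (rule T_op_apply[OF AA z 1])
  from 1(2) obtain h v where hv: "(x, h) \<in> H0" "(x, v) \<in> rigged_op F J" "y = h + s *\<^sub>R v"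
    by (auto simp: Hp op_add_def op_scaleR_def)
  have x: "x \<in> D" using AA_domain[OF H0] hv(1) by blast
  have "(\<phi> + (t - s) *\<^sub>R J g, f + (t - s) *\<^sub>R v) \<in> op_adjoint F"
    by (intro op_adjoint_add op_adjoint_scaleR rigged_op_on_D[OF J x] 1 hv)
  moreover have "(x, y + (t - s) *\<^sub>R v) \<in> Hp t"
  proof -
    have "y + (t - s) *\<^sub>R v = h + t *\<^sub>R v" by (simp add: hv(3) algebra_simps)
    then show ?thesis using hv(1,2) by (auto simp: Hp op_add_def op_scaleR_def)
  qed
  ultimately have "T_op F (Hp t) z (\<phi> + (t - s) *\<^sub>R J g) = g"
    using 1(3,4) by (intro T_op_apply[OF AA z]) (auto simp: algebra_simps)
  then show "(T_op F (Hp t) z \<odot> (id_blinfun + (t - s) *\<^sub>R (J \<odot> T_op F (Hp s) z))) \<phi> = T_op F (Hp s) z \<phi>"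
    by (simp add: g blinfun.add_left blinfun.scaleR_left)
qed

end

section \<open>Removable singularities and growth\<close>

lemma holomorphic_at_bounded:
  fixes f :: "complex \<Rightarrow> 'a::real_normed_vector \<Rightarrow>\<^sub>L 'b::complex_hilbert"
  assumes "holomorphic_at f z"
  obtains C where "\<forall>\<^sub>F s in at z. norm (f s) \<le> C"
proof -
  obtain C where "\<forall>\<^sub>F s in at z. complex_differentiable f s \<and> cmod (s - z) ^ 0 * norm (f s) \<le> C"
    using assms unfolding holomorphic_at_def pole_order_le_iff by blast
  then have "\<forall>\<^sub>F s in at z. norm (f s) \<le> C" by eventually_elim simp
  with that show ?thesis by blast
qed

lemma holomorphic_at_if_bounded:
  fixes f :: "complex \<Rightarrow> 'a::real_normed_vector \<Rightarrow>\<^sub>L 'b::complex_hilbert"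
  assumes "pole_order_le n f z" "\<forall>\<^sub>F s in at z. norm (f s) \<le> C"
  shows "holomorphic_at f z"
  unfolding holomorphic_at_def pole_order_le_iff
  using eventually_conj[OF pole_order_le_eventually_differentiable[OF assms(1)] assms(2)]
  by (intro exI[of _ C]) (auto elim: eventually_mono)

lemma filterlim_of_real_at: "filterlim complex_of_real (at (of_real x)) (at x)"
  unfolding filterlim_at
  by (auto simp: eventually_at_filter intro!: tendsto_intros)

text \<open>Induction on the order: the numerator at the pole is its limit along the reals, where
  the bound on \<open>f\<close> forces it to be zero, so one order is lost.\<close>

lemma holomorphic_at_if_bounded_on_reals:
  fixes f :: "complex \<Rightarrow> 'a::real_normed_vector \<Rightarrow>\<^sub>L 'b::complex_hilbert"
  assumes "pole_order_le n f (of_real x)" and bound: "\<forall>\<^sub>F r in at x. norm (f (of_real r)) \<le> C"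
  shows "holomorphic_at f (of_real x)"
  using assms(1)
proof (induction n)
  case 0
  then show ?case by (simp add: holomorphic_at_def)
next
  case (Suc n)
  let ?z = "complex_of_real x"
  obtain d h where d: "d > 0" and h: "\<And>w. w \<in> ball ?z d \<Longrightarrow> complex_differentiable h w"
    and f: "\<And>w. w \<in> ball ?z d - {?z} \<Longrightarrow> f w = inverse ((w - ?z) ^ Suc n) *\<^sub>C h w"
    using Suc.prems unfolding pole_order_le_def by blast
  have lim: "((\<lambda>r. h (of_real r)) \<longlongrightarrow> h ?z) (at x)"
  proof -
    have "(h \<longlongrightarrow> h ?z) (at ?z)"
      using complex_differentiable_isCont[OF h, of ?z] d by (simp add: isCont_def)
    then show ?thesis by (rule filterlim_compose[OF _ filterlim_of_real_at])
  qed
  have "\<forall>\<^sub>F r in at x. complex_of_real r \<in> ball ?z d - {?z}"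
    using filterlim_of_real_at eventually_at_punctured_ball[OF d]
    by (rule eventually_compose_filterlim[rotated])
  then have "\<forall>\<^sub>F r in at x. norm (h (of_real r)) \<le> \<bar>r - x\<bar> ^ Suc n * C"
    using bound
  proof eventually_elim
    case (elim r)
    have "h (of_real r) = (complex_of_real r - ?z) ^ Suc n *\<^sub>C f (of_real r)"
      using elim(1) by (simp add: f scaleC_scaleC del: power_Suc)
    then have "norm (h (of_real r)) = \<bar>r - x\<bar> ^ Suc n * norm (f (of_real r))"
      by (simp add: norm_scaleC norm_power norm_mult flip: of_real_diff)
    then show ?case using elim(2) by (simp add: mult_left_mono del: power_Suc)
  qed
  moreover have "((\<lambda>r. \<bar>r - x\<bar> ^ Suc n * C) \<longlongrightarrow> \<bar>x - x\<bar> ^ Suc n * C) (at x)"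
    by (intro tendsto_intros)
  ultimately have "norm (h ?z) \<le> \<bar>x - x\<bar> ^ Suc n * C"
    by (intro tendsto_le[OF _ _ tendsto_norm[OF lim]]) auto
  then have "h ?z = 0" by simp
  from pole_order_le_numerator[OF d h f this] show ?case by (rule Suc.IH)
qed

lemma holomorphic_at_cong:
  "holomorphic_at f z \<Longrightarrow> \<forall>\<^sub>F s in at z. f s = g s \<Longrightarrow> holomorphic_at g z"
  unfolding holomorphic_at_def by (rule pole_order_le_cong)

lemma holomorphic_at_linear:
  "holomorphic_at f z \<Longrightarrow> bounded_linear T \<Longrightarrow> (\<And>a x. T (a *\<^sub>C x) = a *\<^sub>C T x) \<Longrightarrow> holomorphic_at (\<lambda>s. T (f s)) z"
  unfolding holomorphic_at_def by (rule pole_order_le_linear)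

lemma eventually_at_cnj:
  assumes "\<forall>\<^sub>F s in at (complex_of_real x). P s"
  shows "\<forall>\<^sub>F s in at (complex_of_real x). P (cnj s)"
proof -
  obtain d where d: "d > 0" "\<And>s. s \<noteq> of_real x \<Longrightarrow> dist s (complex_of_real x) < d \<Longrightarrow> P s"
    using assms unfolding eventually_at by blast
  have "dist (cnj s) (complex_of_real x) = dist s (complex_of_real x)" for s
    unfolding dist_norm by (metis complex_cnj_complex_of_real complex_cnj_diff complex_mod_cnj)
  moreover have "cnj s \<noteq> of_real x" if "s \<noteq> of_real x" for s
    using that by (metis complex_cnj_cnj complex_cnj_complex_of_real)
  ultimately show ?thesis unfolding eventually_at using d by metis
qed

lemma norm_le_if_adjoint:
  assumes "\<And>x y. cinner (blinfun_apply A x) y = cinner x (blinfun_apply B y)"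
  shows "norm A \<le> norm B"
proof (rule norm_blinfun_le_entries)
  fix x y
  have "cmod (cinner x (A y)) = cmod (cinner y (B x))"
    using assms[of y x] cinner_commute[of x "A y"] by simp
  also have "\<dots> \<le> norm y * (norm B * norm x)"
    by (rule order_trans[OF cinner_cauchy_schwarz]) (simp add: mult_left_mono norm_blinfun)
  finally show "cmod (cinner x (A y)) \<le> norm B * norm x * norm y" by (simp add: mult_ac)
qed simp

text \<open>\<open>S\<close> contains a punctured real neighbourhood of 0, so the identity theorem
  determines the extension chosen by \<open>SOME\<close> on a punctured neighbourhood of every
  point.\<close>

lemma meromorphic_ext_eq:
  fixes g :: "complex \<Rightarrow> 'a::real_normed_vector \<Rightarrow>\<^sub>L 'b::complex_hilbert"
  assumes near: "\<forall>\<^sub>F r in at 0. r \<in> S" and g: "meromorphic_entire g"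
    and gf: "\<And>s. s \<in> S \<Longrightarrow> g (complex_of_real s) = f s"
  shows "meromorphic_entire (meromorphic_ext f S)" "\<forall>\<^sub>F s in at z. meromorphic_ext f S s = g s"
proof -
  have ex: "\<exists>g. meromorphic_entire g \<and> (\<forall>s\<in>S. g (complex_of_real s) = f s)" using g gf by blast
  from someI_ex[OF ex] show mer: "meromorphic_entire (meromorphic_ext f S)"
    by (simp add: meromorphic_ext_def)
  from someI_ex[OF ex] have f: "meromorphic_ext f S (complex_of_real s) = f s" if "s \<in> S" for s
    using that by (simp add: meromorphic_ext_def)
  have "\<exists>\<^sub>F s in at (of_real 0). meromorphic_ext f S s = g s"
    unfolding frequently_def
  proof
    assume "\<forall>\<^sub>F s in at (of_real 0). \<not> meromorphic_ext f S s = g s"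
    then have "\<forall>\<^sub>F r in at 0. \<not> meromorphic_ext f S (of_real r) = g (of_real r)"
      by (rule eventually_compose_filterlim[OF _ filterlim_of_real_at])
    with near have "\<forall>\<^sub>F r in at (0::real). False" by eventually_elim (simp add: f gf)
    then show False by simp
  qed
  then show "\<forall>\<^sub>F s in at z. meromorphic_ext f S s = g s" by (rule meromorphic_identity[OF mer g])
qed

lemma resolvent_pole_fredholm:
  fixes K :: "'a::complex_hilbert \<Rightarrow>\<^sub>L 'a"
  assumes K: "finite_rank_limit K"
  obtains n where "resolvent_pole (\<lambda>s. K \<odot> inv_blinfun (id_blinfun + s *\<^sub>C K)) z n"
proof -
  let ?G = "\<lambda>s. inv_blinfun (id_blinfun + s *\<^sub>C K)"
  have clK: "clinear K" using K by (simp add: finite_rank_limit_def)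
  obtain n where n: "pole_order_le n ?G z"
    using analytic_fredholm(1)[OF K] unfolding meromorphic_entire_def by blast
  have "resolvent_pole (\<lambda>s. K \<odot> ?G s) z n"
  proof
    show "pole_order_le n (\<lambda>s. K \<odot> ?G s) z"
      by (rule pole_order_le_linear[OF n bounded_linear_comp_left comp_left_scaleC]) (rule clK)+
    show "\<forall>\<^sub>F s in at z. clinear (K \<odot> ?G s)"
      by (intro always_eventually allI clinear_comp clinear_inv clinear_intros clK)
    show "\<forall>\<^sub>F t in at z. \<forall>\<^sub>F s in at z. K \<odot> ?G s - K \<odot> ?G t = (t - s) *\<^sub>C ((K \<odot> ?G s) \<odot> (K \<odot> ?G t))"
      using analytic_fredholm(2)[OF K, of z]
    proof eventually_elim
      case t: (elim t)
      show ?case using analytic_fredholm(2)[OF K, of z]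
      proof eventually_elim
        case (elim s)
        have "K \<odot> ?G s - K \<odot> ?G t = K \<odot> (?G s - ?G t)" by (simp only: comp.diff_right)
        also have "\<dots> = (t - s) *\<^sub>C (K \<odot> (?G s \<odot> K \<odot> ?G t))"
          unfolding inverse_resolvent_identity[OF clK elim t] by (rule comp_scaleC_right[OF clK])
        finally show ?case by (simp only: comp_assoc)
      qed
    qed
  qed
  with that show ?thesis by blast
qed

lemma comp_inv_commute:
  fixes X Y :: "'a::real_normed_vector \<Rightarrow>\<^sub>L 'a"
  assumes "X \<odot> Y = Y \<odot> X" "invertible_blinfun Y"
  shows "X \<odot> inv_blinfun Y = inv_blinfun Y \<odot> X"
proof -
  have "X \<odot> inv_blinfun Y = inv_blinfun Y \<odot> (Y \<odot> X) \<odot> inv_blinfun Y"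
    using inv_blinfun(2)[OF assms(2)] by (simp flip: comp_assoc)
  also have "\<dots> = inv_blinfun Y \<odot> X \<odot> (Y \<odot> inv_blinfun Y)"
    unfolding assms(1)[symmetric] by (simp only: comp_assoc)
  finally show ?thesis using inv_blinfun(1)[OF assms(2)] by simp
qed

lemma fredholm_commute:
  fixes K :: "'a::complex_normed_vector \<Rightarrow>\<^sub>L 'a"
  assumes K: "clinear K" and inv: "invertible_blinfun (id_blinfun + s *\<^sub>C K)" "invertible_blinfun (id_blinfun + t *\<^sub>C K)"
  shows "K \<odot> inv_blinfun (id_blinfun + s *\<^sub>C K) = inv_blinfun (id_blinfun + s *\<^sub>C K) \<odot> K"
    and "inv_blinfun (id_blinfun + s *\<^sub>C K) \<odot> (K \<odot> inv_blinfun (id_blinfun + t *\<^sub>C K)) =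
      (K \<odot> inv_blinfun (id_blinfun + t *\<^sub>C K)) \<odot> inv_blinfun (id_blinfun + s *\<^sub>C K)"
proof -
  let ?G = "\<lambda>s. inv_blinfun (id_blinfun + s *\<^sub>C K)"
  have K_comm: "K \<odot> (id_blinfun + s *\<^sub>C K) = (id_blinfun + s *\<^sub>C K) \<odot> K" for s
    by (simp add: comp.add_left comp.add_right comp_scaleC_left comp_scaleC_right[OF K])
  show KG: "K \<odot> ?G s = ?G s \<odot> K" by (rule comp_inv_commute[OF K_comm inv(1)])
  have KGt: "K \<odot> ?G t = ?G t \<odot> K" by (rule comp_inv_commute[OF K_comm inv(2)])
  have clG: "clinear (?G t)" by (intro clinear_inv clinear_intros K)
  have "?G t \<odot> (id_blinfun + s *\<^sub>C K) = (id_blinfun + s *\<^sub>C K) \<odot> ?G t"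
    by (simp add: comp.add_left comp.add_right comp_scaleC_left comp_scaleC_right[OF clG] KGt)
  from comp_inv_commute[OF this inv(1)] show "?G s \<odot> (K \<odot> ?G t) = (K \<odot> ?G t) \<odot> ?G s"
    by (metis KG comp_assoc)
qed

text \<open>Multiplying by the highest power of \<open>r - x\<close> and letting \<open>r\<close>
  tend to \<open>x\<close> isolates the top coefficient; the others follow by induction.\<close>

lemma principal_part_eq_0:
  fixes c :: "nat \<Rightarrow> real"
  assumes "\<forall>\<^sub>F r in at x. (\<Sum>i<n. c i / (r - x) ^ Suc i) = 0" "i < n"
  shows "c i = 0"
  using assms
proof (induction n)
  case (Suc n)
  have "\<forall>\<^sub>F r in at x. (\<Sum>i<Suc n. c i * (r - x) ^ (n - i)) = 0"
    using Suc.prems(1) eventually_neq_at_within[of x x UNIV]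
  proof eventually_elim
    case (elim r)
    have "(\<Sum>i<Suc n. c i * (r - x) ^ (n - i)) = (r - x) ^ Suc n * (\<Sum>i<Suc n. c i / (r - x) ^ Suc i)"
      unfolding sum_distrib_left
    proof (intro sum.cong refl)
      fix i assume "i \<in> {..<Suc n}"
      then have "(r - x) ^ Suc n = (r - x) ^ (n - i) * (r - x) ^ Suc i"
        by (simp only: flip: power_add) simp
      then show "c i * (r - x) ^ (n - i) = (r - x) ^ Suc n * (c i / (r - x) ^ Suc i)"
        using elim(2) by simp
    qed
    then show ?case using elim(1) by simp
  qed
  then have "((\<lambda>r. \<Sum>i<Suc n. c i * (r - x) ^ (n - i)) \<longlongrightarrow> 0) (at x)"
    by (rule tendsto_eventually)
  moreover have "((\<lambda>r. \<Sum>i<Suc n. c i * (r - x) ^ (n - i)) \<longlongrightarrow> (\<Sum>i<Suc n. c i * (x - x) ^ (n - i))) (at x)"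
    by (intro tendsto_intros)
  ultimately have "(\<Sum>i<Suc n. c i * (x - x) ^ (n - i)) = 0"
    using tendsto_unique[of "at x"] by fastforce
  moreover have "(\<Sum>i<n. c i * (x - x) ^ (n - i)) = 0" by (intro sum.neutral) auto
  ultimately have "c n = 0" by simp
  with Suc show ?case by (cases "i = n") auto
qed simp

section \<open>The path of boundary values\<close>

text \<open>The resolvent identity used in both directions supplies an explicit two-sided inverse,
  with no smallness of \<open>r\<close>.\<close>

lemma resolvent_inverse:
  fixes T\<^sub>0 T\<^sub>r J :: "'a::real_normed_vector \<Rightarrow>\<^sub>L 'a"
  assumes res1: "T\<^sub>r \<odot> (id_blinfun + r *\<^sub>R (J \<odot> T\<^sub>0)) = T\<^sub>0"
    and res2: "T\<^sub>0 \<odot> (id_blinfun - r *\<^sub>R (J \<odot> T\<^sub>r)) = T\<^sub>r"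
  shows "(id_blinfun + r *\<^sub>R (J \<odot> T\<^sub>0)) \<odot> (id_blinfun - r *\<^sub>R (J \<odot> T\<^sub>r)) = id_blinfun"
    and "(id_blinfun - r *\<^sub>R (J \<odot> T\<^sub>r)) \<odot> (id_blinfun + r *\<^sub>R (J \<odot> T\<^sub>0)) = id_blinfun"
proof -
  define N where "N = id_blinfun - r *\<^sub>R (J \<odot> T\<^sub>r)"
  have "(J \<odot> T\<^sub>0) \<odot> N = J \<odot> T\<^sub>r"
    unfolding comp_assoc N_def res2 ..
  then have "(id_blinfun + r *\<^sub>R (J \<odot> T\<^sub>0)) \<odot> N = id_blinfun"
    by (simp add: comp.add_left comp.scaleR_left) (simp add: N_def)
  then show "(id_blinfun + r *\<^sub>R (J \<odot> T\<^sub>0)) \<odot> (id_blinfun - r *\<^sub>R (J \<odot> T\<^sub>r)) = id_blinfun"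
    by (simp only: N_def)
  have "(id_blinfun - r *\<^sub>R (J \<odot> T\<^sub>r)) \<odot> (id_blinfun + r *\<^sub>R (J \<odot> T\<^sub>0)) =
      id_blinfun + r *\<^sub>R (J \<odot> T\<^sub>0) - r *\<^sub>R (J \<odot> (T\<^sub>r \<odot> (id_blinfun + r *\<^sub>R (J \<odot> T\<^sub>0))))"
    by (simp only: comp.diff_left comp_id comp.scaleR_left comp_assoc)
  then show "(id_blinfun - r *\<^sub>R (J \<odot> T\<^sub>r)) \<odot> (id_blinfun + r *\<^sub>R (J \<odot> T\<^sub>0)) = id_blinfun"
    unfolding res1 by simp
qed

text \<open>The interface between the unbounded operators and the meromorphic argument:
  \<open>T \<sigma> r\<close> is the boundary value with sign \<open>\<sigma>\<close> at the path
  parameter \<open>r\<close>, \<open>S\<close> the set of regular parameters and \<open>x\<close>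
  the point studied. \<open>near\<close> makes continuation from \<open>S\<close> unique.\<close>

locale resonance_path =
  fixes T :: "real \<Rightarrow> real \<Rightarrow> 'k::complex_hilbert \<Rightarrow>\<^sub>L 'k" and J :: "'k \<Rightarrow>\<^sub>L 'k"
    and S :: "real set" and x :: real
  assumes J: "bounded_selfadjoint J"
    and frl: "\<sigma> \<in> {1, -1} \<Longrightarrow> finite_rank_limit (T \<sigma> 0)"
    and adj: "r \<in> S \<Longrightarrow> cinner (T (-1) r u) v = cinner u (T 1 r v)"
    and pos: "r \<in> S \<Longrightarrow> 0 \<le> Im (cinner u (T 1 r u))"
    and res1: "r \<in> S \<Longrightarrow> \<sigma> \<in> {1, -1} \<Longrightarrow> T \<sigma> r \<odot> (id_blinfun + r *\<^sub>R (J \<odot> T \<sigma> 0)) = T \<sigma> 0"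
    and res2: "r \<in> S \<Longrightarrow> \<sigma> \<in> {1, -1} \<Longrightarrow> T \<sigma> 0 \<odot> (id_blinfun - r *\<^sub>R (J \<odot> T \<sigma> r)) = T \<sigma> r"
    and S0: "0 \<in> S" and near: "\<forall>\<^sub>F r in at 0. r \<in> S"
begin

abbreviation z :: complex where "z \<equiv> complex_of_real x"

definition K where "K \<sigma> = J \<odot> T \<sigma> 0"
definition L where "L \<sigma> = T \<sigma> 0 \<odot> J"
definition G where "G \<sigma> s = inv_blinfun (id_blinfun + s *\<^sub>C K \<sigma>)"
definition G' where "G' \<sigma> s = inv_blinfun (id_blinfun + s *\<^sub>C L \<sigma>)"
definition B where "B \<sigma> s = K \<sigma> \<odot> G \<sigma> s"
definition A where "A \<sigma> s = L \<sigma> \<odot> G' \<sigma> s"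
definition reg where "reg \<sigma> s \<longleftrightarrow> invertible_blinfun (id_blinfun + s *\<^sub>C K \<sigma>)"
text \<open>The continuation of the imaginary part. \<open>Im_blinfun\<close> itself is not
  holomorphic in a complex parameter, whereas the difference of the two continued boundary values is
  meromorphic and agrees with it on \<open>S\<close>.\<close>

definition M where "M s = (1 / (2 * \<i>)) *\<^sub>C (T 1 0 \<odot> G 1 s - T (-1) 0 \<odot> G (-1) s)"
definition W where "W = sqrt_blinfun (Im_blinfun (T 1 0))"
definition Q where "Q \<sigma> = residue_vec (B \<sigma>) z"
definition P where "P \<sigma> = residue_vec (A \<sigma>) z"

lemma clJ: "clinear J" and saJ: "cinner (J u) v = cinner u (J v)"
  using J by (auto simp: bounded_selfadjoint_def)

lemma clT: "\<sigma> \<in> {1, -1} \<Longrightarrow> clinear (T \<sigma> 0)"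
  using frl by (auto simp: finite_rank_limit_def)

lemma frlK: "\<sigma> \<in> {1, -1} \<Longrightarrow> finite_rank_limit (K \<sigma>)"
  unfolding K_def by (intro finite_rank_limit_comp_left frl clJ)

lemma frlL: "\<sigma> \<in> {1, -1} \<Longrightarrow> finite_rank_limit (L \<sigma>)"
  unfolding L_def by (intro finite_rank_limit_comp_right frl clJ)

lemma clKL: "\<sigma> \<in> {1, -1} \<Longrightarrow> clinear (K \<sigma>)" "\<sigma> \<in> {1, -1} \<Longrightarrow> clinear (L \<sigma>)"
  unfolding K_def L_def by (intro clinear_comp clT clJ; simp)+

lemma clG: "\<sigma> \<in> {1, -1} \<Longrightarrow> clinear (G \<sigma> s)" "\<sigma> \<in> {1, -1} \<Longrightarrow> clinear (G' \<sigma> s)"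
  unfolding G_def G'_def by (intro clinear_inv clinear_intros clKL; simp)+

text \<open>The scalar \<open>s\<close> is attached to \<open>T \<sigma> 0\<close> for the first two
  claims and to \<open>J\<close> for the third, so that each swap moves the intended factor.\<close>

lemma reg_swap:
  assumes "\<sigma> \<in> {1, -1}" "reg \<sigma> s"
  shows "invertible_blinfun (id_blinfun + s *\<^sub>C L \<sigma>)" "J \<odot> G' \<sigma> s = G \<sigma> s \<odot> J"
    "T \<sigma> 0 \<odot> G \<sigma> s = G' \<sigma> s \<odot> T \<sigma> 0"
proof -
  have XY: "J \<odot> (s *\<^sub>C T \<sigma> 0) = s *\<^sub>C K \<sigma>" "(s *\<^sub>C T \<sigma> 0) \<odot> J = s *\<^sub>C L \<sigma>"
    by (simp_all add: K_def L_def comp_scaleC_left comp_scaleC_right[OF clJ])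
  show inv: "invertible_blinfun (id_blinfun + s *\<^sub>C L \<sigma>)" and "J \<odot> G' \<sigma> s = G \<sigma> s \<odot> J"
    using invertible_swap[of J "s *\<^sub>C T \<sigma> 0"] assms(2)
    unfolding XY reg_def G_def G'_def by blast+
  have YX: "T \<sigma> 0 \<odot> (s *\<^sub>C J) = s *\<^sub>C L \<sigma>" "(s *\<^sub>C J) \<odot> T \<sigma> 0 = s *\<^sub>C K \<sigma>"
    by (simp_all add: K_def L_def comp_scaleC_left comp_scaleC_right[OF clT[OF assms(1)]])
  show "T \<sigma> 0 \<odot> G \<sigma> s = G' \<sigma> s \<odot> T \<sigma> 0"
    using invertible_swap(3)[of "T \<sigma> 0" "s *\<^sub>C J"] inv
    unfolding YX G_def G'_def by blast
qed

lemma reg_near: "\<sigma> \<in> {1, -1} \<Longrightarrow> \<forall>\<^sub>F s in at w. reg \<sigma> s"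
  unfolding reg_def by (rule analytic_fredholm(2)[OF frlK])

lemma meromorphic_G: "\<sigma> \<in> {1, -1} \<Longrightarrow> meromorphic_entire (G \<sigma>)" "\<sigma> \<in> {1, -1} \<Longrightarrow> meromorphic_entire (G' \<sigma>)"
  using analytic_fredholm(1)[OF frlK] analytic_fredholm(1)[OF frlL]
  by (simp_all add: G_def [abs_def] G'_def [abs_def])

lemma A_eq:
  assumes "\<sigma> \<in> {1, -1}" "reg \<sigma> s" shows "A \<sigma> s = T \<sigma> 0 \<odot> G \<sigma> s \<odot> J"
  using reg_swap(2)[OF assms] by (simp add: A_def L_def comp_assoc)

lemma G_eq:
  assumes "\<sigma> \<in> {1, -1}" "reg \<sigma> s" shows "G \<sigma> s = id_blinfun - s *\<^sub>C B \<sigma> s"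
  using inv_blinfun(1)[OF assms(2)[unfolded reg_def]]
  by (simp add: G_def B_def comp.add_left comp_scaleC_left eq_diff_eq)

text \<open>The inverse of \<open>1 + r J T(0)\<close> is \<open>1 - r J T(r)\<close> by the two
  resolvent identities; so at regular real parameters the boundary value is the value of the
  continuation.\<close>

lemma regular:
  assumes r: "r \<in> S" and \<sigma>: "\<sigma> \<in> {1, -1}"
  shows "reg \<sigma> (of_real r)" "T \<sigma> r = T \<sigma> 0 \<odot> G \<sigma> (of_real r)"
proof -
  have M: "id_blinfun + complex_of_real r *\<^sub>C K \<sigma> = id_blinfun + r *\<^sub>R (J \<odot> T \<sigma> 0)"
    by (simp add: K_def scaleR_scaleC)
  note inv = resolvent_inverse[OF res1[OF assms] res2[OF assms]]
  show "reg \<sigma> (of_real r)" unfolding reg_def M by (rule inv_blinfunI[OF inv])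
  then have "T \<sigma> r = T \<sigma> r \<odot> (id_blinfun + complex_of_real r *\<^sub>C K \<sigma>) \<odot> G \<sigma> (of_real r)"
    by (simp add: comp_assoc G_def reg_def inv_blinfun)
  then show "T \<sigma> r = T \<sigma> 0 \<odot> G \<sigma> (of_real r)" unfolding M res1[OF assms] .
qed

text \<open>The opposite boundary value is the witness that makes the \<open>THE\<close> in
  \<open>adjoint_blinfun\<close> denote.\<close>

lemma adjoint_T1: assumes r: "r \<in> S" shows "adjoint_blinfun (T 1 r) = T (-1) r"
  unfolding adjoint_blinfun_def
proof (rule the_equality)
  fix X assume "\<forall>u v. cinner (blinfun_apply X u) v = cinner u (T 1 r v)"
  then show "X = T (-1) r"
    by (intro blinfun_eqI) (rule cinner_ext_left, simp add: adj[OF r])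
qed (simp add: adj[OF r])

lemma Im_T: assumes r: "r \<in> S" shows "Im_blinfun (T 1 r) = M (of_real r)"
  by (simp add: Im_blinfun_def M_def adjoint_T1[OF r] flip: regular(2)[OF r])

lemma nonneg_Im_T: assumes r: "r \<in> S" shows "nonneg_blinfun (Im_blinfun (T 1 r))"
  unfolding nonneg_blinfun_def
proof (intro conjI allI)
  show "clinear (Im_blinfun (T 1 r))"
    unfolding Im_T[OF r] M_def by (intro clinear_intros clinear_comp clT clG) simp_all
  fix u
  have "cinner u (Im_blinfun (T 1 r) u) = (cinner u (T 1 r u) - cnj (cinner u (T 1 r u))) / (2 * \<i>)"
    using adj[OF r, of u u] cinner_commute[of u "T (-1) r u"]
    by (simp add: Im_blinfun_def adjoint_T1[OF r] blinfun.diff_left cinner_scaleC_right cinner_diff_right)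
  also have "\<dots> = complex_of_real (Im (cinner u (T 1 r u)))"
    by (simp add: complex_eq_iff)
  finally have "cinner u (Im_blinfun (T 1 r) u) = complex_of_real (Im (cinner u (T 1 r u)))" .
  then show "cinner u (Im_blinfun (T 1 r) u) \<in> \<real>" "0 \<le> Re (cinner u (Im_blinfun (T 1 r) u))"
    using pos[OF r] by simp_all
qed

lemma W: "nonneg_blinfun W" "W \<odot> W = Im_blinfun (T 1 0)" "clinear W"
  using sqrt_blinfun[OF nonneg_Im_T[OF S0]] by (auto simp: W_def nonneg_blinfun_def)

lemma Im_T0: "Im_blinfun (T 1 0) = (1 / (2 * \<i>)) *\<^sub>C (T 1 0 - T (-1) 0)"
proof -
  have "G \<sigma> 0 = id_blinfun" for \<sigma>
    unfolding G_def by (rule inv_blinfunI) (simp_all add: scaleC.zero_left)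
  then show ?thesis using Im_T[OF S0] by (simp add: M_def)
qed

text \<open>After multiplication by \<open>1 + s L \<tau>\<close> on the left and
  \<open>1 + s K \<sigma>\<close> on the right, the mixed terms \<open>s T J T\<close>
  cancel.\<close>

lemma T_diff:
  assumes "\<sigma> \<in> {1, -1}" "\<tau> \<in> {1, -1}" "reg \<sigma> s" "reg \<tau> s"
  shows "T \<sigma> 0 \<odot> G \<sigma> s - T \<tau> 0 \<odot> G \<tau> s = G' \<tau> s \<odot> (T \<sigma> 0 - T \<tau> 0) \<odot> G \<sigma> s"
proof -
  have 1: "G' \<tau> s \<odot> (id_blinfun + s *\<^sub>C L \<tau>) = id_blinfun"
    using inv_blinfun(2)[OF reg_swap(1)[OF assms(2,4)]] by (simp add: G'_def)
  have 2: "(id_blinfun + s *\<^sub>C K \<sigma>) \<odot> G \<sigma> s = id_blinfun"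
    using inv_blinfun(1) assms(3) by (simp add: G_def reg_def)
  have "(id_blinfun + s *\<^sub>C L \<tau>) \<odot> T \<sigma> 0 - T \<tau> 0 \<odot> (id_blinfun + s *\<^sub>C K \<sigma>) = T \<sigma> 0 - T \<tau> 0"
    by (simp add: comp.add_left comp.add_right comp_scaleC_left comp_scaleC_right[OF clT[OF assms(2)]]
        L_def K_def comp_assoc)
  then have "G' \<tau> s \<odot> (T \<sigma> 0 - T \<tau> 0) \<odot> G \<sigma> s =
      G' \<tau> s \<odot> ((id_blinfun + s *\<^sub>C L \<tau>) \<odot> T \<sigma> 0 - T \<tau> 0 \<odot> (id_blinfun + s *\<^sub>C K \<sigma>)) \<odot> G \<sigma> s"
    by (simp only:)
  also have "\<dots> = (G' \<tau> s \<odot> (id_blinfun + s *\<^sub>C L \<tau>)) \<odot> T \<sigma> 0 \<odot> G \<sigma> s -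
      G' \<tau> s \<odot> T \<tau> 0 \<odot> ((id_blinfun + s *\<^sub>C K \<sigma>) \<odot> G \<sigma> s)"
    by (simp only: comp.diff_left comp.diff_right comp_assoc)
  finally show ?thesis by (simp add: 1 2 reg_swap(3)[OF assms(2,4)])
qed

text \<open>\<open>T_diff\<close> with the two boundary values in either order. One function
  \<open>M\<close> thus has a factorisation for each sign, which is what later transfers the
  conditions between the signs.\<close>

lemma M_factor:
  assumes "\<sigma> \<in> {1, -1}" "reg 1 s" "reg (-1) s"
  shows "M s = G' (-\<sigma>) s \<odot> Im_blinfun (T 1 0) \<odot> G \<sigma> s"
proof -
  have *: "G' \<tau> s \<odot> (c *\<^sub>C X) \<odot> Y = c *\<^sub>C (G' \<tau> s \<odot> X \<odot> Y)" if "\<tau> \<in> {1, -1}" for \<tau> c and X Y :: "'k \<Rightarrow>\<^sub>L 'k"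
    by (simp only: comp_scaleC_right[OF clG(2)[OF that]] comp_scaleC_left)
  have p: "T 1 0 \<odot> G 1 s - T (-1) 0 \<odot> G (-1) s = G' (-1) s \<odot> (T 1 0 - T (-1) 0) \<odot> G 1 s"
    by (rule T_diff) (use assms in auto)
  have m: "T 1 0 \<odot> G 1 s - T (-1) 0 \<odot> G (-1) s = G' 1 s \<odot> (T 1 0 - T (-1) 0) \<odot> G (-1) s"
    using T_diff[of "-1" 1 s] assms(2,3)
    by (simp add: comp.diff_left comp.diff_right algebra_simps)
  show ?thesis
    using assms(1) by (auto simp: M_def Im_T0 * p) (simp add: m flip: p)
qed

lemma adjoint_T:
  "\<sigma> \<in> {1, -1} \<Longrightarrow> cinner (T (-\<sigma>) 0 u) v = cinner u (T \<sigma> 0 v)"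
  using adj[OF S0, of u v] adj[OF S0, of v u] cinner_commute[of "T 1 0 u" v] cinner_commute[of u "T (-1) 0 v"]
  by auto

lemma adjoint_G:
  assumes \<sigma>: "\<sigma> \<in> {1, -1}" and "reg \<sigma> (cnj s)" "reg (-\<sigma>) s"
  shows "cinner (G' (-\<sigma>) s u) v = cinner u (G \<sigma> (cnj s) v)"
proof -
  have \<sigma>': "-\<sigma> \<in> {1, -1}" using \<sigma> by auto
  have adjM: "cinner ((id_blinfun + s *\<^sub>C L (-\<sigma>)) u) v = cinner u ((id_blinfun + cnj s *\<^sub>C K \<sigma>) v)" for u v
    by (simp add: blinfun.add_left cinner_add_left cinner_add_right cinner_scaleC_left
        cinner_scaleC_right L_def K_def adjoint_T[OF \<sigma>] saJ)
  have "cinner (G' (-\<sigma>) s u) v = cinner (G' (-\<sigma>) s u) ((id_blinfun + cnj s *\<^sub>C K \<sigma>) (G \<sigma> (cnj s) v))"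
    using assms(2) by (simp add: G_def reg_def)
  also have "\<dots> = cinner ((id_blinfun + s *\<^sub>C L (-\<sigma>)) (G' (-\<sigma>) s u)) (G \<sigma> (cnj s) v)"
    by (rule adjM[symmetric])
  also have "\<dots> = cinner u (G \<sigma> (cnj s) v)"
    using reg_swap(1)[OF \<sigma>' assms(3)] by (simp add: G'_def)
  finally show ?thesis .
qed

text \<open>Two readings of one quantity: through \<open>M\<close> it turns a bound on
  \<open>J M J\<close> into a bound on \<open>w J\<close>, and through \<open>T\<close> it yields
  the principal part with the coefficients of (vi). The factor \<open>\<sigma>\<close> appears
  because the lower boundary value has the opposite imaginary part.\<close>

lemma norm_W_G:
  assumes \<sigma>: "\<sigma> \<in> {1, -1}" and "reg 1 (of_real r)" "reg (-1) (of_real r)"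
  shows "(norm (W (G \<sigma> (of_real r) v)))\<^sup>2 = Re (cinner v (M (of_real r) v))"
    and "(norm (W (G \<sigma> (of_real r) v)))\<^sup>2 = \<sigma> * Im (cinner v (T \<sigma> 0 (G \<sigma> (of_real r) v)))"
proof -
  have reg: "reg \<tau> (of_real r)" if "\<tau> \<in> {1, -1}" for \<tau> using assms that by auto
  have \<sigma>': "-\<sigma> \<in> {1, -1}" using \<sigma> by auto
  let ?s = "complex_of_real r"
  have adjG: "cinner (G' (-\<tau>) ?s u) v = cinner u (G \<tau> ?s v)" if "\<tau> \<in> {1, -1}" for \<tau> u v
    using adjoint_G[OF that, of ?s u v] assms(2,3) that by auto
  have adjG': "cinner u (G' (-\<tau>) ?s v) = cinner (G \<tau> ?s u) v" if "\<tau> \<in> {1, -1}" for \<tau> u v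
    using adjG[OF that, of v u] cinner_commute[of u] cinner_commute[of "G \<tau> ?s u"] by simp
  have "cinner v (M ?s v) = cinner (G \<sigma> ?s v) (Im_blinfun (T 1 0) (G \<sigma> ?s v))"
    unfolding M_factor[OF assms] by (simp add: adjG'[OF \<sigma>])
  also have "\<dots> = complex_of_real ((norm (W (G \<sigma> ?s v)))\<^sup>2)"
    unfolding W_def norm_sqrt_blinfun[OF nonneg_Im_T[OF S0]] cinner_self ..
  finally have MW: "cinner v (M ?s v) = complex_of_real ((norm (W (G \<sigma> ?s v)))\<^sup>2)" .
  then show "(norm (W (G \<sigma> ?s v)))\<^sup>2 = Re (cinner v (M ?s v))" by simp
  have "cinner v (T (-1) 0 (G (-1) ?s v)) = cinner v (G' (-1) ?s (T (-1) 0 v))"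
    using reg_swap(3)[of "-1" ?s] reg[of "-1"] by (metis blinfun_apply_blinfun_compose insertCI)
  also have "\<dots> = cinner (G 1 ?s v) (T (-1) 0 v)" using adjG'[of 1 v] by simp
  also have "\<dots> = cinner (T 1 0 (G 1 ?s v)) v" using adjoint_T[of "-1" "G 1 ?s v" v] by simp
  also have "\<dots> = cnj (cinner v (T 1 0 (G 1 ?s v)))" by (rule cinner_commute)
  finally have cc: "cinner v (T (-1) 0 (G (-1) ?s v)) = cnj (cinner v (T 1 0 (G 1 ?s v)))" .
  have "cinner v (M ?s v) = (cinner v (T 1 0 (G 1 ?s v)) - cinner v (T (-1) 0 (G (-1) ?s v))) / (2 * \<i>)"
    by (simp add: M_def blinfun.diff_left cinner_scaleC_right cinner_diff_right)
  also have "\<dots> = complex_of_real (Im (cinner v (T 1 0 (G 1 ?s v))))"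
    unfolding cc by (simp add: complex_eq_iff)
  finally have "(norm (W (G \<sigma> ?s v)))\<^sup>2 = Im (cinner v (T 1 0 (G 1 ?s v)))"
    unfolding MW of_real_eq_iff .
  then show "(norm (W (G \<sigma> ?s v)))\<^sup>2 = \<sigma> * Im (cinner v (T \<sigma> 0 (G \<sigma> ?s v)))"
    using \<sigma> cc by auto
qed

section \<open>The residues \<open>P\<close> and \<open>Q\<close> and their relation through
  \<open>J\<close>\<close>

lemma B_pole:
  assumes "\<sigma> \<in> {1, -1}"
  obtains n where "resolvent_pole (B \<sigma>) z n"
  using resolvent_pole_fredholm[OF frlK[OF assms], of z] by (auto simp: B_def [abs_def] G_def)

lemma A_pole:
  assumes "\<sigma> \<in> {1, -1}"
  obtains n where "resolvent_pole (A \<sigma>) z n"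
  using resolvent_pole_fredholm[OF frlL[OF assms], of z] by (auto simp: A_def [abs_def] G'_def)

lemma pole_G:
  assumes "\<sigma> \<in> {1, -1}"
  obtains n where "pole_order_le n (G \<sigma>) z" "pole_order_le n (G' \<sigma>) z"
proof -
  obtain n m where "pole_order_le n (G \<sigma>) z" "pole_order_le m (G' \<sigma>) z"
    using meromorphic_G[OF assms] unfolding meromorphic_entire_def by blast
  then show ?thesis
    by (intro that[OF pole_order_le_mono[OF _ max.cobounded1] pole_order_le_mono[OF _ max.cobounded2]])
qed

lemma J_P: assumes \<sigma>: "\<sigma> \<in> {1, -1}" shows "J \<odot> P \<sigma> = Q \<sigma> \<odot> J"
proof -
  obtain n where "resolvent_pole (A \<sigma>) z n" using A_pole[OF \<sigma>] .
  then interpret A: resolvent_pole "A \<sigma>" z n .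
  obtain m where "resolvent_pole (B \<sigma>) z m" using B_pole[OF \<sigma>] .
  then interpret B: resolvent_pole "B \<sigma>" z m .
  note lin = bounded_linear_comp_left[OF clJ] comp_left_scaleC[OF clJ]
  have "J \<odot> P \<sigma> = residue_vec (\<lambda>s. J \<odot> A \<sigma> s) z"
    unfolding P_def by (rule residue_vec_linear[OF A.pole lin, symmetric])
  also have "\<dots> = residue_vec (\<lambda>s. B \<sigma> s \<odot> J) z"
  proof (rule residue_vec_cong[OF pole_order_le_linear[OF A.pole lin]])
    show "\<forall>\<^sub>F s in at z. J \<odot> A \<sigma> s = B \<sigma> s \<odot> J"
      using reg_near[OF \<sigma>]
      by eventually_elim (simp add: A_eq[OF \<sigma>] B_def K_def comp_assoc)
  qed
  also have "\<dots> = Q \<sigma> \<odot> J"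
    unfolding Q_def by (rule residue_vec_linear[OF B.pole])
      (auto intro: comp.bounded_linear_left simp: comp_scaleC_left)
  finally show ?thesis .
qed

text \<open>One direction is \<open>J P = Q J\<close>. For the other, \<open>J\<close> cannot be
  cancelled; instead \<open>Q = J R\<close> for the residue \<open>R\<close> of \<open>T(s)\<close>,
  and idempotence gives \<open>Q = Q Q = Q J R = J P R\<close>.\<close>

lemma comp_J_P_eq_0_iff:
  assumes \<sigma>: "\<sigma> \<in> {1, -1}"
  shows "X \<odot> J \<odot> P \<sigma> = 0 \<longleftrightarrow> X \<odot> Q \<sigma> = 0"
proof
  assume "X \<odot> Q \<sigma> = 0"
  then have "X \<odot> Q \<sigma> \<odot> J = 0" by simp
  then show "X \<odot> J \<odot> P \<sigma> = 0" by (simp add: comp_assoc J_P[OF \<sigma>])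
next
  assume 0: "X \<odot> J \<odot> P \<sigma> = 0"
  obtain m where "resolvent_pole (B \<sigma>) z m" using B_pole[OF \<sigma>] .
  then interpret B: resolvent_pole "B \<sigma>" z m .
  obtain n where n: "pole_order_le n (G \<sigma>) z" using pole_G[OF \<sigma>] by metis
  have lin: "bounded_linear (\<lambda>X. T \<sigma> 0 \<odot> X)" "T \<sigma> 0 \<odot> (a *\<^sub>C X) = a *\<^sub>C (T \<sigma> 0 \<odot> X)" for a X
    using bounded_linear_comp_left comp_left_scaleC clT[OF \<sigma>] by blast+
  have "Q \<sigma> = residue_vec (\<lambda>s. J \<odot> (T \<sigma> 0 \<odot> G \<sigma> s)) z"
    by (simp add: Q_def B_def [abs_def] K_def comp_assoc)
  also have "\<dots> = J \<odot> residue_vec (\<lambda>s. T \<sigma> 0 \<odot> G \<sigma> s) z"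
    by (rule residue_vec_linear[OF pole_order_le_linear[OF n lin] bounded_linear_comp_left[OF clJ]
          comp_left_scaleC[OF clJ]])
  finally obtain R where R: "Q \<sigma> = J \<odot> R" by blast
  have "Q \<sigma> \<odot> Q \<sigma> = Q \<sigma>" using B.N_mult[of 0 0] by (simp add: B.N_def Q_def)
  then have "Q \<sigma> = J \<odot> P \<sigma> \<odot> R" unfolding J_P[OF \<sigma>] by (simp add: comp_assoc flip: R)
  then have "X \<odot> Q \<sigma> = (X \<odot> J \<odot> P \<sigma>) \<odot> R" by (simp add: comp_assoc)
  then show "X \<odot> Q \<sigma> = 0" using 0 by simp
qed

lemma G_Q_commute:
  assumes \<sigma>: "\<sigma> \<in> {1, -1}" and "reg \<sigma> s"
  shows "G \<sigma> s \<odot> Q \<sigma> = Q \<sigma> \<odot> G \<sigma> s"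
proof -
  obtain m where "resolvent_pole (B \<sigma>) z m" using B_pole[OF \<sigma>] .
  then interpret B: resolvent_pole "B \<sigma>" z m .
  have "\<forall>\<^sub>F t in at z. G \<sigma> s \<odot> B \<sigma> t = B \<sigma> t \<odot> G \<sigma> s"
    using reg_near[OF \<sigma>]
    by eventually_elim (use fredholm_commute(2)[OF clKL(1)[OF \<sigma>]] assms(2) in \<open>simp add: B_def G_def reg_def\<close>)
  from B.commute_N[OF clG(1)[OF \<sigma>] this] show ?thesis by (simp add: B.N_def Q_def)
qed

lemma comp_inverse_eq_0:
  fixes X Y :: "'k \<Rightarrow>\<^sub>L 'k"
  assumes "invertible_blinfun Y"
  shows "X \<odot> inv_blinfun Y = 0 \<longleftrightarrow> X = 0" "inv_blinfun Y \<odot> X = 0 \<longleftrightarrow> X = 0"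
proof -
  have "X = (X \<odot> inv_blinfun Y) \<odot> Y" "X = Y \<odot> (inv_blinfun Y \<odot> X)"
    using inv_blinfun[OF assms] by (simp_all add: comp_assoc) (simp flip: comp_assoc)
  then show "X \<odot> inv_blinfun Y = 0 \<longleftrightarrow> X = 0" "inv_blinfun Y \<odot> X = 0 \<longleftrightarrow> X = 0" by auto
qed

text \<open>\<open>Q\<close> commutes with \<open>G\<close>, so the factorisation of
  \<open>M\<close> leaves the imaginary part at 0 times \<open>Q\<close> between invertible
  operators. This makes the condition independent of the regular point.\<close>

lemma Im_T_Q_iff:
  assumes r: "r \<in> S" and \<sigma>: "\<sigma> \<in> {1, -1}"
  shows "Im_blinfun (T 1 r) \<odot> Q \<sigma> = 0 \<longleftrightarrow> W \<odot> Q \<sigma> = 0"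
proof -
  have \<sigma>': "-\<sigma> \<in> {1, -1}" using \<sigma> by auto
  note reg = regular(1)[OF r]
  have "Im_blinfun (T 1 r) \<odot> Q \<sigma> =
      G' (-\<sigma>) (of_real r) \<odot> ((Im_blinfun (T 1 0) \<odot> Q \<sigma>) \<odot> G \<sigma> (of_real r))"
    unfolding Im_T[OF r] M_factor[OF \<sigma> reg[of 1, simplified] reg[of "-1", simplified]]
    by (simp add: comp_assoc G_Q_commute[OF \<sigma> reg[OF \<sigma>]])
  also have "\<dots> = 0 \<longleftrightarrow> Im_blinfun (T 1 0) \<odot> Q \<sigma> = 0"
    unfolding G_def G'_def
    using comp_inverse_eq_0(1)[OF reg[OF \<sigma>, unfolded reg_def]]
      comp_inverse_eq_0(2)[OF reg_swap(1)[OF \<sigma>' reg[OF \<sigma>']]] by simp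
  also have "\<dots> \<longleftrightarrow> W \<odot> Q \<sigma> = 0"
    unfolding W_def by (rule sqrt_comp_eq_0_iff[OF nonneg_Im_T[OF S0], symmetric])
  finally show ?thesis .
qed

lemma sqrt_Im_T_Q_iff:
  assumes "r \<in> S" "\<sigma> \<in> {1, -1}"
  shows "sqrt_blinfun (Im_blinfun (T 1 r)) \<odot> Q \<sigma> = 0 \<longleftrightarrow> W \<odot> Q \<sigma> = 0"
  unfolding sqrt_comp_eq_0_iff[OF nonneg_Im_T[OF assms(1)]] by (rule Im_T_Q_iff[OF assms])

section \<open>The functions \<open>w\<close> and \<open>w'\<close> and their singularities\<close>

definition w where "w \<sigma> s = W \<odot> G \<sigma> s"
text \<open>Near \<open>z\<close> this is the adjoint of \<open>w \<sigma> (cnj s)\<close>; passing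
  to adjoints flips the sign of the boundary value.\<close>

definition w' where "w' \<sigma> s = G' (-\<sigma>) s \<odot> W"

lemma pole_w:
  assumes "\<sigma> \<in> {1, -1}"
  obtains n where "pole_order_le n (w \<sigma>) z" "pole_order_le n (w' \<sigma>) z"
proof -
  have "-\<sigma> \<in> {1, -1}" using assms by auto
  then obtain n m where n: "pole_order_le n (G \<sigma>) z" and m: "pole_order_le m (G' (-\<sigma>)) z"
    using pole_G[OF assms] pole_G[of "-\<sigma>"] by metis
  have "pole_order_le n (w \<sigma>) z"
    unfolding w_def [abs_def]
    by (rule pole_order_le_linear[OF n bounded_linear_comp_left[OF W(3)] comp_left_scaleC[OF W(3)]])
  moreover have "pole_order_le m (w' \<sigma>) z"
    unfolding w'_def [abs_def]
    by (rule pole_order_le_linear[OF m]) (auto intro: comp.bounded_linear_left simp: comp_scaleC_left)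
  ultimately show ?thesis
    by (intro that[OF pole_order_le_mono[OF _ max.cobounded1] pole_order_le_mono[OF _ max.cobounded2]])
qed

text \<open>\<open>G = 1 - s B\<close> gives \<open>w = W - s W B\<close>, so only the singularity
  of \<open>W B\<close> matters.\<close>

lemma W_Q_imp_holomorphic_w:
  assumes \<sigma>: "\<sigma> \<in> {1, -1}" and "W \<odot> Q \<sigma> = 0"
  shows "holomorphic_at (w \<sigma>) z"
proof -
  obtain m where "resolvent_pole (B \<sigma>) z m" using B_pole[OF \<sigma>] .
  then interpret B: resolvent_pole "B \<sigma>" z m .
  have "pole_order_le 0 (\<lambda>s. W \<odot> B \<sigma> s) z"
    by (rule B.removable_comp[OF W(3)]) (use assms(2) in \<open>simp add: B.N_def Q_def\<close>)
  from pole_order_le_diff[OF pole_order_le_const[of 0 W] pole_order_le_ident[OF this]]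
  have "pole_order_le 0 (\<lambda>s. W - s *\<^sub>C (W \<odot> B \<sigma> s)) z" by simp
  then show ?thesis unfolding holomorphic_at_def
  proof (rule pole_order_le_cong)
    show "\<forall>\<^sub>F s in at z. W - s *\<^sub>C (W \<odot> B \<sigma> s) = w \<sigma> s"
      using reg_near[OF \<sigma>]
      by eventually_elim (simp add: w_def G_eq[OF \<sigma>] comp.diff_right comp_scaleC_right[OF W(3)])
  qed
qed

lemma w_K: assumes \<sigma>: "\<sigma> \<in> {1, -1}" shows "\<forall>\<^sub>F s in at z. w \<sigma> s \<odot> K \<sigma> = W \<odot> B \<sigma> s"
  using reg_near[OF \<sigma>]
  by eventually_elim
    (simp add: w_def B_def G_def reg_def comp_assoc fredholm_commute(1)[OF clKL(1)[OF \<sigma>]])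

text \<open>\<open>K\<close> commutes with \<open>G\<close>, hence \<open>W B = w K\<close>. A
  vanishing residue of \<open>w\<close> alone therefore already gives
  \<open>W \<odot> Q \<sigma> = 0\<close>, whatever the order of the pole.\<close>

lemma W_Q_residue:
  assumes \<sigma>: "\<sigma> \<in> {1, -1}"
  shows "W \<odot> Q \<sigma> = residue_vec (\<lambda>s. w \<sigma> s \<odot> K \<sigma>) z" "W \<odot> Q \<sigma> = residue_vec (w \<sigma>) z \<odot> K \<sigma>"
proof -
  obtain m where "resolvent_pole (B \<sigma>) z m" using B_pole[OF \<sigma>] .
  then interpret B: resolvent_pole "B \<sigma>" z m .
  note lin = bounded_linear_comp_left[OF W(3)] comp_left_scaleC[OF W(3)]
  have "W \<odot> Q \<sigma> = residue_vec (\<lambda>s. W \<odot> B \<sigma> s) z"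
    unfolding Q_def by (rule residue_vec_linear[OF B.pole lin, symmetric])
  also have "\<dots> = residue_vec (\<lambda>s. w \<sigma> s \<odot> K \<sigma>) z"
    by (rule residue_vec_cong[OF pole_order_le_linear[OF B.pole lin]])
      (use w_K[OF \<sigma>] in \<open>simp add: eq_commute\<close>)
  finally show 1: "W \<odot> Q \<sigma> = residue_vec (\<lambda>s. w \<sigma> s \<odot> K \<sigma>) z" .
  obtain n where n: "pole_order_le n (w \<sigma>) z" using pole_w[OF \<sigma>] by metis
  show "W \<odot> Q \<sigma> = residue_vec (w \<sigma>) z \<odot> K \<sigma>"
    unfolding 1 by (rule residue_vec_linear[OF n])
      (auto intro: comp.bounded_linear_left simp: comp_scaleC_left)
qed

text \<open>Composing with \<open>T \<sigma> 0\<close> on the right turns \<open>w J\<close> into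
  \<open>w K\<close>.\<close>

lemma holomorphic_wJ_imp_W_Q:
  assumes \<sigma>: "\<sigma> \<in> {1, -1}" and "holomorphic_at (\<lambda>s. w \<sigma> s \<odot> J) z"
  shows "W \<odot> Q \<sigma> = 0"
proof -
  have "holomorphic_at (\<lambda>s. (w \<sigma> s \<odot> J) \<odot> T \<sigma> 0) z"
    by (rule holomorphic_at_linear[OF assms(2)]) (auto intro: comp.bounded_linear_left simp: comp_scaleC_left)
  then have "residue_vec (\<lambda>s. w \<sigma> s \<odot> K \<sigma>) z = 0"
    unfolding holomorphic_at_def K_def comp_assoc by (rule residue_vec_removable)
  then show ?thesis using W_Q_residue(1)[OF \<sigma>] by simp
qed

lemma holomorphic_w_iff:
  assumes \<sigma>: "\<sigma> \<in> {1, -1}"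
  shows "holomorphic_at (w \<sigma>) z \<longleftrightarrow> W \<odot> Q \<sigma> = 0"
    and "holomorphic_at (\<lambda>s. w \<sigma> s \<odot> J) z \<longleftrightarrow> W \<odot> Q \<sigma> = 0"
    and "residue_vec (w \<sigma>) z = 0 \<longleftrightarrow> W \<odot> Q \<sigma> = 0"
proof -
  have "holomorphic_at (\<lambda>s. w \<sigma> s \<odot> J) z" if "holomorphic_at (w \<sigma>) z"
    by (rule holomorphic_at_linear[OF that]) (auto intro: comp.bounded_linear_left simp: comp_scaleC_left)
  moreover have "residue_vec (w \<sigma>) z = 0" if "holomorphic_at (w \<sigma>) z"
    using that unfolding holomorphic_at_def by (rule residue_vec_removable)
  moreover have "W \<odot> Q \<sigma> = 0" if "residue_vec (w \<sigma>) z = 0"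
    using W_Q_residue(2)[OF \<sigma>] that by simp
  ultimately show "holomorphic_at (w \<sigma>) z \<longleftrightarrow> W \<odot> Q \<sigma> = 0"
    "holomorphic_at (\<lambda>s. w \<sigma> s \<odot> J) z \<longleftrightarrow> W \<odot> Q \<sigma> = 0"
    "residue_vec (w \<sigma>) z = 0 \<longleftrightarrow> W \<odot> Q \<sigma> = 0"
    using W_Q_imp_holomorphic_w[OF \<sigma>] holomorphic_wJ_imp_W_Q[OF \<sigma>] by blast+
qed

lemma norm_w':
  assumes \<sigma>: "\<sigma> \<in> {1, -1}"
  shows "\<forall>\<^sub>F s in at z. norm (w' \<sigma> s) = norm (w \<sigma> (cnj s))"
proof -
  have \<sigma>': "-\<sigma> \<in> {1, -1}" using \<sigma> by auto
  show ?thesis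
    using eventually_at_cnj[OF reg_near[OF \<sigma>, of z]] reg_near[OF \<sigma>', of z]
  proof eventually_elim
    case (elim s)
    have "cinner (w' \<sigma> s u) v = cinner u (w \<sigma> (cnj s) v)" for u v
      by (simp add: w'_def w_def adjoint_G[OF \<sigma> elim] nonneg_selfadjoint[OF W(1)])
    note 1 = this
    have "cinner (w \<sigma> (cnj s) u) v = cinner u (w' \<sigma> s v)" for u v
      using 1[of v u] cinner_commute[of u] cinner_commute[of "w \<sigma> (cnj s) u"] by simp
    note 2 = this
    show ?case using norm_le_if_adjoint[OF 1] norm_le_if_adjoint[OF 2] by simp
  qed
qed

text \<open>Conjugating the parameter destroys complex differentiability but keeps growth, and for a
  function with a pole of finite order boundedness is enough.\<close>

lemma holomorphic_w'_iff:
  assumes \<sigma>: "\<sigma> \<in> {1, -1}"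
  shows "holomorphic_at (w' \<sigma>) z \<longleftrightarrow> holomorphic_at (w \<sigma>) z"
proof -
  obtain n where n: "pole_order_le n (w \<sigma>) z" "pole_order_le n (w' \<sigma>) z" using pole_w[OF \<sigma>] .
  show ?thesis
  proof
    assume "holomorphic_at (w' \<sigma>) z"
    then obtain C where C: "\<forall>\<^sub>F s in at z. norm (w' \<sigma> s) \<le> C" by (rule holomorphic_at_bounded)
    have "\<forall>\<^sub>F s in at z. norm (w \<sigma> s) \<le> C"
      using eventually_at_cnj[OF C] eventually_at_cnj[OF norm_w'[OF \<sigma>]] by eventually_elim simp
    then show "holomorphic_at (w \<sigma>) z" by (rule holomorphic_at_if_bounded[OF n(1)])
  next
    assume "holomorphic_at (w \<sigma>) z"
    then obtain C where C: "\<forall>\<^sub>F s in at z. norm (w \<sigma> s) \<le> C" by (rule holomorphic_at_bounded)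
    have "\<forall>\<^sub>F s in at z. norm (w' \<sigma> s) \<le> C"
      using eventually_at_cnj[OF C] norm_w'[OF \<sigma>] by eventually_elim simp
    then show "holomorphic_at (w' \<sigma>) z" by (rule holomorphic_at_if_bounded[OF n(2)])
  qed
qed

section \<open>The imaginary part near the resonance point\<close>

lemma meromorphic_M: "meromorphic_entire M"
  unfolding meromorphic_entire_def
proof
  fix v
  obtain n m where n: "pole_order_le n (G 1) v" and m: "pole_order_le m (G (-1)) v"
    using meromorphic_G(1)[of 1, simplified] meromorphic_G(1)[of "-1", simplified]
    unfolding meromorphic_entire_def by blast
  have lin: "bounded_linear (\<lambda>X. T \<sigma> 0 \<odot> X)" "T \<sigma> 0 \<odot> (a *\<^sub>C X) = a *\<^sub>C (T \<sigma> 0 \<odot> X)"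
    if "\<sigma> \<in> {1, -1}" for \<sigma> a X
    using bounded_linear_comp_left comp_left_scaleC clT[OF that] by blast+
  have "pole_order_le (max n m) (\<lambda>s. T 1 0 \<odot> G 1 s - T (-1) 0 \<odot> G (-1) s) v"
    by (intro pole_order_le_diff pole_order_le_linear[OF n] pole_order_le_linear[OF m] lin) simp_all
  from pole_order_le_linear[OF this, of "\<lambda>X. (1 / (2 * \<i>)) *\<^sub>C X"]
  show "\<exists>n. pole_order_le n M v"
    by (auto simp: M_def [abs_def] scaleC_scaleC mult.commute scaleC.bounded_linear_right)
qed

text \<open>\<open>M = w' w\<close> is a product of two bounded functions near
  \<open>z\<close>.\<close>

lemma holomorphic_w_imp_M:
  assumes \<sigma>: "\<sigma> \<in> {1, -1}" and hol: "holomorphic_at (w \<sigma>) z"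
  shows "holomorphic_at M z"
proof -
  obtain C where C: "\<forall>\<^sub>F s in at z. norm (w \<sigma> s) \<le> C" using holomorphic_at_bounded[OF hol] .
  obtain C' where C': "\<forall>\<^sub>F s in at z. norm (w' \<sigma> s) \<le> C'"
    using holomorphic_at_bounded hol holomorphic_w'_iff[OF \<sigma>] by metis
  have "\<forall>\<^sub>F s in at z. norm (M s) \<le> C' * C"
    using C C' reg_near[of 1 z, simplified] reg_near[of "-1" z, simplified]
  proof eventually_elim
    case (elim s)
    have "M s = w' \<sigma> s \<odot> w \<sigma> s"
      unfolding M_factor[OF \<sigma> elim(3,4)] W(2)[symmetric] by (simp add: w_def w'_def comp_assoc)
    then show ?case using elim(1,2) by (simp add: norm_comp_le_mult)
  qed
  then show ?thesis
    using meromorphic_M holomorphic_at_if_bounded unfolding meromorphic_entire_def by blast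
qed

lemma holomorphic_JMJ_imp_wJ:
  assumes \<sigma>: "\<sigma> \<in> {1, -1}" and hol: "holomorphic_at (\<lambda>s. J \<odot> M s \<odot> J) z"
  shows "holomorphic_at (\<lambda>s. w \<sigma> s \<odot> J) z"
proof -
  obtain C where C: "\<forall>\<^sub>F s in at z. norm (J \<odot> M s \<odot> J) \<le> C" using holomorphic_at_bounded[OF hol] .
  obtain n where n: "pole_order_le n (w \<sigma>) z" using pole_w[OF \<sigma>] by metis
  have pole: "pole_order_le n (\<lambda>s. w \<sigma> s \<odot> J) z"
    by (rule pole_order_le_linear[OF n]) (auto intro: comp.bounded_linear_left simp: comp_scaleC_left)
  have "\<forall>\<^sub>F s in at z. norm (J \<odot> M s \<odot> J) \<le> C \<and> reg 1 s \<and> reg (-1) s"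
    using C reg_near[of 1 z, simplified] reg_near[of "-1" z, simplified] by eventually_elim simp
  \<comment> \<open>Restriction to the reals: there \<open>w' \<sigma> s\<close> is the adjoint of
    \<open>w \<sigma> s\<close>, so the form of \<open>M\<close> is a squared norm.\<close>
  then have "\<forall>\<^sub>F r in at x. norm (J \<odot> M (of_real r) \<odot> J) \<le> C \<and> reg 1 (of_real r) \<and> reg (-1) (of_real r)"
    by (rule eventually_compose_filterlim[OF _ filterlim_of_real_at])
  then have "\<forall>\<^sub>F r in at x. norm (w \<sigma> (of_real r) \<odot> J) \<le> sqrt C"
  proof eventually_elim
    case (elim r)
    then have reg: "reg 1 (of_real r)" "reg (-1) (of_real r)" and le: "norm (J \<odot> M (of_real r) \<odot> J) \<le> C"
      by auto
    have C0: "C \<ge> 0" using le norm_ge_zero order_trans by blast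
    show ?case
    proof (rule norm_blinfun_bound)
      fix v
      have "(norm ((w \<sigma> (of_real r) \<odot> J) v))\<^sup>2 = Re (cinner v ((J \<odot> M (of_real r) \<odot> J) v))"
        using norm_W_G(1)[OF \<sigma> reg, of "J v"] by (simp add: w_def saJ)
      also have "\<dots> \<le> norm v * norm ((J \<odot> M (of_real r) \<odot> J) v)"
        using complex_Re_le_cmod cinner_cauchy_schwarz order_trans by blast
      also have "\<dots> \<le> norm v * (C * norm v)"
        by (intro mult_left_mono order_trans[OF norm_blinfun] mult_right_mono le) auto
      also have "\<dots> = (sqrt C * norm v)\<^sup>2" using C0 by (simp add: power2_eq_square)
      finally show "norm ((w \<sigma> (of_real r) \<odot> J) v) \<le> sqrt C * norm v"
        by (rule power2_le_imp_le) (use C0 in simp)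
    qed (use C0 in simp)
  qed
  then show ?thesis by (rule holomorphic_at_if_bounded_on_reals[OF pole])
qed

lemma holomorphic_M_iff:
  assumes \<sigma>: "\<sigma> \<in> {1, -1}"
  shows "holomorphic_at M z \<longleftrightarrow> W \<odot> Q \<sigma> = 0"
    and "holomorphic_at (\<lambda>s. J \<odot> M s \<odot> J) z \<longleftrightarrow> W \<odot> Q \<sigma> = 0"
proof -
  have "bounded_linear (\<lambda>X. J \<odot> X \<odot> J)" "J \<odot> (a *\<^sub>C X) \<odot> J = a *\<^sub>C (J \<odot> X \<odot> J)" for a X
    by (auto intro: bounded_linear_compose[OF comp.bounded_linear_left] comp.bounded_linear_right
        simp: comp_scaleC_left comp_scaleC_right[OF clJ])
  then have "holomorphic_at (\<lambda>s. J \<odot> M s \<odot> J) z" if "holomorphic_at M z"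
    using holomorphic_at_linear[OF that] by blast
  then show "holomorphic_at M z \<longleftrightarrow> W \<odot> Q \<sigma> = 0"
    "holomorphic_at (\<lambda>s. J \<odot> M s \<odot> J) z \<longleftrightarrow> W \<odot> Q \<sigma> = 0"
    using holomorphic_w_imp_M[OF \<sigma>] holomorphic_JMJ_imp_wJ[OF \<sigma>] holomorphic_w_iff[OF \<sigma>] by blast+
qed

lemma W_Q_sign: "\<sigma> \<in> {1, -1} \<Longrightarrow> W \<odot> Q \<sigma> = 0 \<longleftrightarrow> W \<odot> Q 1 = 0"
  using holomorphic_M_iff(1)[of \<sigma>] holomorphic_M_iff(1)[of 1] by simp

section \<open>The coefficients of the principal part\<close>

definition A_nilpotent where "A_nilpotent \<sigma> = residue_vec (\<lambda>s. (s - z) *\<^sub>C A \<sigma> s) z"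

text \<open>For \<open>u\<close> in the range of \<open>P\<close> the squared norm of
  \<open>W G J u\<close> at real \<open>r\<close> is \<open>\<sigma>\<close> times a finite
  principal part with coefficients \<open>c u i\<close>. All coefficients vanish exactly when this
  norm vanishes near \<open>x\<close> for every such \<open>u\<close>, which amounts to
  \<open>W \<odot> J \<odot> P \<sigma> = 0\<close>.\<close>

lemma coefficients_eq_0_iff:
  assumes \<sigma>: "\<sigma> \<in> {1, -1}"
  shows "(\<forall>u\<in>range (P \<sigma>). \<forall>j\<ge>2. Im (cinner u (J ((blinfun_apply (A_nilpotent \<sigma>) ^^ (j - 1)) u))) = 0) \<longleftrightarrow> W \<odot> Q \<sigma> = 0"
proof -
  obtain n where "resolvent_pole (A \<sigma>) z n" using A_pole[OF \<sigma>] .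
  then interpret A: resolvent_pole "A \<sigma>" z n .
  have N0: "A.N 0 = P \<sigma>" and N1: "A.N 1 = A_nilpotent \<sigma>"
    by (simp_all add: A.N_def P_def A_nilpotent_def)
  have N_mult: "A.N i (A.N j v) = A.N (i + j) v" for i j v
    using A.N_mult[of i j] by (metis blinfun_apply_blinfun_compose)
  \<comment> \<open>At \<open>k = 0\<close> this says that \<open>A.N 0\<close> acts as the identity
    on the range of \<open>P\<close>.\<close>
  have funpow: "(blinfun_apply (A_nilpotent \<sigma>) ^^ k) (P \<sigma> v) = A.N k (P \<sigma> v)" for k v
    by (induction k) (simp_all add: N_mult flip: N0 N1)
  have P_commute: "X \<odot> P \<sigma> = P \<sigma> \<odot> X" if "clinear X" "\<forall>\<^sub>F s in at z. X \<odot> A \<sigma> s = A \<sigma> s \<odot> X" for X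
    using A.commute_N[OF that] by (simp add: N0)
  have PG': "G' \<sigma> s \<odot> P \<sigma> = P \<sigma> \<odot> G' \<sigma> s" and PA: "A \<sigma> s \<odot> P \<sigma> = P \<sigma> \<odot> A \<sigma> s" if s: "reg \<sigma> s" for s
  proof -
    note inv = reg_swap(1)[OF \<sigma>]
    have ev: "\<forall>\<^sub>F t in at z. G' \<sigma> s \<odot> A \<sigma> t = A \<sigma> t \<odot> G' \<sigma> s \<and> L \<sigma> \<odot> A \<sigma> t = A \<sigma> t \<odot> L \<sigma>"
      using reg_near[OF \<sigma>]
    proof eventually_elim
      case (elim t)
      have "G' \<sigma> s \<odot> A \<sigma> t = A \<sigma> t \<odot> G' \<sigma> s"
        unfolding A_def G'_def by (rule fredholm_commute(2)[OF clKL(2)[OF \<sigma>] inv[OF s] inv[OF elim]])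
      moreover have "L \<sigma> \<odot> A \<sigma> t = A \<sigma> t \<odot> L \<sigma>"
        by (simp only: A_def G'_def comp_assoc
            flip: fredholm_commute(1)[OF clKL(2)[OF \<sigma>] inv[OF elim] inv[OF elim]])
      ultimately show ?case by blast
    qed
    then have "G' \<sigma> s \<odot> P \<sigma> = P \<sigma> \<odot> G' \<sigma> s" "L \<sigma> \<odot> P \<sigma> = P \<sigma> \<odot> L \<sigma>"
      by (intro P_commute clG clKL \<sigma>; elim eventually_mono; simp)+
    then show "G' \<sigma> s \<odot> P \<sigma> = P \<sigma> \<odot> G' \<sigma> s" "A \<sigma> s \<odot> P \<sigma> = P \<sigma> \<odot> A \<sigma> s"
      by (simp_all add: A_def) (metis comp_assoc)
  qed
  \<comment> \<open>Collects the dependence on \<open>s\<close> in an invertible right factor: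
    vanishing at a single regular \<open>s\<close> already gives
    \<open>W \<odot> J \<odot> P \<sigma> = 0\<close>.\<close>
  have WGJP: "W \<odot> G \<sigma> s \<odot> J \<odot> P \<sigma> = (W \<odot> J \<odot> P \<sigma>) \<odot> G' \<sigma> s" if s: "reg \<sigma> s" for s
  proof -
    have "W \<odot> G \<sigma> s \<odot> J \<odot> P \<sigma> = W \<odot> (G \<sigma> s \<odot> J) \<odot> P \<sigma>" by (simp only: comp_assoc)
    also have "\<dots> = W \<odot> J \<odot> (G' \<sigma> s \<odot> P \<sigma>)"
      by (simp only: comp_assoc flip: reg_swap(2)[OF \<sigma> s])
    finally show ?thesis by (simp only: PG'[OF s] comp_assoc)
  qed
  define c where "c u i = Im (cinner u (J (A.N i u)))" for u i
  have expansion: "\<forall>\<^sub>F r in at x. reg \<sigma> (of_real r) \<and>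
      (\<forall>u\<in>range (P \<sigma>). (norm (W (G \<sigma> (of_real r) (J u))))\<^sup>2 = \<sigma> * (\<Sum>i<n. c u i / (r - x) ^ Suc i))"
  proof -
    have "\<forall>\<^sub>F s in at z. reg 1 s \<and> reg (-1) s \<and>
        (\<forall>j. A.N j \<odot> A \<sigma> s = (\<Sum>i<n. (1 / (s - z) ^ Suc i) *\<^sub>C A.N (j + i)))"
      using reg_near[of 1 z, simplified] reg_near[of "-1" z, simplified] A.N_expansion
      by eventually_elim simp
    then have "\<forall>\<^sub>F r in at x. reg 1 (of_real r) \<and> reg (-1) (of_real r) \<and>
        (\<forall>j. A.N j \<odot> A \<sigma> (of_real r) = (\<Sum>i<n. (1 / (of_real r - z) ^ Suc i) *\<^sub>C A.N (j + i)))"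
      by (rule eventually_compose_filterlim[OF _ filterlim_of_real_at])
    then show ?thesis
    proof eventually_elim
      case (elim r)
      let ?s = "complex_of_real r"
      have reg: "reg \<sigma> ?s" using elim \<sigma> by auto
      have "(norm (W (G \<sigma> ?s (J u))))\<^sup>2 = \<sigma> * (\<Sum>i<n. c u i / (r - x) ^ Suc i)" if u: "u \<in> range (P \<sigma>)" for u
      proof -
        have u': "P \<sigma> u = u" using u N_mult[of 0 0] by (auto simp: N0)
        have "T \<sigma> 0 (G \<sigma> ?s (J u)) = A \<sigma> ?s u" by (simp add: A_eq[OF \<sigma> reg])
        also have "\<dots> = (A \<sigma> ?s \<odot> P \<sigma>) u" by (simp add: u')
        also have "\<dots> = (\<Sum>i<n. (1 / (?s - z) ^ Suc i) *\<^sub>C A.N i) u"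
        proof -
          have "A.N 0 \<odot> A \<sigma> ?s = (\<Sum>i<n. (1 / (?s - z) ^ Suc i) *\<^sub>C A.N (0 + i))"
            using elim by blast
          then show ?thesis by (simp only: PA[OF reg] N0 add_0)
        qed
        also have "\<dots> = (\<Sum>i<n. complex_of_real (1 / (r - x) ^ Suc i) *\<^sub>C A.N i u)"
          by (simp add: blinfun.sum_left)
        finally have "Im (cinner (J u) (T \<sigma> 0 (G \<sigma> ?s (J u)))) =
            (\<Sum>i<n. Im (cinner (J u) (complex_of_real (1 / (r - x) ^ Suc i) *\<^sub>C A.N i u)))"
          by (simp only: cinner.sum_right Im_sum)
        also have "\<dots> = (\<Sum>i<n. c u i / (r - x) ^ Suc i)"
          by (intro sum.cong refl) (simp add: c_def saJ cinner_scaleC_right flip: of_real_diff of_real_power of_real_mult)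
        finally show ?thesis using norm_W_G(2)[OF \<sigma>, of r "J u"] elim by simp
      qed
      with reg show ?case by blast
    qed
  qed
  \<comment> \<open>Symmetry of \<open>J\<close> kills the simple pole. The coefficient with index
    \<open>i\<close> belongs to the power \<open>- (i + 1)\<close>, that is to
    \<open>j = i + 1\<close>, so the condition on \<open>j\<close> starts at 2.\<close>
  have c0: "c u 0 = 0" if "u \<in> range (P \<sigma>)" for u
  proof -
    have "A.N 0 u = u" using that N_mult[of 0 0] by (auto simp: N0)
    then have "c u 0 = Im (cinner u (J u))" by (simp add: c_def)
    also have "\<dots> = 0"
      using saJ[of u u] cinner_commute[of "J u" u] by (metis Reals_cnj_iff complex_is_Real_iff)
    finally show ?thesis .
  qed
  have coeff: "(\<forall>u\<in>range (P \<sigma>). \<forall>j\<ge>2. Im (cinner u (J ((blinfun_apply (A_nilpotent \<sigma>) ^^ (j - 1)) u))) = 0) \<longleftrightarrow>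
      (\<forall>u\<in>range (P \<sigma>). \<forall>i. c u i = 0)" (is "?C \<longleftrightarrow> ?c")
  proof
    assume C: ?C
    show ?c
    proof (intro ballI allI)
      fix u i assume u: "u \<in> range (P \<sigma>)"
      then obtain v where v: "u = P \<sigma> v" by blast
      show "c u i = 0"
      proof (cases i)
        case (Suc k)
        have "Im (cinner u (J ((blinfun_apply (A_nilpotent \<sigma>) ^^ (Suc i - 1)) u))) = 0"
          using C u Suc by (metis One_nat_def Suc_1 Suc_le_mono le_add1 plus_1_eq_Suc)
        then show ?thesis by (simp add: v funpow c_def del: funpow.simps)
      qed (use c0 u in simp)
    qed
  qed (auto simp: funpow c_def)
  show ?thesis
    unfolding coeff
  proof
    assume c: "\<forall>u\<in>range (P \<sigma>). \<forall>i. c u i = 0"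
    obtain r where r: "reg \<sigma> (of_real r)"
      "\<And>u. u \<in> range (P \<sigma>) \<Longrightarrow> (norm (W (G \<sigma> (of_real r) (J u))))\<^sup>2 = \<sigma> * (\<Sum>i<n. c u i / (r - x) ^ Suc i)"
      using eventually_happens'[OF _ expansion] by auto
    have "(W \<odot> G \<sigma> (of_real r) \<odot> J \<odot> P \<sigma>) v = 0" for v
      using r(2)[of "P \<sigma> v"] c by simp
    then have "(W \<odot> J \<odot> P \<sigma>) \<odot> G' \<sigma> (of_real r) = 0"
      unfolding WGJP[OF r(1), symmetric] by (intro blinfun_eqI) simp
    then have "W \<odot> J \<odot> P \<sigma> = 0"
      unfolding G'_def using comp_inverse_eq_0(1)[OF reg_swap(1)[OF \<sigma> r(1)]] by simp
    then show "W \<odot> Q \<sigma> = 0" by (rule comp_J_P_eq_0_iff[OF \<sigma>, THEN iffD1])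
  next
    assume "W \<odot> Q \<sigma> = 0"
    then have WJP: "W \<odot> J \<odot> P \<sigma> = 0" by (rule comp_J_P_eq_0_iff[OF \<sigma>, THEN iffD2])
    show "\<forall>u\<in>range (P \<sigma>). \<forall>i. c u i = 0"
    proof (intro ballI allI)
      fix u i assume u: "u \<in> range (P \<sigma>)"
      then obtain v where v: "u = P \<sigma> v" by blast
      have "\<forall>\<^sub>F r in at x. (\<Sum>i<n. c u i / (r - x) ^ Suc i) = 0"
        using expansion
      proof eventually_elim
        case (elim r)
        have "W (G \<sigma> (of_real r) (J u)) = (W \<odot> G \<sigma> (of_real r) \<odot> J \<odot> P \<sigma>) v" by (simp add: v)
        also have "\<dots> = 0" using WGJP[of "of_real r"] elim WJP by simp
        finally have W0: "W (G \<sigma> (of_real r) (J u)) = 0" .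
        have "(norm (W (G \<sigma> (of_real r) (J u))))\<^sup>2 = \<sigma> * (\<Sum>i<n. c u i / (r - x) ^ Suc i)"
          using elim u by blast
        then have "\<sigma> * (\<Sum>i<n. c u i / (r - x) ^ Suc i) = 0" unfolding W0 by simp
        then show ?case using \<sigma> by (simp only: mult_eq_0_iff) auto
      qed
      \<comment> \<open>For \<open>i \<ge> n\<close> the coefficient vanishes together with
        \<open>A.N i\<close>.\<close>
      from principal_part_eq_0[OF this] show "c u i = 0"
        by (cases "i < n") (auto simp: c_def A.N_eq_0 blinfun.zero_right)
    qed
  qed
qed

section \<open>Agreement with the extensions chosen by \<open>meromorphic_ext\<close>\<close>

lemma ext_A:
  assumes \<sigma>: "\<sigma> \<in> {1, -1}"
  shows "meromorphic_entire (meromorphic_ext (\<lambda>r. T \<sigma> r \<odot> J) S)"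
    and "\<forall>\<^sub>F s in at z. meromorphic_ext (\<lambda>r. T \<sigma> r \<odot> J) S s = A \<sigma> s"
proof -
  have "bounded_linear (\<lambda>X. T \<sigma> 0 \<odot> X \<odot> J)" "T \<sigma> 0 \<odot> (a *\<^sub>C X) \<odot> J = a *\<^sub>C (T \<sigma> 0 \<odot> X \<odot> J)" for a X
    by (auto intro: bounded_linear_compose[OF comp.bounded_linear_left] comp.bounded_linear_right
        simp: comp_scaleC_left comp_scaleC_right[OF clT[OF \<sigma>]])
  then have g: "meromorphic_entire (\<lambda>s. T \<sigma> 0 \<odot> G \<sigma> s \<odot> J)"
    using meromorphic_G(1)[OF \<sigma>] pole_order_le_linear unfolding meromorphic_entire_def by blast
  note ext = meromorphic_ext_eq[OF near g, of "\<lambda>r. T \<sigma> r \<odot> J", simplified regular(2)[OF _ \<sigma>, symmetric]]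
  show "meromorphic_entire (meromorphic_ext (\<lambda>r. T \<sigma> r \<odot> J) S)" by (rule ext(1)) simp
  have "\<forall>\<^sub>F s in at z. meromorphic_ext (\<lambda>r. T \<sigma> r \<odot> J) S s = T \<sigma> 0 \<odot> G \<sigma> s \<odot> J" by (rule ext(2)) simp
  then show "\<forall>\<^sub>F s in at z. meromorphic_ext (\<lambda>r. T \<sigma> r \<odot> J) S s = A \<sigma> s"
    using reg_near[OF \<sigma>] by eventually_elim (simp add: A_eq[OF \<sigma>])
qed

lemma ext_B:
  assumes \<sigma>: "\<sigma> \<in> {1, -1}"
  shows "meromorphic_entire (meromorphic_ext (\<lambda>r. J \<odot> T \<sigma> r) S)"
    and "\<forall>\<^sub>F s in at z. meromorphic_ext (\<lambda>r. J \<odot> T \<sigma> r) S s = B \<sigma> s"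
proof -
  have B: "B \<sigma> = (\<lambda>s. J \<odot> T \<sigma> 0 \<odot> G \<sigma> s)" by (simp add: fun_eq_iff B_def K_def)
  have "clinear (J \<odot> T \<sigma> 0)" by (intro clinear_comp clJ clT \<sigma>)
  then have g: "meromorphic_entire (B \<sigma>)"
    using meromorphic_G(1)[OF \<sigma>] pole_order_le_linear bounded_linear_comp_left comp_left_scaleC
    unfolding meromorphic_entire_def B by blast
  have gf: "B \<sigma> (of_real r) = J \<odot> T \<sigma> r" if "r \<in> S" for r
    by (simp only: B comp_assoc regular(2)[OF that \<sigma>])
  show "meromorphic_entire (meromorphic_ext (\<lambda>r. J \<odot> T \<sigma> r) S)"
    "\<forall>\<^sub>F s in at z. meromorphic_ext (\<lambda>r. J \<odot> T \<sigma> r) S s = B \<sigma> s"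
    using meromorphic_ext_eq[OF near g gf] by blast+
qed

lemma residue_ext:
  assumes \<sigma>: "\<sigma> \<in> {1, -1}"
  shows "residue_vec (meromorphic_ext (\<lambda>r. T \<sigma> r \<odot> J) S) z = P \<sigma>"
    and "residue_vec (meromorphic_ext (\<lambda>r. J \<odot> T \<sigma> r) S) z = Q \<sigma>"
    and "residue_vec (\<lambda>s. (s - z) *\<^sub>C meromorphic_ext (\<lambda>r. T \<sigma> r \<odot> J) S s) z = A_nilpotent \<sigma>"
proof -
  obtain n where n: "pole_order_le n (meromorphic_ext (\<lambda>r. T \<sigma> r \<odot> J) S) z"
    using ext_A(1)[OF \<sigma>] unfolding meromorphic_entire_def by blast
  obtain m where m: "pole_order_le m (meromorphic_ext (\<lambda>r. J \<odot> T \<sigma> r) S) z"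
    using ext_B(1)[OF \<sigma>] unfolding meromorphic_entire_def by blast
  show "residue_vec (meromorphic_ext (\<lambda>r. T \<sigma> r \<odot> J) S) z = P \<sigma>"
    unfolding P_def by (rule residue_vec_cong[OF n ext_A(2)[OF \<sigma>]])
  show "residue_vec (meromorphic_ext (\<lambda>r. J \<odot> T \<sigma> r) S) z = Q \<sigma>"
    unfolding Q_def by (rule residue_vec_cong[OF m ext_B(2)[OF \<sigma>]])
  show "residue_vec (\<lambda>s. (s - z) *\<^sub>C meromorphic_ext (\<lambda>r. T \<sigma> r \<odot> J) S s) z = A_nilpotent \<sigma>"
    unfolding A_nilpotent_def
    by (rule residue_vec_cong[OF pole_order_le_power[OF n, of 1, simplified]])
      (use ext_A(2)[OF \<sigma>] in eventually_elim, simp)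
qed

lemma ext_M: "\<forall>\<^sub>F s in at z. meromorphic_ext (\<lambda>r. Im_blinfun (T 1 r)) S s = M s"
  by (rule meromorphic_ext_eq(2)[OF near meromorphic_M]) (simp add: Im_T)

lemma holomorphic_ext_M_iff:
  "holomorphic_at (meromorphic_ext (\<lambda>r. Im_blinfun (T 1 r)) S) z \<longleftrightarrow> W \<odot> Q 1 = 0"
  "holomorphic_at (\<lambda>s. J \<odot> meromorphic_ext (\<lambda>r. Im_blinfun (T 1 r)) S s \<odot> J) z \<longleftrightarrow> W \<odot> Q 1 = 0"
proof -
  let ?E = "meromorphic_ext (\<lambda>r. Im_blinfun (T 1 r)) S"
  have 1: "\<forall>\<^sub>F s in at z. J \<odot> ?E s \<odot> J = J \<odot> M s \<odot> J" using ext_M by eventually_elim simp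
  have 2: "\<forall>\<^sub>F s in at z. M s = ?E s" using ext_M by eventually_elim simp
  have 3: "\<forall>\<^sub>F s in at z. J \<odot> M s \<odot> J = J \<odot> ?E s \<odot> J" using ext_M by eventually_elim simp
  show "holomorphic_at ?E z \<longleftrightarrow> W \<odot> Q 1 = 0"
    using holomorphic_at_cong[OF _ ext_M] holomorphic_at_cong[OF _ 2] holomorphic_M_iff(1)[of 1] by auto
  show "holomorphic_at (\<lambda>s. J \<odot> ?E s \<odot> J) z \<longleftrightarrow> W \<odot> Q 1 = 0"
    using holomorphic_at_cong[OF _ 1] holomorphic_at_cong[OF _ 3] holomorphic_M_iff(2)[of 1] by auto
qed

end

section \<open>Boundary values of the sandwiched resolvent\<close>

context rigged_affine_space
begin

lemma T_lim_tendsto: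
  assumes "l \<in> Lambda H F" and \<sigma>: "\<sigma> \<in> {1, -1}"
  shows "((\<lambda>y. T_op F H (Complex l (\<sigma> * y))) \<longlongrightarrow> T_lim F H l \<sigma>) (at_right 0)"
proof -
  obtain L where "((\<lambda>y. T_op F H (Complex l (\<sigma> * y))) \<longlongrightarrow> L) (at_right 0)"
    using assms unfolding Lambda_def by auto
  moreover from this have "T_lim F H l \<sigma> = L"
    unfolding T_lim_def by (intro tendsto_Lim) simp_all
  ultimately show ?thesis by simp
qed

lemma eventually_Im_Complex:
  assumes "\<sigma> \<in> {1, -1}"
  shows "\<forall>\<^sub>F y in at_right 0. Im (Complex l (\<sigma> * y)) \<noteq> 0"
  using eventually_at_right_less[of 0] by eventually_elim (use assms in auto)

lemma T_lim_finite_rank_limit: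
  assumes H: "H \<in> AA" "l \<in> Lambda H F" and \<sigma>: "\<sigma> \<in> {1, -1}"
  shows "finite_rank_limit (T_lim F H l \<sigma>)"
proof (rule finite_rank_limit_tendsto[OF T_lim_tendsto[OF H(2) \<sigma>]])
  show "\<forall>\<^sub>F y in at_right 0. finite_rank_limit (T_op F H (Complex l (\<sigma> * y)))"
    using eventually_Im_Complex[OF \<sigma>, of l]
    by eventually_elim (rule finite_rank_limit_compact[OF T_op_properties(1)[OF H(1)]])
qed simp

lemma T_lim_adjoint:
  assumes H: "H \<in> AA" "l \<in> Lambda H F"
  shows "cinner (T_lim F H l (-1) u) v = cinner u (T_lim F H l 1 v)"
proof (rule tendsto_unique)
  show "((\<lambda>y. cinner (T_op F H (Complex l (- 1 * y)) u) v) \<longlongrightarrow> cinner (T_lim F H l (-1) u) v) (at_right 0)"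
    by (intro cinner.tendsto tendsto_intros T_lim_tendsto H) simp
  have "((\<lambda>y. cinner u (T_op F H (Complex l (1 * y)) v)) \<longlongrightarrow> cinner u (T_lim F H l 1 v)) (at_right 0)"
    by (intro cinner.tendsto tendsto_intros T_lim_tendsto H) simp
  then show "((\<lambda>y. cinner (T_op F H (Complex l (- 1 * y)) u) v) \<longlongrightarrow> cinner u (T_lim F H l 1 v)) (at_right 0)"
  proof (rule Lim_transform_eventually)
    show "\<forall>\<^sub>F y in at_right 0. cinner u (T_op F H (Complex l (1 * y)) v) =
        cinner (T_op F H (Complex l (- 1 * y)) u) v"
      using eventually_at_right_less[of 0]
    proof eventually_elim
      case (elim y)
      then show ?case using T_op_adjoint[OF H(1), of "Complex l y" u v] by (simp add: complex_cnj)
    qed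
  qed
qed simp

lemma T_lim_Im_nonneg:
  assumes H: "H \<in> AA" "l \<in> Lambda H F"
  shows "0 \<le> Im (cinner u (T_lim F H l 1 u))"
proof (rule tendsto_lowerbound)
  show "((\<lambda>y. Im (cinner u (T_op F H (Complex l (1 * y)) u))) \<longlongrightarrow> Im (cinner u (T_lim F H l 1 u))) (at_right 0)"
    by (intro cinner.tendsto tendsto_intros T_lim_tendsto H) simp
  show "\<forall>\<^sub>F y in at_right 0. 0 \<le> Im (cinner u (T_op F H (Complex l (1 * y)) u))"
    using eventually_at_right_less[of 0] by eventually_elim (simp add: T_op_Im_nonneg[OF H(1)])
qed simp

lemma T_lim_path:
  assumes H0: "H0 \<in> AA" and J: "J \<in> JJ" and \<sigma>: "\<sigma> \<in> {1, -1}"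
    and Hp: "\<And>r. Hp r = op_add H0 (op_scaleR r (rigged_op F J))"
    and st: "l \<in> Lambda (Hp s) F" "l \<in> Lambda (Hp t) F"
  shows "T_lim F (Hp t) l \<sigma> \<odot> (id_blinfun + (t - s) *\<^sub>R (J \<odot> T_lim F (Hp s) l \<sigma>)) = T_lim F (Hp s) l \<sigma>"
proof (rule tendsto_unique)
  let ?T = "\<lambda>r y. T_op F (Hp r) (Complex l (\<sigma> * y))"
  have "((\<lambda>y. ?T t y \<odot> (id_blinfun + (t - s) *\<^sub>R (J \<odot> ?T s y))) \<longlongrightarrow>
      T_lim F (Hp t) l \<sigma> \<odot> (id_blinfun + (t - s) *\<^sub>R (J \<odot> T_lim F (Hp s) l \<sigma>))) (at_right 0)"
    by (intro comp.tendsto tendsto_intros T_lim_tendsto st \<sigma>)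
  then show "(?T s \<longlongrightarrow>
      T_lim F (Hp t) l \<sigma> \<odot> (id_blinfun + (t - s) *\<^sub>R (J \<odot> T_lim F (Hp s) l \<sigma>))) (at_right 0)"
    by (rule Lim_transform_eventually)
      (use eventually_Im_Complex[OF \<sigma>, of l] in eventually_elim, rule T_op_path[OF H0 J _ Hp])
  show "(?T s \<longlongrightarrow> T_lim F (Hp s) l \<sigma>) (at_right 0)" by (rule T_lim_tendsto[OF st(1) \<sigma>])
qed simp

text \<open>For small \<open>r\<close> the limit of \<open>1 + r J T(0)\<close> is invertible by the
  Neumann series. The inverses off the axis are \<open>1 - r J T(r)\<close>, so they converge, and
  \<open>T(0)\<close> times them is \<open>T(r)\<close>. This provides the regular points near 0
  from which the continuation is determined.\<close>

lemma Lambda_near: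
  assumes H0: "H0 \<in> AA" "l \<in> Lambda H0 F" and J: "J \<in> JJ"
    and Hp: "\<And>r. Hp r = op_add H0 (op_scaleR r (rigged_op F J))"
  shows "\<forall>\<^sub>F r in at 0. l \<in> Lambda (Hp r) F"
proof -
  have Hp0: "Hp 0 = H0" unfolding Hp by (rule path_zero[OF H0(1) J])
  have small: "\<forall>\<^sub>F r in at 0. norm (r *\<^sub>R (J \<odot> T_lim F H0 l \<sigma>)) < 1" for \<sigma>
  proof -
    have "((\<lambda>r. norm (r *\<^sub>R (J \<odot> T_lim F H0 l \<sigma>))) \<longlongrightarrow> norm (0 *\<^sub>R (J \<odot> T_lim F H0 l \<sigma>))) (at 0)"
      by (intro tendsto_intros)
    from order_tendstoD(2)[OF this, of 1] show ?thesis by simp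
  qed
  have conv: "\<exists>L. ((\<lambda>y. T_op F (Hp r) (Complex l (\<sigma> * y))) \<longlongrightarrow> L) (at_right 0)"
    if \<sigma>: "\<sigma> \<in> {1, -1}" and r: "norm (r *\<^sub>R (J \<odot> T_lim F H0 l \<sigma>)) < 1" for r \<sigma>
  proof -
    let ?T = "\<lambda>r y. T_op F (Hp r) (Complex l (\<sigma> * y))"
    let ?M = "id_blinfun + r *\<^sub>R (J \<odot> T_lim F H0 l \<sigma>)"
    have T0: "(?T 0 \<longlongrightarrow> T_lim F H0 l \<sigma>) (at_right 0)"
      unfolding Hp0 by (rule T_lim_tendsto[OF H0(2) \<sigma>])
    have path: "?T t y \<odot> (id_blinfun + (t - s) *\<^sub>R (J \<odot> ?T s y)) = ?T s y"
      if "Im (Complex l (\<sigma> * y)) \<noteq> 0" for s t y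
      by (rule T_op_path[OF H0(1) J that Hp])
    have "((\<lambda>y. id_blinfun - r *\<^sub>R (J \<odot> ?T r y)) \<longlongrightarrow> inv_blinfun ?M) (at_right 0)"
    proof (rule tendsto_inv_blinfun)
      show "((\<lambda>y. id_blinfun + r *\<^sub>R (J \<odot> ?T 0 y)) \<longlongrightarrow> ?M) (at_right 0)"
        by (intro comp.tendsto tendsto_intros T0)
      show "invertible_blinfun ?M" by (rule invertible_id_plus[OF r])
      show "\<forall>\<^sub>F y in at_right 0.
          (id_blinfun + r *\<^sub>R (J \<odot> ?T 0 y)) \<odot> (id_blinfun - r *\<^sub>R (J \<odot> ?T r y)) = id_blinfun \<and>
          (id_blinfun - r *\<^sub>R (J \<odot> ?T r y)) \<odot> (id_blinfun + r *\<^sub>R (J \<odot> ?T 0 y)) = id_blinfun"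
        using eventually_Im_Complex[OF \<sigma>, of l]
      proof eventually_elim
        case (elim y)
        have "?T r y \<odot> (id_blinfun + r *\<^sub>R (J \<odot> ?T 0 y)) = ?T 0 y"
          using path[OF elim, of r 0] by simp
        moreover have "?T 0 y \<odot> (id_blinfun - r *\<^sub>R (J \<odot> ?T r y)) = ?T r y"
          using path[OF elim, of 0 r] by simp
        ultimately show ?case by (intro conjI resolvent_inverse)
      qed
    qed
    then have "((\<lambda>y. ?T 0 y \<odot> (id_blinfun - r *\<^sub>R (J \<odot> ?T r y))) \<longlongrightarrow>
        T_lim F H0 l \<sigma> \<odot> inv_blinfun ?M) (at_right 0)"
      by (intro comp.tendsto T0)
    then have "(?T r \<longlongrightarrow> T_lim F H0 l \<sigma> \<odot> inv_blinfun ?M) (at_right 0)"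
      by (rule Lim_transform_eventually)
        (use eventually_Im_Complex[OF \<sigma>, of l] path[of _ 0 r] in \<open>auto elim!: eventually_mono\<close>)
    then show ?thesis ..
  qed
  from small[of 1] small[of "-1"] show ?thesis
  proof eventually_elim
    case (elim r)
    then show ?case using conv[of 1 r] conv[of "-1" r] unfolding Lambda_def by simp
  qed
qed

lemma resonance_path:
  assumes H0: "H0 \<in> AA" "l \<in> Lambda H0 F" and J: "J \<in> JJ"
    and Hp: "\<And>r. Hp r = op_add H0 (op_scaleR r (rigged_op F J))"
  shows "resonance_path (\<lambda>\<sigma> r. T_lim F (Hp r) l \<sigma>) J (regular_points F Hp l)"
proof
  have Hp0: "Hp 0 = H0" unfolding Hp by (rule path_zero[OF H0(1) J])
  have AA: "Hp r \<in> AA" for r unfolding Hp by (rule path_in_AA[OF H0(1) J])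
  show "bounded_selfadjoint J" by (rule JJ_selfadjoint[OF J])
  show "finite_rank_limit (T_lim F (Hp 0) l \<sigma>)" if "\<sigma> \<in> {1, -1}" for \<sigma>
    unfolding Hp0 by (rule T_lim_finite_rank_limit[OF H0 that])
  show "0 \<in> regular_points F Hp l" using H0(2) by (simp add: regular_points_def Hp0)
  show "\<forall>\<^sub>F r in at 0. r \<in> regular_points F Hp l"
    unfolding regular_points_def mem_Collect_eq by (rule Lambda_near[OF H0 J Hp])
  fix r assume "r \<in> regular_points F Hp l"
  then have r: "l \<in> Lambda (Hp r) F" by (simp add: regular_points_def)
  show "cinner (T_lim F (Hp r) l (-1) u) v = cinner u (T_lim F (Hp r) l 1 v)" for u v
    by (rule T_lim_adjoint[OF AA r])
  show "0 \<le> Im (cinner u (T_lim F (Hp r) l 1 u))" for u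
    by (rule T_lim_Im_nonneg[OF AA r])
  have 0: "l \<in> Lambda (Hp 0) F" using H0(2) by (simp add: Hp0)
  fix \<sigma> :: real assume \<sigma>: "\<sigma> \<in> {1, -1}"
  show "T_lim F (Hp r) l \<sigma> \<odot> (id_blinfun + r *\<^sub>R (J \<odot> T_lim F (Hp 0) l \<sigma>)) = T_lim F (Hp 0) l \<sigma>"
    using T_lim_path[OF H0(1) J \<sigma> Hp 0 r] by simp
  \<comment> \<open>The path identity with base point \<open>r\<close> and target 0, whence the
    minus sign.\<close>
  show "T_lim F (Hp 0) l \<sigma> \<odot> (id_blinfun - r *\<^sub>R (J \<odot> T_lim F (Hp r) l \<sigma>)) = T_lim F (Hp r) l \<sigma>"
    using T_lim_path[OF H0(1) J \<sigma> Hp r 0] by simp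
qed

end

theorem theorem1p38:
  fixes F :: "('h::complex_hilbert, 'k::complex_hilbert) operator"
    and JJ :: "('k \<Rightarrow>\<^sub>L 'k) set"
    and AA :: "('h, 'h) operator set"
    and D :: "'h set"
    and l :: real
    and H0 V :: "('h, 'h) operator"
    and J :: "'k \<Rightarrow>\<^sub>L 'k"
    and Hp :: "real \<Rightarrow> ('h, 'h) operator"
    and rl :: real
  assumes setting: "rigged_affine_space F JJ AA D"
    and l: "l \<in> essentially_regular AA F"
    and H0: "H0 \<in> AA" "l \<in> Lambda H0 F"
    and V: "J \<in> JJ" "V = rigged_op F J"
    and Hp: "Hp = (\<lambda>r. op_add H0 (op_scaleR r V))"
    and resonance: "rl \<notin> regular_points F Hp l"
  shows
    "(\<forall>\<sigma>\<in>{1, -1}.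
       (\<comment> \<open>(i)\<close>
        (\<forall>r\<in>regular_points F Hp l.
           sqrt_blinfun (Im_blinfun (T_lim F (Hp r) l 1)) o\<^sub>L J o\<^sub>L P_res F J Hp l \<sigma> rl = 0)
          \<longleftrightarrow> type_I F J Hp l rl) \<and>
       (\<comment> \<open>(i*)\<close>
        (\<exists>r\<in>regular_points F Hp l.
           sqrt_blinfun (Im_blinfun (T_lim F (Hp r) l 1)) o\<^sub>L J o\<^sub>L P_res F J Hp l \<sigma> rl = 0)
          \<longleftrightarrow> type_I F J Hp l rl) \<and>
       (\<comment> \<open>(ii)\<close>
        (\<forall>r\<in>regular_points F Hp l.
           sqrt_blinfun (Im_blinfun (T_lim F (Hp r) l 1)) o\<^sub>L Q_res F J Hp l \<sigma> rl = 0)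
          \<longleftrightarrow> type_I F J Hp l rl) \<and>
       (\<comment> \<open>(ii*)\<close>
        (\<exists>r\<in>regular_points F Hp l.
           sqrt_blinfun (Im_blinfun (T_lim F (Hp r) l 1)) o\<^sub>L Q_res F J Hp l \<sigma> rl = 0)
          \<longleftrightarrow> type_I F J Hp l rl) \<and>
       (\<comment> \<open>(iii)\<close>
        holomorphic_at (w_fun F J H0 l \<sigma>) (complex_of_real rl)
          \<longleftrightarrow> type_I F J Hp l rl) \<and>
       (\<comment> \<open>(iii')\<close>
        holomorphic_at (\<lambda>s. w_fun F J H0 l \<sigma> s o\<^sub>L J) (complex_of_real rl)
          \<longleftrightarrow> type_I F J Hp l rl) \<and>
       (\<comment> \<open>the identity of meromorphic functions displayed in (iii')\<close>
        \<forall>s. invertible_blinfun (id_blinfun + s *\<^sub>C (J o\<^sub>L T_lim F H0 l \<sigma>)) \<longrightarrow>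
          invertible_blinfun (id_blinfun + s *\<^sub>C (T_lim F H0 l \<sigma> o\<^sub>L J)) \<and>
          w_fun F J H0 l \<sigma> s o\<^sub>L J = wJ_fun F J H0 l \<sigma> s) \<and>
       (\<comment> \<open>(iv)\<close>
        holomorphic_at (w_dagger F J H0 l \<sigma>) (complex_of_real rl)
          \<longleftrightarrow> type_I F J Hp l rl) \<and>
       (\<comment> \<open>(v)\<close>
        residue_vec (w_fun F J H0 l \<sigma>) (complex_of_real rl) = 0
          \<longleftrightarrow> type_I F J Hp l rl) \<and>
       (\<comment> \<open>(vi)\<close>
        (\<forall>u\<in>Upsilon F J Hp l \<sigma> rl. \<forall>j\<ge>2. c_coeff F J Hp l \<sigma> rl u j = 0)
          \<longleftrightarrow> type_I F J Hp l rl) \<and>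
       (\<comment> \<open>(i) without the square root\<close>
        (\<forall>r\<in>regular_points F Hp l.
           Im_blinfun (T_lim F (Hp r) l 1) o\<^sub>L J o\<^sub>L P_res F J Hp l \<sigma> rl = 0)
          \<longleftrightarrow> type_I F J Hp l rl) \<and>
       (\<comment> \<open>(i*) without the square root\<close>
        (\<exists>r\<in>regular_points F Hp l.
           Im_blinfun (T_lim F (Hp r) l 1) o\<^sub>L J o\<^sub>L P_res F J Hp l \<sigma> rl = 0)
          \<longleftrightarrow> type_I F J Hp l rl) \<and>
       (\<comment> \<open>(ii) without the square root\<close>
        (\<forall>r\<in>regular_points F Hp l.
           Im_blinfun (T_lim F (Hp r) l 1) o\<^sub>L Q_res F J Hp l \<sigma> rl = 0)
          \<longleftrightarrow> type_I F J Hp l rl) \<and>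
       (\<comment> \<open>(ii*) without the square root\<close>
        (\<exists>r\<in>regular_points F Hp l.
           Im_blinfun (T_lim F (Hp r) l 1) o\<^sub>L Q_res F J Hp l \<sigma> rl = 0)
          \<longleftrightarrow> type_I F J Hp l rl)) \<and>
     (\<comment> \<open>(vii)\<close>
      holomorphic_at (ImT_fun F Hp l) (complex_of_real rl)
        \<longleftrightarrow> type_I F J Hp l rl) \<and>
     (\<comment> \<open>(viii)\<close>
      holomorphic_at (\<lambda>s. J o\<^sub>L ImT_fun F Hp l s o\<^sub>L J) (complex_of_real rl)
        \<longleftrightarrow> type_I F J Hp l rl)"
proof -
  interpret rigged_affine_space F JJ AA D by (rule setting)
  have Hp': "Hp r = op_add H0 (op_scaleR r (rigged_op F J))" for r by (simp add: Hp V(2))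
  have Hp0: "Hp 0 = H0" unfolding Hp' by (rule path_zero[OF H0(1) V(1)])
  interpret R: resonance_path "\<lambda>\<sigma> r. T_lim F (Hp r) l \<sigma>" J "regular_points F Hp l" rl
    by (rule resonance_path[OF H0 V(1) Hp'])
  have residues: "P_res F J Hp l \<sigma> rl = R.P \<sigma>" "Q_res F J Hp l \<sigma> rl = R.Q \<sigma>"
    "A_nil F J Hp l \<sigma> rl = R.A_nilpotent \<sigma>" if "\<sigma> \<in> {1, -1}" for \<sigma>
    using R.residue_ext[OF that] by (simp_all add: P_res_def Q_res_def A_nil_def A_fun_def B_fun_def)
  have w: "w_fun F J H0 l \<sigma> = R.w \<sigma>" "w_dagger F J H0 l \<sigma> = R.w' \<sigma>" for \<sigma>
    by (simp_all add: fun_eq_iff w_fun_def w_dagger_def R.w_def R.w'_def R.W_def R.G_def R.G'_def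
        R.K_def R.L_def Hp0)
  have ImT: "ImT_fun F Hp l = meromorphic_ext (\<lambda>r. Im_blinfun (T_lim F (Hp r) l 1)) (regular_points F Hp l)"
    by (simp add: ImT_fun_def)
  define I where "I \<longleftrightarrow> R.W \<odot> R.Q 1 = 0"
  have WQ: "R.W \<odot> R.Q \<sigma> = 0 \<longleftrightarrow> I" if "\<sigma> \<in> {1, -1}" for \<sigma>
    unfolding I_def by (rule R.W_Q_sign[OF that])
  have pointwise:
    "sqrt_blinfun (Im_blinfun (T_lim F (Hp r) l 1)) \<odot> J \<odot> P_res F J Hp l \<sigma> rl = 0 \<longleftrightarrow> I"
    "sqrt_blinfun (Im_blinfun (T_lim F (Hp r) l 1)) \<odot> Q_res F J Hp l \<sigma> rl = 0 \<longleftrightarrow> I"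
    "Im_blinfun (T_lim F (Hp r) l 1) \<odot> J \<odot> P_res F J Hp l \<sigma> rl = 0 \<longleftrightarrow> I"
    "Im_blinfun (T_lim F (Hp r) l 1) \<odot> Q_res F J Hp l \<sigma> rl = 0 \<longleftrightarrow> I"
    if "r \<in> regular_points F Hp l" "\<sigma> \<in> {1, -1}" for r \<sigma>
    using R.sqrt_Im_T_Q_iff[OF that] R.Im_T_Q_iff[OF that] WQ[OF that(2)]
    by (simp_all add: residues[OF that(2)] R.comp_J_P_eq_0_iff[OF that(2)])
  have type_I: "type_I F J Hp l rl \<longleftrightarrow> I"
    unfolding type_I_def using pointwise(1)[of _ 1] R.S0 by auto
  have coefficients: "(\<forall>u\<in>Upsilon F J Hp l \<sigma> rl. \<forall>j\<ge>2. c_coeff F J Hp l \<sigma> rl u j = 0) \<longleftrightarrow> I"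
    if "\<sigma> \<in> {1, -1}" for \<sigma>
    using R.coefficients_eq_0_iff[OF that] WQ[OF that]
    by (simp add: Upsilon_def c_coeff_def residues[OF that])
  have displayed: "invertible_blinfun (id_blinfun + s *\<^sub>C (T_lim F H0 l \<sigma> \<odot> J)) \<and>
      w_fun F J H0 l \<sigma> s \<odot> J = wJ_fun F J H0 l \<sigma> s"
    if \<sigma>: "\<sigma> \<in> {1, -1}" and inv: "invertible_blinfun (id_blinfun + s *\<^sub>C (J \<odot> T_lim F H0 l \<sigma>))" for \<sigma> s
  proof -
    have reg: "R.reg \<sigma> s" using inv by (simp add: R.reg_def R.K_def Hp0)
    have "w_fun F J H0 l \<sigma> s \<odot> J = R.W \<odot> (R.G \<sigma> s \<odot> J)" by (simp add: w R.w_def comp_assoc)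
    also have "\<dots> = R.W \<odot> (J \<odot> R.G' \<sigma> s)" by (simp only: R.reg_swap(2)[OF \<sigma> reg])
    also have "\<dots> = wJ_fun F J H0 l \<sigma> s"
      by (simp add: wJ_fun_def R.W_def R.G'_def R.L_def Hp0 comp_assoc)
    finally show ?thesis using R.reg_swap(1)[OF \<sigma> reg] by (simp add: R.L_def Hp0)
  qed
  have holomorphic:
    "holomorphic_at (w_fun F J H0 l \<sigma>) (complex_of_real rl) \<longleftrightarrow> I"
    "holomorphic_at (\<lambda>s. w_fun F J H0 l \<sigma> s \<odot> J) (complex_of_real rl) \<longleftrightarrow> I"
    "holomorphic_at (w_dagger F J H0 l \<sigma>) (complex_of_real rl) \<longleftrightarrow> I"
    "residue_vec (w_fun F J H0 l \<sigma>) (complex_of_real rl) = 0 \<longleftrightarrow> I"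
    if "\<sigma> \<in> {1, -1}" for \<sigma>
    using R.holomorphic_w_iff[OF that] R.holomorphic_w'_iff[OF that] WQ[OF that]
    by (simp_all add: w)
  have Im_holomorphic:
    "holomorphic_at (ImT_fun F Hp l) (complex_of_real rl) \<longleftrightarrow> I"
    "holomorphic_at (\<lambda>s. J \<odot> ImT_fun F Hp l s \<odot> J) (complex_of_real rl) \<longleftrightarrow> I"
    unfolding ImT I_def by (rule R.holomorphic_ext_M_iff)+
  \<comment> \<open>Each pointwise condition has the same truth value at all regular points, and 0
    is one of them, so the universal and the existential form coincide.\<close>
  have ex_all: "(\<forall>r\<in>regular_points F Hp l. X r) \<longleftrightarrow> I" "(\<exists>r\<in>regular_points F Hp l. X r) \<longleftrightarrow> I"
    if "\<And>r. r \<in> regular_points F Hp l \<Longrightarrow> X r \<longleftrightarrow> I" for X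
    using that R.S0 by auto
  show ?thesis
    unfolding type_I
    by (intro conjI ballI allI impI displayed[THEN conjunct1] displayed[THEN conjunct2] holomorphic
        coefficients Im_holomorphic ex_all pointwise; assumption)
qed

end
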